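(* Let $\Omega\subset\mathbb{R}^2$ be open, let $H:\mathbb{R}^2\to\mathbb{R}$ be a convex $C^2$ function such that for every $\delta>0$ there exists $c_\delta>0$ with $D^2H(z)\ge c_\delta I_2$ for all $|z|\ge 1+\delta$, and set $F=\nabla H$. Let $\varepsilon>0$, $f\in L^{2+\varepsilon}(\Omega)$, let $u$ be a solution of $\nabla\cdot(F(\nabla u))=f$ in $\Omega$, and fix $\delta>0$. Suppose that $v_\delta:=\left(\frac{\partial u}{\partial x_1}-(1+\delta)\right)_+$ belongs to $H^1(\Omega)\cap L^\infty(\Omega)$ and that $D^2H(\nabla u)\le\bar C I_2$ in $\Omega$ for some constant $\bar C$. Then $v_\delta$ is continuous on $\Omega$, and for every $\Omega_0\subset\Omega$ with $d(\Omega_0,\partial\Omega)>0$ one has $$|v_\delta(x)-v_\delta(y)|\le C\,\big|\ln|x-y|\big|^{-1/2}\qquad\text{for all }x,y\in\Omega_0\text{ with }0<|x-y|<1,$$ where the constant $C$ depends only on $\varepsilon$, $\|f\|_{L^{2+\varepsilon}}$, $\|v_\delta\|_{L^\infty}$, $\|v_\delta\|_{H^1}$, $c_\delta$, $\bar C$ and $d(\Omega_0,\partial\Omega)$.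
   Context: $I_2$ is the identity matrix and $t_+=\max\{t,0\}$; matrix inequalities are between symmetric matrices. Convention on solutions: $u$ is a weak solution which is assumed regular enough, namely $u\in H^2_{loc}(\Omega)$, for the equation to be differentiated, so that $v=\partial u/\partial x_1$ satisfies $\nabla\cdot(D^2H(\nabla u)\nabla v)=\partial f/\partial x_1$ in the sense of distributions; the quantitative content is that $C$ depends on $u$, $f$, $H$ only through the listed quantities (in particular not on the $H^2$ norm of $u$). Continuity is meant for the continuous representative of $v_\delta$. *)

theory Defs
  imports "HOL-Analysis.Analysis" "HOL-Probability.Essential_Supremum"
begin

subsection \<open>Classical derivatives\<close>

definition partial :: "'n::finite \<Rightarrow> (real^'n \<Rightarrow> real) \<Rightarrow> real^'n \<Rightarrow> real" where
  "partial i f x = frechet_derivative f (at x) (axis i 1)"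

definition grad :: "(real^'n \<Rightarrow> real) \<Rightarrow> real^'n \<Rightarrow> real^'n::finite" where
  "grad f x = (\<chi> i. partial i f x)"

definition hess :: "(real^'n \<Rightarrow> real) \<Rightarrow> real^'n \<Rightarrow> real^'n^'n::finite" where
  "hess f x = jacobian (grad f) (at x)"

definition C2 :: "(real^'n::finite \<Rightarrow> real) \<Rightarrow> bool" where
  "C2 f \<longleftrightarrow> (\<forall>x. f differentiable at x) \<and> (\<forall>x. grad f differentiable at x) \<and>
     continuous_on UNIV (hess f)"

text \<open>Being coinductive, this is infinite differentiability: all iterated partial derivatives
  exist and are again differentiable.\<close>

coinductive smooth :: "(real^'n::finite \<Rightarrow> real) \<Rightarrow> bool" where
  "\<lbrakk>\<And>x. f differentiable at x; \<And>i. smooth (partial i f)\<rbrakk> \<Longrightarrow> smooth f"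

definition test_functions :: "(real^'n::finite) set \<Rightarrow> (real^'n \<Rightarrow> real) set" where
  "test_functions S =
     {\<phi>. smooth \<phi> \<and> compact (closure {x. \<phi> x \<noteq> 0}) \<and> closure {x. \<phi> x \<noteq> 0} \<subseteq> S}"

text \<open>The order on symmetric matrices. Symmetry of a Hessian is automatic for \<^const>\<open>C2\<close>
  functions.\<close>

definition loewner_le :: "real^'n^'n::finite \<Rightarrow> real^'n^'n \<Rightarrow> bool" where
  "loewner_le A B \<longleftrightarrow> transpose A = A \<and> transpose B = B \<and> (\<forall>\<xi>. \<xi> \<bullet> (A *v \<xi>) \<le> \<xi> \<bullet> (B *v \<xi>))"

subsection \<open>Lebesgue spaces\<close>

definition Lp :: "real \<Rightarrow> 'a::euclidean_space set \<Rightarrow> ('a \<Rightarrow> 'b::euclidean_space) set" where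
  "Lp p S = {f \<in> borel_measurable (lebesgue_on S). integrable (lebesgue_on S) (\<lambda>x. norm (f x) powr p)}"

definition Lp_norm :: "real \<Rightarrow> 'a::euclidean_space set \<Rightarrow> ('a \<Rightarrow> 'b::euclidean_space) \<Rightarrow> real" where
  "Lp_norm p S f = (LINT x|lebesgue_on S. norm (f x) powr p) powr (1 / p)"

definition Lp_loc :: "real \<Rightarrow> 'a::euclidean_space set \<Rightarrow> ('a \<Rightarrow> 'b::euclidean_space) set" where
  "Lp_loc p S = {f. \<forall>K. compact K \<and> K \<subseteq> S \<longrightarrow> f \<in> Lp p K}"

definition Linf :: "'a::euclidean_space set \<Rightarrow> ('a \<Rightarrow> real) set" where
  "Linf S = {f \<in> borel_measurable (lebesgue_on S). esssup (lebesgue_on S) (\<lambda>x. ennreal \<bar>f x\<bar>) < \<infinity>}"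

definition Linf_norm :: "'a::euclidean_space set \<Rightarrow> ('a \<Rightarrow> real) \<Rightarrow> real" where
  "Linf_norm S f = enn2real (esssup (lebesgue_on S) (\<lambda>x. ennreal \<bar>f x\<bar>))"

subsection \<open>Weak derivatives and Sobolev spaces\<close>

definition has_weak_grad :: "(real^'n::finite) set \<Rightarrow> (real^'n \<Rightarrow> real) \<Rightarrow> (real^'n \<Rightarrow> real^'n) \<Rightarrow> bool" where
  "has_weak_grad S u G \<longleftrightarrow> u \<in> Lp_loc 1 S \<and> G \<in> Lp_loc 1 S \<and>
     (\<forall>\<phi>\<in>test_functions S.
        (LINT x|lebesgue_on S. u x *\<^sub>R grad \<phi> x) = - (LINT x|lebesgue_on S. \<phi> x *\<^sub>R G x))"

text \<open>The weak gradient is unique up to null sets; some representative is picked. It is meaningful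
  only if a weak gradient exists.\<close>

definition weak_grad :: "(real^'n::finite) set \<Rightarrow> (real^'n \<Rightarrow> real) \<Rightarrow> real^'n \<Rightarrow> real^'n" where
  "weak_grad S u = (SOME G. has_weak_grad S u G)"

definition H1 :: "(real^'n::finite) set \<Rightarrow> (real^'n \<Rightarrow> real) set" where
  "H1 S = {u \<in> Lp 2 S. (\<exists>G. has_weak_grad S u G) \<and> weak_grad S u \<in> Lp 2 S}"

definition H1_norm :: "(real^'n::finite) set \<Rightarrow> (real^'n \<Rightarrow> real) \<Rightarrow> real" where
  "H1_norm S u = sqrt ((Lp_norm 2 S u)\<^sup>2 + (Lp_norm 2 S (weak_grad S u))\<^sup>2)"

definition H1_loc :: "(real^'n::finite) set \<Rightarrow> (real^'n \<Rightarrow> real) set" where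
  "H1_loc S = {u \<in> Lp_loc 2 S. (\<exists>G. has_weak_grad S u G) \<and> weak_grad S u \<in> Lp_loc 2 S}"

definition H2_loc :: "(real^'n::finite) set \<Rightarrow> (real^'n \<Rightarrow> real) set" where
  "H2_loc S = {u \<in> H1_loc S. \<forall>i. (\<lambda>x. weak_grad S u x $ i) \<in> H1_loc S}"

subsection \<open>The equation\<close>

text \<open>Weak solutions of \<open>div (F (\<nabla>u)) = f\<close> in \<open>S\<close>.\<close>

definition weak_solution ::
  "(real^'n::finite) set \<Rightarrow> (real^'n \<Rightarrow> real^'n) \<Rightarrow> (real^'n \<Rightarrow> real) \<Rightarrow> (real^'n \<Rightarrow> real) \<Rightarrow> bool" where
  "weak_solution S F f u \<longleftrightarrow> (\<lambda>x. F (weak_grad S u x)) \<in> Lp_loc 1 S \<and>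
     (\<forall>\<phi>\<in>test_functions S.
        (LINT x|lebesgue_on S. F (weak_grad S u x) \<bullet> grad \<phi> x) = - (LINT x|lebesgue_on S. f x * \<phi> x))"

definition excess :: "(real^2) set \<Rightarrow> (real^2 \<Rightarrow> real) \<Rightarrow> real \<Rightarrow> real^2 \<Rightarrow> real" where
  "excess S u \<delta> x = max (weak_grad S u x $ 1 - (1 + \<delta>)) 0"

text \<open>Extended-valued, so that the distance to an empty boundary (\<open>S = UNIV\<close>) is \<open>\<infinity>\<close>; the
  library's \<^const>\<open>setdist\<close> would give \<open>0\<close>.\<close>

definition set_edist :: "'a::metric_space set \<Rightarrow> 'a set \<Rightarrow> ennreal" where
  "set_edist A B = (INF x\<in>A. INF y\<in>B. ennreal (dist x y))"

end

theory Submission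
  imports Defs
begin

text \<open>Let \<open>v = \<partial>\<^sub>1 u\<close> and \<open>w = (v - (1 + \<delta>))\<^sub>+\<close>. Differentiating the equation gives
  \<open>\<integral> D\<^sup>2H(\<nabla>u) \<nabla>v \<bullet> \<nabla>\<phi> = \<integral> f \<partial>\<^sub>1\<phi>\<close>. Since \<open>\<nabla>w\<close> is \<open>\<nabla>v\<close> on \<open>{v > 1 + \<delta>}\<close> and \<open>0\<close> elsewhere, and
  \<open>D\<^sup>2H(\<nabla>u) \<ge> c\<^sub>\<delta>\<close> on that set, testing with truncations of \<open>w\<close> from above or from below only sees
  the elliptic region. Stampacchia's iteration with \<open>f \<in> L\<close> to the power \<open>2 + \<epsilon>\<close> then shows that on a
  square of half-side \<open>R\<close> the values of \<open>w\<close> lie between its extreme values on the boundary, up to an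
  error \<open>C R\<close> to the power \<open>\<epsilon> / (2 + \<epsilon>)\<close>. By the Courant--Lebesgue argument some square with half-side
  between \<open>r\<close> and \<open>R\<close> has boundary oscillation at most \<open>C \<parallel>\<nabla>w\<parallel> / sqrt (ln (R / r))\<close>. Taking \<open>r = 2t\<close>
  and \<open>R = sqrt t\<close>, where \<open>t\<close> is the distance of the two points, gives the logarithmic modulus.\<close>

text \<open>Boundary values of w on a square are not defined, so the boundary oscillation and the
  comparison with it are both read off from mollifications of w. The good square then varies with
  the mollification, and only a limit of half-sides and boundary levels along a subsequence is at
  hand; hence the comparison is set up for a convergent sequence of squares. The gain in the
  iteration comes from dimension two: W^{1,1} embeds in L^2, Cauchy-Schwarz on a superlevel set A
  contributes |A|, and the source contributes |A| to the power \<epsilon> / (2 + \<epsilon>), so the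
  exponent exceeds 1. Differentiating the equation meets a second obstacle: D^2 H is bounded along
  the solution only, not on the plane, so the chain rule for F(\<nabla>u) is first applied to
  cut-off components of F. In the last step R = sqrt t keeps ln (R / r) comparable to |ln t|, while
  a positive power of R still beats every power of the logarithm.\<close>

section \<open>Smooth functions vanishing to infinite order\<close>

definition flat :: "nat \<Rightarrow> real \<Rightarrow> real" where
  "flat n t = (if t > 0 then exp (- (1 / t)) / t ^ n else 0)"

lemma flat_nonneg: "flat n t \<ge> 0"
  by (simp add: flat_def)

lemma flat_tendsto_0: "(flat n \<longlongrightarrow> 0) (at 0)"
proof -
  have "((\<lambda>t::real. inverse t ^ n / exp (inverse t)) \<longlongrightarrow> 0) (at_right 0)"
    using filterlim_compose[OF tendsto_power_div_exp_0 filterlim_inverse_at_top_right] .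
  then have r: "(flat n \<longlongrightarrow> 0) (at_right 0)"
  proof (rule Lim_transform_eventually)
    show "\<forall>\<^sub>F t in at_right 0. inverse t ^ n / exp (inverse t) = flat n t"
      unfolding eventually_at_right_field
      by (rule exI[of _ 1]) (auto simp: flat_def exp_minus field_simps)
  qed
  have l: "(flat n \<longlongrightarrow> 0) (at_left 0)"
  proof (rule Lim_transform_eventually[OF tendsto_const])
    show "\<forall>\<^sub>F t in at_left 0. 0 = flat n t"
      unfolding eventually_at_left_field by (rule exI[of _ "-1"]) (auto simp: flat_def)
  qed
  show ?thesis using l r by (simp add: filterlim_at_split)
qed

text \<open>Dividing by powers of t closes the family under differentiation, up to linear
  combinations. At t = 0 the difference quotient of \<open>flat n\<close> is
  \<open>flat (n + 1)\<close>, whose limit is already known to be 0.\<close>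

lemma flat_has_derivative:
  "(flat n has_real_derivative (flat (n + 2) t - real n * flat (n + 1) t)) (at t)"
proof -
  consider "t > 0" | "t < 0" | "t = 0" by linarith
  then show ?thesis
  proof cases
    case 1
    have "((\<lambda>t. exp (- (1 / t)) / t ^ n) has_real_derivative
        (flat (n + 2) t - real n * flat (n + 1) t)) (at t)"
      using 1 power_eq_if[of t "n - 1"]
      by (cases n) (auto intro!: derivative_eq_intros simp: flat_def field_simps power2_eq_square split: if_splits)
    then show ?thesis
      by (rule has_field_derivative_transform_within_open[of _ _ _ "{0<..}"])
         (use 1 in \<open>auto simp: flat_def\<close>)
  next
    case 2
    have "((\<lambda>_. 0) has_real_derivative 0) (at t)" by simp
    then have "(flat n has_real_derivative 0) (at t)"
      by (rule has_field_derivative_transform_within_open[of _ _ _ "{..<0}"])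
         (use 2 in \<open>auto simp: flat_def\<close>)
    then show ?thesis using 2 by (simp add: flat_def)
  next
    case 3
    have "((\<lambda>h. (flat n (0 + h) - flat n 0) / h) \<longlongrightarrow> 0) (at 0)"
    proof (rule Lim_transform_eventually[OF flat_tendsto_0[of "n + 1"]])
      show "\<forall>\<^sub>F h in at 0. flat (n + 1) h = (flat n (0 + h) - flat n 0) / h"
        unfolding eventually_at by (rule exI[of _ 1]) (auto simp: flat_def)
    qed
    then have "(flat n has_real_derivative 0) (at 0)"
      by (simp add: DERIV_def)
    then show ?thesis using 3 by (simp add: flat_def)
  qed
qed

text \<open>Unlike \<^const>\<open>smooth\<close> itself, this class is inductive and visibly closed under partial
  derivatives, so that it can serve as the invariant of a coinduction.\<close>

inductive elem :: "(real^'n::finite \<Rightarrow> real) \<Rightarrow> bool" where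
  elem_const: "elem (\<lambda>_. c)"
| elem_coord: "elem (\<lambda>x. x $ i)"
| elem_add: "elem f \<Longrightarrow> elem g \<Longrightarrow> elem (\<lambda>x. f x + g x)"
| elem_mult: "elem f \<Longrightarrow> elem g \<Longrightarrow> elem (\<lambda>x. f x * g x)"
| elem_flat: "elem f \<Longrightarrow> elem (\<lambda>x. flat n (f x))"

lemma elem_sum: "finite I \<Longrightarrow> (\<And>i. i \<in> I \<Longrightarrow> elem (f i)) \<Longrightarrow> elem (\<lambda>x. \<Sum>i\<in>I. f i x)"
  by (induction I rule: finite_induct) (auto intro: elem.intros)

text \<open>The derivative is kept as a function of point and direction: membership in the class for
  every fixed direction is what passes to all partial derivatives in the coinduction.\<close>

lemma elem_derivative:
  "elem f \<Longrightarrow> \<exists>f'. (\<forall>x. (f has_derivative f' x) (at x)) \<and> (\<forall>h. elem (\<lambda>x. f' x h))"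
proof (induction rule: elem.induct)
  case (elem_const c)
  show ?case by (rule exI[of _ "\<lambda>_ _. 0"]) (auto intro: elem.intros)
next
  case (elem_coord i)
  show ?case
    by (rule exI[of _ "\<lambda>_ h. h $ i"]) (auto intro: elem.intros bounded_linear_imp_has_derivative bounded_linear_vec_nth)
next
  case (elem_add f g)
  then obtain f' g' where "\<forall>x. (f has_derivative f' x) (at x)" "\<forall>h. elem (\<lambda>x. f' x h)"
    "\<forall>x. (g has_derivative g' x) (at x)" "\<forall>h. elem (\<lambda>x. g' x h)" by blast
  then show ?case
    by (intro exI[of _ "\<lambda>x h. f' x h + g' x h"]) (auto intro: elem.intros intro!: derivative_eq_intros)
next
  case (elem_mult f g)
  then obtain f' g' where "\<forall>x. (f has_derivative f' x) (at x)" "\<forall>h. elem (\<lambda>x. f' x h)"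
    "\<forall>x. (g has_derivative g' x) (at x)" "\<forall>h. elem (\<lambda>x. g' x h)" by blast
  with elem_mult.hyps show ?case
    by (intro exI[of _ "\<lambda>x h. f x * g' x h + f' x h * g x"])
       (auto intro!: elem.intros has_derivative_mult)
next
  case (elem_flat f n)
  then obtain f' where f': "\<And>x. (f has_derivative f' x) (at x)" "\<And>h. elem (\<lambda>x. f' x h)" by blast
  have "((\<lambda>x. flat n (f x)) has_derivative
      (\<lambda>h. (flat (n + 2) (f x) + (- real n) * flat (n + 1) (f x)) * f' x h)) (at x)" for x
    using has_derivative_compose[OF f'(1) flat_has_derivative[of n "f x", unfolded has_field_derivative_def]]
    by simp
  moreover have "elem (\<lambda>x. (flat (n + 2) (f x) + (- real n) * flat (n + 1) (f x)) * f' x h)" for h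
    using elem_flat.hyps f'(2) by (intro elem.intros)
  ultimately show ?case
    by (intro exI[of _ "\<lambda>x h. (flat (n + 2) (f x) + (- real n) * flat (n + 1) (f x)) * f' x h"]) blast
qed

lemma partial_eqI: "(f has_derivative f') (at x) \<Longrightarrow> partial i f x = f' (axis i 1)"
  by (metis frechet_derivative_at partial_def)

lemma elem_imp_smooth: "elem f \<Longrightarrow> smooth f"
proof (coinduction arbitrary: f rule: smooth.coinduct)
  case smooth
  then obtain f' where f': "\<And>x. (f has_derivative f' x) (at x)" "\<And>h. elem (\<lambda>x. f' x h)"
    using elem_derivative by blast
  have "partial i f = (\<lambda>x. f' x (axis i 1))" for i
    using partial_eqI[OF f'(1)] by auto
  then show ?case using f' by (auto simp: differentiable_def)
qed

text \<open>Each partial derivative of a reflected function brings out a minus sign, so the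
  coinduction runs over all scalar multiples \<open>c * k (x - y)\<close> at once.\<close>

lemma smooth_reflect: "smooth k \<Longrightarrow> smooth (\<lambda>y. c * k (x - y))"
proof (coinduction arbitrary: c k rule: smooth.coinduct)
  case smooth
  then have d: "k differentiable at x" and s: "smooth (partial i k)" for x i
    by (auto elim: smooth.cases)
  have "((\<lambda>y. c * k (x - y)) has_derivative (\<lambda>h. c * frechet_derivative k (at (x - y)) (- h))) (at y)" for y
  proof -
    have "(k has_derivative frechet_derivative k (at (x - y))) (at (x - y))"
      using d frechet_derivative_works by blast
    then show ?thesis
      by (auto intro!: derivative_eq_intros has_derivative_compose[where g=k and f="\<lambda>y. x - y"])
  qed
  note der = this
  have "partial i (\<lambda>y. c * k (x - y)) = (\<lambda>y. (- c) * partial i k (x - y))" for i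
  proof
    fix y
    have "linear (frechet_derivative k (at (x - y)))" using d by (simp add: linear_frechet_derivative)
    then show "partial i (\<lambda>y. c * k (x - y)) y = (- c) * partial i k (x - y)"
      using partial_eqI[OF der] by (simp add: partial_def linear_neg)
  qed
  moreover have "\<exists>c' k'. (\<lambda>y. (- c) * partial i k (x - y)) = (\<lambda>y. c' * k' (x - y)) \<and> smooth k'" for i
    using s by blast
  ultimately show ?case using der by (auto simp: differentiable_def)
qed

lemma smooth_differentiable: "smooth k \<Longrightarrow> k differentiable at x"
  by (auto elim: smooth.cases)

lemma smooth_partial: "smooth k \<Longrightarrow> smooth (partial i k)"
  by (auto elim: smooth.cases)

lemma smooth_continuous: "smooth k \<Longrightarrow> continuous_on A k"
  by (meson continuous_at_imp_continuous_on differentiable_imp_continuous_within smooth_differentiable)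

subsection \<open>Functions with a continuous gradient\<close>

text \<open>The regularity required of test functions throughout. One continuous derivative is all
  that a truncation of a mollification offers, and it is enough for integration by parts and for the
  planar Sobolev inequality. The gradient is an explicit argument so that product and chain rules
  compute it.\<close>

definition C1_grad :: "(real^'n::finite \<Rightarrow> real) \<Rightarrow> (real^'n \<Rightarrow> real^'n) \<Rightarrow> bool" where
  "C1_grad g D \<longleftrightarrow> (\<forall>x. (g has_derivative (\<lambda>h. D x \<bullet> h)) (at x)) \<and> continuous_on UNIV D"

lemma C1_gradD: "C1_grad g D \<Longrightarrow> (g has_derivative (\<lambda>h. D x \<bullet> h)) (at x)"
  by (simp add: C1_grad_def)

lemma C1_grad_continuous: "C1_grad g D \<Longrightarrow> continuous_on A g"
  by (meson C1_gradD continuous_at_imp_continuous_on has_derivative_continuous)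

lemma C1_grad_continuous_grad: "C1_grad g D \<Longrightarrow> continuous_on A D"
  by (meson C1_grad_def continuous_on_subset subset_UNIV)

lemma C1_grad_lipschitz:
  assumes g: "C1_grad g D" and L: "\<And>x. norm (D x) \<le> L"
  shows "\<bar>g x - g y\<bar> \<le> L * norm (x - y)"
proof -
  have "norm (g x - g y) \<le> L * norm (x - y)"
  proof (rule differentiable_bound[of UNIV g "\<lambda>x h. D x \<bullet> h"])
    show "onorm (\<lambda>h. D x \<bullet> h) \<le> L" for x
    proof (rule onorm_le)
      fix h show "norm (D x \<bullet> h) \<le> L * norm h"
        using order_trans[OF Cauchy_Schwarz_ineq2[of "D x" h] mult_right_mono[OF L[of x]]] by simp
    qed
  qed (use C1_gradD[OF g] in auto)
  then show ?thesis by simp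
qed

lemma continuous_compact_support_bounded:
  fixes g :: "'a::topological_space \<Rightarrow> 'b::real_normed_vector"
  assumes "continuous_on UNIV g" "compact K" "\<And>x. x \<notin> K \<Longrightarrow> g x = 0"
  shows "\<exists>B\<ge>0. \<forall>x. norm (g x) \<le> B"
proof -
  have "compact (g ` K)"
    by (intro compact_continuous_image assms continuous_on_subset[OF assms(1)]) auto
  then obtain B where B: "\<And>x. x \<in> K \<Longrightarrow> norm (g x) \<le> B"
    by (meson bounded_iff compact_imp_bounded image_eqI)
  have "norm (g x) \<le> max B 0" for x
    using B[of x] assms(3)[of x] by (cases "x \<in> K") (auto simp: le_max_iff_disj)
  then show ?thesis by (meson max.cobounded2)
qed

lemma linear_eq_inner:
  fixes f :: "real^'n::finite \<Rightarrow> real"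
  assumes "linear f" shows "f h = (\<chi> i. f (axis i 1)) \<bullet> h"
proof -
  have h: "h = (\<Sum>i\<in>UNIV. (h $ i) *\<^sub>R axis i 1)"
    using basis_expansion[of h] by (simp add: scalar_mult_eq_scaleR)
  have "f h = (\<Sum>i\<in>UNIV. f ((h $ i) *\<^sub>R axis i 1))"
    by (subst h) (rule linear_sum[OF assms])
  also have "\<dots> = (\<Sum>i\<in>UNIV. f (axis i 1) * h $ i)"
    by (simp add: linear_scale[OF assms] mult.commute)
  finally show ?thesis by (simp add: inner_vec_def)
qed

lemma C1_gradI_partial:
  assumes "\<And>x. g differentiable at x" "\<And>i. continuous_on UNIV (partial i g)"
  shows "C1_grad g (grad g)"
  unfolding C1_grad_def
proof (intro conjI allI)
  show "(g has_derivative (\<lambda>h. grad g x \<bullet> h)) (at x)" for x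
  proof -
    have "(g has_derivative frechet_derivative g (at x)) (at x)"
      using assms(1) frechet_derivative_works by blast
    moreover have "frechet_derivative g (at x) = (\<lambda>h. grad g x \<bullet> h)"
      unfolding grad_def partial_def
      by (rule ext) (rule linear_eq_inner[OF linear_frechet_derivative[OF assms(1)]])
    ultimately show ?thesis by simp
  qed
  show "continuous_on UNIV (grad g)"
    unfolding grad_def by (intro continuous_on_vec_lambda assms(2))
qed

lemma smooth_C1_grad: "smooth k \<Longrightarrow> C1_grad k (grad k)"
  by (intro C1_gradI_partial smooth_differentiable smooth_continuous smooth_partial)

lemma C1_grad_partial: "C1_grad g D \<Longrightarrow> partial i g x = D x $ i"
  using partial_eqI[OF C1_gradD[of g D x], of i] by (simp add: cart_eq_inner_axis[symmetric])

lemma C1_grad_eq: "C1_grad g D \<Longrightarrow> grad g x = D x"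
  by (simp add: grad_def vec_eq_iff C1_grad_partial)

lemma partial_eq_0_outside:
  fixes k :: "real^'n::finite \<Rightarrow> real"
  assumes "open S" "\<And>x. x \<in> S \<Longrightarrow> k x = 0" "x \<in> S"
  shows "partial i k x = 0"
proof -
  have "((\<lambda>_. 0) has_derivative (\<lambda>_. 0)) (at x)" by simp
  then have "(k has_derivative (\<lambda>_. 0)) (at x)"
    by (rule has_derivative_transform_within_open[OF _ assms(1,3)]) (use assms in auto)
  then show ?thesis by (rule partial_eqI)
qed

subsection \<open>Mollifiers\<close>

text \<open>The squared norm is a polynomial in the coordinates, so the bump lies in
  \<open>elem\<close> and inherits smoothness also at the origin, where the norm itself is not
  differentiable.\<close>

definition bump :: "real \<Rightarrow> real^'n::finite \<Rightarrow> real" where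
  "bump r z = flat 0 (r\<^sup>2 - (norm z)\<^sup>2)"

definition mollifier :: "real \<Rightarrow> real^'n::finite \<Rightarrow> real" where
  "mollifier r z = bump r z / (LINT y|lborel. bump r (y :: real^'n))"

lemma norm_sq_sum: "(norm (x :: real^'n::finite))\<^sup>2 = (\<Sum>i\<in>UNIV. x $ i * x $ i)"
  by (metis inner_vec_def power2_norm_eq_inner inner_real_def)

lemma elem_bump: "elem (bump r :: real^'n::finite \<Rightarrow> real)"
proof -
  have "elem (\<lambda>x::real^'n. flat 0 (r\<^sup>2 + (-1) * (\<Sum>i\<in>UNIV. x $ i * x $ i)))"
    by (intro elem.intros elem_sum) auto
  then show ?thesis by (simp add: bump_def[abs_def] norm_sq_sum)
qed

lemma bump_eq_0: "r \<ge> 0 \<Longrightarrow> norm z \<ge> r \<Longrightarrow> bump r z = 0"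
  by (simp add: bump_def flat_def power_mono not_less)

lemma bump_pos: "r > 0 \<Longrightarrow> norm z < r \<Longrightarrow> bump r z > 0"
  by (auto simp: bump_def flat_def power_strict_mono)

lemma bump_nonneg: "bump r z \<ge> 0"
  by (simp add: bump_def flat_nonneg)

lemma integrable_continuous_compact_support:
  fixes k :: "'a::euclidean_space \<Rightarrow> 'b::{banach, second_countable_topology}"
  assumes "continuous_on UNIV k" "compact K" "\<And>x. x \<notin> K \<Longrightarrow> k x = 0"
  shows "integrable lborel k"
proof -
  have "integrable lborel (\<lambda>x. indicator K x *\<^sub>R k x)"
    by (rule borel_integrable_compact[OF assms(2)]) (use assms(1) continuous_on_subset in blast)
  moreover have "(\<lambda>x. indicator K x *\<^sub>R k x) = k"
    using assms(3) by (auto simp: indicator_def)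
  ultimately show ?thesis by simp
qed

lemma bump_continuous: "continuous_on A (bump r)"
  by (rule smooth_continuous) (rule elem_imp_smooth[OF elem_bump])

text \<open>An integral equal to 0 would make the nonnegative bump vanish almost everywhere. Its
  zero set is closed, and a closed set containing almost every point is everything, which
  contradicts positivity at the origin.\<close>

lemma integral_bump_pos: "r > 0 \<Longrightarrow> (LINT y|lborel. bump r (y :: real^'n::finite)) > 0"
proof -
  assume r: "r > 0"
  have i: "integrable lborel (bump r :: real^'n \<Rightarrow> real)"
    by (rule integrable_continuous_compact_support[OF bump_continuous compact_cball[of 0 r]])
       (use r in \<open>auto intro!: bump_eq_0\<close>)
  have "(LINT y|lborel. bump r (y :: real^'n)) \<noteq> 0"
  proof
    assume "(LINT y|lborel. bump r (y :: real^'n)) = 0"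
    then have ae: "AE y in lborel. bump r (y :: real^'n) = 0"
      using integral_nonneg_eq_0_iff_AE[OF i] bump_nonneg by auto
    then have "AE y in lebesgue. y \<in> {y :: real^'n. bump r y = 0}"
      by (intro AE_completion) simp
    moreover have "closed {y :: real^'n. bump r y = 0}"
      by (rule closed_Collect_eq) (auto intro: bump_continuous)
    ultimately have "0 \<in> {y :: real^'n. bump r y = 0}"
      by (metis mem_closed_if_AE_lebesgue)
    then show False using bump_pos[OF r, of "0 :: real^'n"] r by simp
  qed
  moreover have "(LINT y|lborel. bump r (y :: real^'n)) \<ge> 0"
    by (rule integral_nonneg_AE) (simp add: bump_nonneg)
  ultimately show ?thesis by simp
qed

lemma mollifier_smooth: "smooth (mollifier r)"
proof -
  have "elem (\<lambda>x. bump r x * (1 / (LINT y|lborel. bump r (y :: real^'n))))"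
    by (intro elem.intros elem_bump)
  then show ?thesis using elem_imp_smooth by (simp add: mollifier_def[abs_def])
qed

lemma mollifier_nonneg: "mollifier r z \<ge> 0"
  by (simp add: mollifier_def bump_nonneg)

lemma mollifier_eq_0: "r \<ge> 0 \<Longrightarrow> norm z \<ge> r \<Longrightarrow> mollifier r z = 0"
  by (simp add: mollifier_def bump_eq_0)

lemma mollifier_continuous: "continuous_on A (mollifier r)"
  by (rule smooth_continuous) (rule mollifier_smooth)

lemma mollifier_integrable: "r \<ge> 0 \<Longrightarrow> integrable lborel (mollifier r)"
  by (rule integrable_continuous_compact_support[OF mollifier_continuous compact_cball[of 0 r]])
     (auto intro: mollifier_eq_0)

lemma mollifier_integral: "r > 0 \<Longrightarrow> (LINT y|lborel. mollifier r (y :: real^'n::finite)) = 1"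
  using integral_bump_pos[of r, where 'n='n] by (simp add: mollifier_def)

lemma partial_mollifier:
  fixes z :: "real^'n::finite"
  shows "partial i (mollifier r) z =
    flat 2 (r\<^sup>2 - (norm z)\<^sup>2) * (-2 * z $ i) / (LINT y|lborel. bump r (y :: real^'n))"
proof -
  have "((\<lambda>z::real^'n. flat 0 (r\<^sup>2 - z \<bullet> z) * (1 / (LINT y|lborel. bump r (y :: real^'n)))) has_derivative
    (\<lambda>h. flat 2 (r\<^sup>2 - z \<bullet> z) * (- 2 * (z \<bullet> h)) * (1 / (LINT y|lborel. bump r (y :: real^'n))))) (at z)"
  proof (intro has_derivative_mult_left)
    have "((\<lambda>z::real^'n. r\<^sup>2 - z \<bullet> z) has_derivative (\<lambda>h. - 2 * (z \<bullet> h))) (at z)"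
      by (auto intro!: derivative_eq_intros simp: inner_commute)
    from has_derivative_compose[OF this flat_has_derivative[of 0 "r\<^sup>2 - z \<bullet> z", unfolded has_field_derivative_def]]
    show "((\<lambda>z::real^'n. flat 0 (r\<^sup>2 - z \<bullet> z)) has_derivative
       (\<lambda>h. flat 2 (r\<^sup>2 - z \<bullet> z) * (- 2 * (z \<bullet> h)))) (at z)" by (simp add: numeral_eq_Suc)
  qed
  from partial_eqI[OF this, of i] show ?thesis
    by (simp add: mollifier_def[abs_def] bump_def[abs_def] power2_norm_eq_inner cart_eq_inner_axis[symmetric])
qed

text \<open>Schwarz's theorem for this one kernel, read off from the explicit second derivatives. It
  is the source of the symmetry of the weak Hessian of u.\<close>

lemma partial_partial_mollifier_commute:
  fixes z :: "real^'n::finite"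
  shows "partial i (partial j (mollifier r)) z = partial j (partial i (mollifier r)) z"
proof -
  let ?Z = "(LINT y|lborel. bump r (y :: real^'n))"
  have "partial i (partial j (mollifier r)) z =
     (flat 4 (r\<^sup>2 - z \<bullet> z) - 2 * flat 3 (r\<^sup>2 - z \<bullet> z)) * (- 2 * z $ i) * (-2 * z $ j) / ?Z
     + flat 2 (r\<^sup>2 - z \<bullet> z) * (-2 * axis i 1 $ j) / ?Z" for i j
  proof -
    have "((\<lambda>z::real^'n. r\<^sup>2 - z \<bullet> z) has_derivative (\<lambda>h. - 2 * (z \<bullet> h))) (at z)"
      by (auto intro!: derivative_eq_intros simp: inner_commute)
    from has_derivative_compose[OF this flat_has_derivative[of 2 "r\<^sup>2 - z \<bullet> z", unfolded has_field_derivative_def]]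
    have a: "((\<lambda>z::real^'n. flat 2 (r\<^sup>2 - z \<bullet> z)) has_derivative
       (\<lambda>h. (flat 4 (r\<^sup>2 - z \<bullet> z) - 2 * flat 3 (r\<^sup>2 - z \<bullet> z)) * (- 2 * (z \<bullet> h)))) (at z)"
      by (simp add: numeral_eq_Suc)
    have b: "((\<lambda>z::real^'n. -2 * z $ j) has_derivative (\<lambda>h. -2 * h $ j)) (at z)"
      by (intro has_derivative_mult_right bounded_linear_imp_has_derivative bounded_linear_vec_nth)
    have "((\<lambda>z::real^'n. flat 2 (r\<^sup>2 - z \<bullet> z) * (-2 * z $ j) * (1 / ?Z)) has_derivative
      (\<lambda>h. (flat 2 (r\<^sup>2 - z \<bullet> z) * (-2 * h $ j) +
        (flat 4 (r\<^sup>2 - z \<bullet> z) - 2 * flat 3 (r\<^sup>2 - z \<bullet> z)) * (- 2 * (z \<bullet> h)) * (-2 * z $ j)) * (1 / ?Z))) (at z)"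
      by (intro has_derivative_mult_left has_derivative_mult a b)
    moreover have "partial j (mollifier r) = (\<lambda>z::real^'n. flat 2 (r\<^sup>2 - z \<bullet> z) * (-2 * z $ j) * (1 / ?Z))"
      by (simp add: fun_eq_iff partial_mollifier power2_norm_eq_inner)
    ultimately show ?thesis
      using partial_eqI[of "partial j (mollifier r)" _ z i] 
      by (simp add: cart_eq_inner_axis[symmetric] diff_divide_distrib)
  qed
  then show ?thesis by (simp add: axis_def)
qed

subsection \<open>Convolution\<close>

text \<open>The radius of the support is recorded because a convolution at x sees only
  \<open>cball x r\<close>, which has to stay inside the region where weak identities hold. The
  class is closed under partial derivatives at the same radius, so derivatives of mollifications are
  again convolutions of the same kind.\<close>

definition kernel :: "real \<Rightarrow> (real^'n::finite \<Rightarrow> real) \<Rightarrow> bool" where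
  "kernel r k \<longleftrightarrow> smooth k \<and> (\<forall>z. r < norm z \<longrightarrow> k z = 0)"

definition conv :: "(real^'n::finite \<Rightarrow> real) \<Rightarrow> (real^'n \<Rightarrow> real) \<Rightarrow> real^'n \<Rightarrow> real" where
  "conv g k x = (LINT y|lborel. g y * k (x - y))"

lemma kernel_mollifier: "r \<ge> 0 \<Longrightarrow> kernel r (mollifier r)"
  by (auto simp: kernel_def mollifier_smooth mollifier_eq_0)

lemma kernel_partial:
  assumes "kernel r k" shows "kernel r (partial i k)"
proof -
  have "open {z :: real^'a. r < norm z}"
    by (intro open_Collect_less continuous_intros)
  then have "partial i k z = 0" if "r < norm z" for z
    by (rule partial_eq_0_outside) (use assms that in \<open>auto simp: kernel_def\<close>)
  then show ?thesis using assms by (auto simp: kernel_def smooth_partial)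
qed

lemma kernel_continuous: "kernel r k \<Longrightarrow> continuous_on A k"
  by (simp add: kernel_def smooth_continuous)

lemma kernel_measurable: "kernel r k \<Longrightarrow> k \<in> borel_measurable borel"
  by (rule borel_measurable_continuous_onI) (rule kernel_continuous)

lemma kernel_bounded:
  assumes "kernel r k" shows "\<exists>B\<ge>0. \<forall>z. \<bar>k z\<bar> \<le> B"
  using continuous_compact_support_bounded[OF kernel_continuous[OF assms] compact_cball[of 0 r]] assms
  by (auto simp: kernel_def)

lemma kernel_lipschitz:
  assumes "kernel r (k :: real^'n::finite \<Rightarrow> real)" shows "\<exists>L\<ge>0. \<forall>z z'. \<bar>k z - k z'\<bar> \<le> L * norm (z - z')"
proof -
  have "\<forall>i. \<exists>B\<ge>0. \<forall>z. \<bar>partial i k z\<bar> \<le> B"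
    using kernel_bounded[OF kernel_partial[OF assms]] by blast
  then obtain B where B: "\<And>i. B i \<ge> 0" "\<And>i z. \<bar>partial i k z\<bar> \<le> B i" by metis
  define L where "L = (\<Sum>i\<in>UNIV. B i)"
  have nb: "norm (grad k z) \<le> L" for z
    using norm_le_l1_cart[of "grad k z"] sum_mono[of UNIV "\<lambda>i. \<bar>grad k z $ i\<bar>" B] B(2)
    by (simp add: grad_def L_def)
  have L0: "L \<ge> 0" unfolding L_def by (intro sum_nonneg B)
  have "C1_grad k (grad k)" using assms by (intro smooth_C1_grad) (simp add: kernel_def)
  from C1_grad_lipschitz[OF this nb] show ?thesis using L0 by blast
qed

text \<open>The gradient of a kernel is Lipschitz, which gives a quadratic remainder uniform in the
  base point. Uniformity is the point: the remainder can be integrated against any integrable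
  function.\<close>

lemma kernel_taylor:
  assumes "kernel r (k :: real^'n::finite \<Rightarrow> real)"
  shows "\<exists>L\<ge>0. \<forall>z h. \<bar>k (z + h) - k z - grad k z \<bullet> h\<bar> \<le> L * (norm h)\<^sup>2"
proof -
  have "\<forall>i. \<exists>L\<ge>0. \<forall>z z'. \<bar>partial i k z - partial i k z'\<bar> \<le> L * norm (z - z')"
    using kernel_lipschitz[OF kernel_partial[OF assms]] by blast
  then obtain B where B: "\<And>i. B i \<ge> 0" "\<And>i z z'. \<bar>partial i k z - partial i k z'\<bar> \<le> B i * norm (z - z')" by metis
  define L where "L = (\<Sum>i\<in>UNIV. B i)"
  have L0: "L \<ge> 0" unfolding L_def by (intro sum_nonneg B)
  have nb: "norm (grad k z - grad k z') \<le> L * norm (z - z')" for z z'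
    using norm_le_l1_cart[of "grad k z - grad k z'"]
      sum_mono[of UNIV "\<lambda>i. \<bar>(grad k z - grad k z') $ i\<bar>" "\<lambda>i. B i * norm (z - z')"] B(2)
    by (simp add: grad_def L_def sum_distrib_right)
  have "norm (k (z + h) - k z - grad k z \<bullet> ((z + h) - z)) \<le> norm ((z + h) - z) * (L * norm h)" for z h
  proof (rule differentiable_bound_linearization[of z "z + h" "cball z (norm h)" k "\<lambda>x h. grad k x \<bullet> h"])
    show "(k has_derivative (\<lambda>h. grad k x \<bullet> h)) (at x within cball z (norm h))" for x
      using C1_gradD[OF smooth_C1_grad] assms by (auto simp: kernel_def intro: has_derivative_at_withinI)
    show "onorm ((\<lambda>h. grad k x \<bullet> h) - (\<lambda>h. grad k z \<bullet> h)) \<le> L * norm h" if "x \<in> cball z (norm h)" for x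
    proof -
      have "norm (grad k x - grad k z) \<le> L * norm h"
        using nb[of x z] that mult_left_mono[OF _ L0, of "norm (x - z)" "norm h"]
        by (simp add: dist_norm norm_minus_commute)
      then have "norm (((\<lambda>h. grad k x \<bullet> h) - (\<lambda>h. grad k z \<bullet> h)) h') \<le> L * norm h * norm h'" for h'
        using order_trans[OF Cauchy_Schwarz_ineq2[of "grad k x - grad k z" h'] mult_right_mono] 
        by (simp add: inner_diff_left)
      then show ?thesis by (rule onorm_le)
    qed
    show "z + t *\<^sub>R (z + h - z) \<in> cball z (norm h)" if "t \<in> {0..1}" for t
      using that by (auto simp: dist_norm mult_left_le_one_le)
  qed auto
  then show ?thesis using L0 by (intro exI[of _ L]) (auto simp: power2_eq_square mult_ac)
qed

lemma conv_integrable_integrand: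
  assumes "integrable lborel g" "kernel r k"
  shows "integrable lborel (\<lambda>y. g y * k (x - y))"
proof -
  have [measurable]: "k \<in> borel_measurable borel" by (rule kernel_measurable[OF assms(2)])
  obtain B where B: "B \<ge> 0" "\<And>z. \<bar>k z\<bar> \<le> B" using kernel_bounded[OF assms(2)] by blast
  have [measurable]: "g \<in> borel_measurable borel"
    using borel_measurable_integrable[OF assms(1)] by simp
  show ?thesis
  proof (rule Bochner_Integration.integrable_bound[of _ "\<lambda>y. B * \<bar>g y\<bar>"])
    show "integrable lborel (\<lambda>y. B * \<bar>g y\<bar>)" using assms(1) by simp
    show "(\<lambda>y. g y * k (x - y)) \<in> borel_measurable lborel" by measurable
    show "AE y in lborel. norm (g y * k (x - y)) \<le> norm (B * \<bar>g y\<bar>)"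
    proof (rule AE_I2)
      fix y show "norm (g y * k (x - y)) \<le> norm (B * \<bar>g y\<bar>)"
        using mult_left_mono[OF B(2)[of "x - y"], of "\<bar>g y\<bar>"] B(1) by (simp add: abs_mult mult.commute)
    qed
  qed
qed

lemma mollifier_measurable [measurable]: "mollifier r \<in> borel_measurable borel"
  by (rule borel_measurable_continuous_onI) (rule mollifier_continuous)

lemma mollifier_integrable_integrand:
  "integrable lborel g \<Longrightarrow> r > 0 \<Longrightarrow> integrable lborel (\<lambda>y. g y * mollifier r (x - y))"
  by (rule conv_integrable_integrand[OF _ kernel_mollifier]) auto

text \<open>Differentiation under the integral for g that is merely integrable: the uniform Taylor
  remainder integrates to an error of order |h|^2. Continuity of the gradient comes from applying
  the same argument to the partial derivatives of the kernel, whose convolutions are differentiable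
  and hence continuous.\<close>

lemma conv_C1_grad:
  assumes "integrable lborel g" "kernel r (k :: real^'n::finite \<Rightarrow> real)"
  shows "C1_grad (conv g k) (\<lambda>x. \<chi> i. conv g (partial i k) x)"
proof -
  have der: "(conv g k has_derivative (\<lambda>h. (\<chi> i. conv g (partial i k) x) \<bullet> h)) (at x)"
    if k: "kernel r k" for k :: "real^'n \<Rightarrow> real" and x
  proof -
    obtain L where L: "L \<ge> 0" "\<And>z h. \<bar>k (z + h) - k z - grad k z \<bullet> h\<bar> \<le> L * (norm h)\<^sup>2"
      using kernel_taylor[OF k] by blast
    define M where "M = (LINT y|lborel. \<bar>g y\<bar> * L)"
    have bd: "norm (conv g k (x + h) - conv g k x - (\<chi> i. conv g (partial i k) x) \<bullet> h) \<le> M * (norm h)\<^sup>2" for h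
    proof -
      have i1: "integrable lborel (\<lambda>y. g y * k (x - y))" "integrable lborel (\<lambda>y. g y * k (x + h - y))"
        "integrable lborel (\<lambda>y. g y * partial i k (x - y))" for i
        using conv_integrable_integrand[OF assms(1) k] conv_integrable_integrand[OF assms(1) kernel_partial[OF k]]
        by auto
      have i1': "integrable lborel (\<lambda>y. g y * (partial i k (x - y) * h $ i))" for i
        using integrable_mult_left[OF i1(3)[of i], of "h $ i"] by (simp add: mult.assoc)
      have "(\<chi> i. conv g (partial i k) x) \<bullet> h = (\<Sum>i\<in>UNIV. (LINT y|lborel. g y * partial i k (x - y) * h $ i))"
        using i1 by (simp add: inner_vec_def conv_def)
      also have "\<dots> = (LINT y|lborel. g y * (grad k (x - y) \<bullet> h))"
        using i1 i1' by (subst Bochner_Integration.integral_sum[symmetric])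
          (auto simp: inner_vec_def grad_def sum_distrib_left mult.assoc)
      finally have e1: "(\<chi> i. conv g (partial i k) x) \<bullet> h = (LINT y|lborel. g y * (grad k (x - y) \<bullet> h))" .
      have i2: "integrable lborel (\<lambda>y. g y * (grad k (x - y) \<bullet> h))"
        using i1' by (auto simp: inner_vec_def grad_def sum_distrib_left)
      have c: "x - y + h = x + h - y" for y by simp
      have e2: "g y * (k ((x - y) + h) - k (x - y) - grad k (x - y) \<bullet> h) =
        g y * k (x + h - y) - g y * k (x - y) - g y * (grad k (x - y) \<bullet> h)" for y
        unfolding c by (simp only: right_diff_distrib)
      have e3: "conv g k (x + h) - conv g k x - (\<chi> i. conv g (partial i k) x) \<bullet> h =
        (LINT y|lborel. g y * (k ((x - y) + h) - k (x - y) - grad k (x - y) \<bullet> h))"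
        unfolding e1 e2 unfolding conv_def using i1 i2
        by (subst Bochner_Integration.integral_diff, (auto)[2], subst Bochner_Integration.integral_diff) auto
      have "norm (conv g k (x + h) - conv g k x - (\<chi> i. conv g (partial i k) x) \<bullet> h)
        \<le> (LINT y|lborel. norm (g y * (k ((x - y) + h) - k (x - y) - grad k (x - y) \<bullet> h)))"
        unfolding e3 by (rule integral_norm_bound)
      also have "\<dots> \<le> (LINT y|lborel. \<bar>g y\<bar> * L * (norm h)\<^sup>2)"
      proof (rule integral_mono)
        show "integrable lborel (\<lambda>y. norm (g y * (k ((x - y) + h) - k (x - y) - grad k (x - y) \<bullet> h)))"
          unfolding e2
          by (rule integrable_norm[OF Bochner_Integration.integrable_diff[OF
              Bochner_Integration.integrable_diff[OF i1(2) i1(1)] i2]])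
        show "integrable lborel (\<lambda>y. \<bar>g y\<bar> * L * (norm h)\<^sup>2)"
          using assms(1) by auto
        show "norm (g y * (k ((x - y) + h) - k (x - y) - grad k (x - y) \<bullet> h)) \<le> \<bar>g y\<bar> * L * (norm h)\<^sup>2" for y
          using mult_left_mono[OF L(2)[of "x - y" h], of "\<bar>g y\<bar>"] by (simp add: abs_mult mult.assoc)
      qed
      also have "\<dots> = M * (norm h)\<^sup>2" by (simp add: M_def)
      finally show ?thesis .
    qed
    show ?thesis
      unfolding has_derivative_at
    proof
      show "bounded_linear (\<lambda>h. (\<chi> i. conv g (partial i k) x) \<bullet> h)"
        by (rule bounded_linear_inner_right)
      show "(\<lambda>h. norm (conv g k (x + h) - conv g k x - (\<chi> i. conv g (partial i k) x) \<bullet> h) / norm h) \<midarrow>0\<rightarrow> 0"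
      proof (rule tendsto_sandwich[of "\<lambda>_. 0" _ _ "\<lambda>h. M * norm h"])
        show "\<forall>\<^sub>F h in at 0. norm (conv g k (x + h) - conv g k x - (\<chi> i. conv g (partial i k) x) \<bullet> h) / norm h \<le> M * norm h"
          unfolding eventually_at
        proof (intro exI[of _ 1] conjI ballI impI)
          fix h :: "real^'n" assume "h \<noteq> 0 \<and> dist h 0 < 1"
          then show "norm (conv g k (x + h) - conv g k x - (\<chi> i. conv g (partial i k) x) \<bullet> h) / norm h \<le> M * norm h"
            using bd[of h] by (simp add: divide_le_eq power2_eq_square mult.assoc)
        qed simp
        show "((\<lambda>h. M * norm h) \<longlongrightarrow> 0) (at 0)"
          by (intro tendsto_mult_right_zero tendsto_norm_zero tendsto_ident_at)
      qed (auto intro!: always_eventually)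
    qed
  qed
  have "continuous_on UNIV (conv g (partial i k))" for i
    by (meson continuous_at_imp_continuous_on der has_derivative_continuous kernel_partial assms(2))
  then show ?thesis
    using der[OF assms(2)] by (auto simp: C1_grad_def intro!: continuous_on_vec_lambda)
qed

lemma conv_continuous: "integrable lborel g \<Longrightarrow> kernel r k \<Longrightarrow> continuous_on A (conv g k)"
  by (rule C1_grad_continuous) (rule conv_C1_grad)

lemma conv_measurable: "integrable lborel g \<Longrightarrow> kernel r k \<Longrightarrow> conv g k \<in> borel_measurable borel"
  by (rule borel_measurable_continuous_onI) (rule conv_continuous)

lemma conv_add:
  assumes "integrable lborel f" "integrable lborel g" "kernel r k"
  shows "conv (\<lambda>x. f x + g x) k x = conv f k x + conv g k x"
  unfolding conv_def distrib_right using assms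
  by (intro Bochner_Integration.integral_add conv_integrable_integrand)

lemma conv_diff:
  assumes "integrable lborel f" "integrable lborel g" "kernel r k"
  shows "conv (\<lambda>x. f x - g x) k x = conv f k x - conv g k x"
  unfolding conv_def left_diff_distrib using assms
  by (intro Bochner_Integration.integral_diff conv_integrable_integrand)

lemma nn_integral_lborel_reflect:
  fixes k :: "real^'n::finite \<Rightarrow> ennreal"
  assumes [measurable]: "k \<in> borel_measurable borel"
  shows "(\<integral>\<^sup>+y. k (x - y) \<partial>lborel) = (\<integral>\<^sup>+y. k y \<partial>lborel)"
proof -
  have l: "lborel = distr lborel borel (\<lambda>y. x - y)"
    using lborel_affine[of "-1" x] by (simp add: density_1)
  have "(\<integral>\<^sup>+y. k y \<partial>distr lborel borel (\<lambda>y. x - y)) = (\<integral>\<^sup>+y. k (x - y) \<partial>lborel)"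
    by (rule nn_integral_distr) measurable
  then show ?thesis by (simp flip: l)
qed

lemma nn_integral_lborel_translate:
  fixes k :: "'a::euclidean_space \<Rightarrow> ennreal"
  assumes [measurable]: "k \<in> borel_measurable borel"
  shows "(\<integral>\<^sup>+y. k (x + y) \<partial>lborel) = (\<integral>\<^sup>+y. k y \<partial>lborel)"
  by (subst lborel_distr_plus[symmetric, of x]) (simp add: nn_integral_distr)

lemma nn_integral_mollifier:
  "r > 0 \<Longrightarrow> (\<integral>\<^sup>+y. ennreal (mollifier r (y :: real^'n::finite)) \<partial>lborel) = 1"
  using nn_integral_eq_integral[OF mollifier_integrable[of r, where 'a='n]] mollifier_integral[of r, where 'n='n]
  by (simp add: mollifier_nonneg)

lemma
  fixes x :: "real^'n::finite"
  assumes r: "r > 0"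
  shows mollifier_reflect_integrable: "integrable lborel (\<lambda>y. mollifier r (x - y))"
    and mollifier_reflect_integral: "(LINT y|lborel. mollifier r (x - y)) = 1"
proof -
  have e: "(\<integral>\<^sup>+y. ennreal (mollifier r (x - y)) \<partial>lborel) = 1"
    using nn_integral_lborel_reflect[of "\<lambda>z. ennreal (mollifier r z)" x] nn_integral_mollifier[OF r, where 'n='n]
    by simp
  show "integrable lborel (\<lambda>y. mollifier r (x - y))"
    by (rule integrableI_nonneg) (auto simp: e mollifier_nonneg)
  show "(LINT y|lborel. mollifier r (x - y)) = 1"
    by (subst integral_eq_nn_integral) (auto simp: e mollifier_nonneg)
qed

lemma nn_integral_conv:
  fixes g :: "real^'n::finite \<Rightarrow> ennreal"
  assumes [measurable]: "g \<in> borel_measurable borel" and r: "r > 0"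
  shows "(\<integral>\<^sup>+x. \<integral>\<^sup>+y. g y * ennreal (mollifier r (x - y)) \<partial>lborel \<partial>lborel) = (\<integral>\<^sup>+y. g y \<partial>lborel)"
proof -
  have "(\<integral>\<^sup>+x. \<integral>\<^sup>+y. g y * ennreal (mollifier r (x - y)) \<partial>lborel \<partial>lborel)
     = (\<integral>\<^sup>+y. \<integral>\<^sup>+x. g y * ennreal (mollifier r (x - y)) \<partial>lborel \<partial>lborel)"
    by (rule lborel_pair.Fubini'[symmetric]) measurable
  also have "\<dots> = (\<integral>\<^sup>+y. g y \<partial>lborel)"
  proof (rule nn_integral_cong)
    fix y :: "real^'n"
    have "(\<integral>\<^sup>+x. ennreal (mollifier r (x - y)) \<partial>lborel) = (\<integral>\<^sup>+x. ennreal (mollifier r (x :: real^'n)) \<partial>lborel)"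
      using nn_integral_lborel_translate[of "\<lambda>z. ennreal (mollifier r z)" "-y"] by simp
    also have "\<dots> = 1" by (rule nn_integral_mollifier[OF r])
    finally show "(\<integral>\<^sup>+x. g y * ennreal (mollifier r (x - y)) \<partial>lborel) = g y"
      by (simp add: nn_integral_cmult)
  qed
  finally show ?thesis .
qed

lemma nn_integral_abs_conv_le:
  assumes g: "integrable lborel g" and r: "r > 0"
  shows "(\<integral>\<^sup>+x. ennreal \<bar>conv g (mollifier r) x\<bar> \<partial>lborel) \<le> (\<integral>\<^sup>+x. ennreal \<bar>g x\<bar> \<partial>lborel)"
proof -
  have [measurable]: "g \<in> borel_measurable borel"
    using borel_measurable_integrable[OF g] by simp
  have i: "integrable lborel (\<lambda>y. g y * mollifier r (x - y))" for x
    by (rule mollifier_integrable_integrand[OF g r])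
  have "(\<integral>\<^sup>+x. ennreal \<bar>conv g (mollifier r) x\<bar> \<partial>lborel)
     \<le> (\<integral>\<^sup>+x. \<integral>\<^sup>+y. ennreal \<bar>g y\<bar> * ennreal (mollifier r (x - y)) \<partial>lborel \<partial>lborel)"
  proof (rule nn_integral_mono)
    fix x
    have "ennreal \<bar>conv g (mollifier r) x\<bar> \<le> (\<integral>\<^sup>+y. norm (g y * mollifier r (x - y)) \<partial>lborel)"
      unfolding conv_def using integral_norm_bound_ennreal[OF i[of x]] by simp
    then show "ennreal \<bar>conv g (mollifier r) x\<bar> \<le> (\<integral>\<^sup>+y. ennreal \<bar>g y\<bar> * ennreal (mollifier r (x - y)) \<partial>lborel)"
      by (simp add: abs_mult mollifier_nonneg ennreal_mult'')
  qed
  also have "\<dots> = (\<integral>\<^sup>+x. ennreal \<bar>g x\<bar> \<partial>lborel)"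
    by (rule nn_integral_conv[OF _ r]) measurable
  finally show ?thesis .
qed

lemma conv_integrable:
  assumes g: "integrable lborel g" and r: "r > 0"
  shows "integrable lborel (conv g (mollifier r))"
    and "(LINT x|lborel. \<bar>conv g (mollifier r) x\<bar>) \<le> (LINT x|lborel. \<bar>g x\<bar>)"
proof -
  have m: "conv g (mollifier r) \<in> borel_measurable lborel"
    using conv_measurable[OF g kernel_mollifier] r by simp
  have fin: "(\<integral>\<^sup>+x. ennreal \<bar>g x\<bar> \<partial>lborel) < \<infinity>"
    using g by (simp add: integrable_iff_bounded)
  show 1: "integrable lborel (conv g (mollifier r))"
    using nn_integral_abs_conv_le[OF g r] fin by (intro integrableI_bounded[OF m]) auto
  have "ennreal (LINT x|lborel. \<bar>conv g (mollifier r) x\<bar>) \<le> ennreal (LINT x|lborel. \<bar>g x\<bar>)"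
    using nn_integral_abs_conv_le[OF g r] 1 g
    by (subst (asm) (1 2) nn_integral_eq_integral) auto
  then show "(LINT x|lborel. \<bar>conv g (mollifier r) x\<bar>) \<le> (LINT x|lborel. \<bar>g x\<bar>)"
    by (simp add: ennreal_le_iff)
qed

lemma conv_nonneg: "(\<And>x. g x \<ge> 0) \<Longrightarrow> conv g (mollifier r) x \<ge> 0"
  unfolding conv_def by (intro integral_nonneg_AE) (simp add: mollifier_nonneg)

lemma conv_integral_nonneg:
  assumes g: "integrable lborel g" and r: "r > 0" and pos: "\<And>x. g x \<ge> 0"
  shows "(LINT x|lborel. conv g (mollifier r) x) = (LINT x|lborel. g x)"
proof -
  have [measurable]: "g \<in> borel_measurable borel"
    using borel_measurable_integrable[OF g] by simp
  have i: "integrable lborel (\<lambda>y. g y * mollifier r (x - y))" for x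
    by (rule mollifier_integrable_integrand[OF g r])
  have "ennreal (conv g (mollifier r) x) = (\<integral>\<^sup>+y. ennreal (g y) * ennreal (mollifier r (x - y)) \<partial>lborel)" for x
    unfolding conv_def using nn_integral_eq_integral[OF i[of x]] pos
    by (simp add: mollifier_nonneg ennreal_mult)
  then have "(\<integral>\<^sup>+x. ennreal (conv g (mollifier r) x) \<partial>lborel) = (\<integral>\<^sup>+x. ennreal (g x) \<partial>lborel)"
    using nn_integral_conv[OF _ r, of "\<lambda>x. ennreal (g x)"] by simp
  then show ?thesis
    using g conv_integrable(1)[OF g r] pos conv_nonneg[of g r]
    by (simp add: integral_eq_nn_integral)
qed

text \<open>Jensen's inequality for the probability density \<open>mollifier r (x - y)\<close>: the
  variance of g about its mean m is nonnegative.\<close>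

lemma conv_square_le:
  assumes g: "integrable lborel g" "integrable lborel (\<lambda>x. (g x)\<^sup>2)" and r: "r > 0"
  shows "(conv g (mollifier r) x)\<^sup>2 \<le> conv (\<lambda>x. (g x)\<^sup>2) (mollifier r) x"
proof -
  define m where "m = conv g (mollifier r) x"
  have i: "integrable lborel (\<lambda>y. g y * mollifier r (x - y))" "integrable lborel (\<lambda>y. (g y)\<^sup>2 * mollifier r (x - y))"
    using mollifier_integrable_integrand[OF g(1) r] mollifier_integrable_integrand[OF g(2) r] by auto
  note j = mollifier_reflect_integrable[OF r, of x] mollifier_reflect_integral[OF r, of x]
  have "0 \<le> (LINT y|lborel. (g y - m)\<^sup>2 * mollifier r (x - y))"
    by (intro integral_nonneg_AE) (simp add: mollifier_nonneg)
  also have "(\<lambda>y. (g y - m)\<^sup>2 * mollifier r (x - y)) = (\<lambda>y. (g y)\<^sup>2 * mollifier r (x - y)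
      - (2 * m) * (g y * mollifier r (x - y)) + m\<^sup>2 * mollifier r (x - y))"
    by (auto simp: algebra_simps power2_eq_square)
  also have "(LINT y|lborel. (g y)\<^sup>2 * mollifier r (x - y)
      - (2 * m) * (g y * mollifier r (x - y)) + m\<^sup>2 * mollifier r (x - y))
    = conv (\<lambda>x. (g x)\<^sup>2) (mollifier r) x - (2 * m) * m + m\<^sup>2 * 1"
    using i j by (simp add: conv_def m_def)
  finally show ?thesis by (simp add: m_def power2_eq_square)
qed


section \<open>Convergence of mollifications in L1\<close>

definition mol :: "nat \<Rightarrow> real^'n::finite \<Rightarrow> real" where
  "mol n = mollifier (inverse (real (Suc n)))"

lemma kernel_mol: "kernel (inverse (real (Suc n))) (mol n)"
  unfolding mol_def by (rule kernel_mollifier) simp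

lemma mol_conv_tendsto:
  fixes U :: "(real^'n::finite) set"
  assumes "open U" "x \<in> U" "\<And>y. y \<in> U \<Longrightarrow> g y = c"
  shows "(\<lambda>n. conv g (mol n) x) \<longlonglongrightarrow> c"
proof -
  obtain e where e: "e > 0" "ball x e \<subseteq> U" using assms open_contains_ball by blast
  have "\<forall>\<^sub>F n in sequentially. inverse (real (Suc n)) < e"
    using LIMSEQ_inverse_real_of_nat e(1) by (rule order_tendstoD(2))
  then have "\<forall>\<^sub>F n in sequentially. c = conv g (mol n) x"
  proof eventually_elim
    case (elim n)
    have "g y * mol n (x - y) = c * mol n (x - y)" for y
    proof (cases "y \<in> ball x e")
      case True then show ?thesis using assms(3) e(2) by auto
    next
      case False
      then have "norm (x - y) \<ge> inverse (real (Suc n))" using elim by (simp add: dist_norm)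
      then show ?thesis by (simp add: mol_def mollifier_eq_0)
    qed
    then have "conv g (mol n) x = (LINT y|lborel. c * mol n (x - y))" by (simp only: conv_def)
    then show ?case
      using mollifier_reflect_integral[of "inverse (real (Suc n))" x] by (simp add: mol_def)
  qed
  then show ?thesis by (rule Lim_transform_eventually[OF tendsto_const])
qed

text \<open>The usual density argument. Convolution contracts the L1 norm, so the error for g is at
  most the error for s plus twice the distance from g to s; each of the three pieces gets a quarter
  of the tolerance.\<close>

lemma conv_L1_tendsto_approx:
  fixes g :: "real^'n::finite \<Rightarrow> real"
  assumes g: "integrable lborel g"
    and approx: "\<And>e. e > 0 \<Longrightarrow> \<exists>s. integrable lborel s \<and> (LINT x|lborel. \<bar>g x - s x\<bar>) \<le> e \<and>
      (\<lambda>n. LINT x|lborel. \<bar>conv s (mol n) x - s x\<bar>) \<longlonglongrightarrow> 0"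
  shows "(\<lambda>n. LINT x|lborel. \<bar>conv g (mol n) x - g x\<bar>) \<longlonglongrightarrow> 0"
proof (rule order_tendstoI)
  fix a :: real assume "a < 0"
  moreover have "0 \<le> (LINT x|lborel. \<bar>conv g (mol n) x - g x\<bar>)" for n
    by (rule integral_nonneg_AE) simp
  ultimately show "\<forall>\<^sub>F n in sequentially. a < (LINT x|lborel. \<bar>conv g (mol n) x - g x\<bar>)"
    by (intro always_eventually allI) (meson less_le_trans)
next
  fix a :: real assume a: "0 < a"
  then obtain s where s: "integrable lborel s" "(LINT x|lborel. \<bar>g x - s x\<bar>) \<le> a / 4"
    "(\<lambda>n. LINT x|lborel. \<bar>conv s (mol n) x - s x\<bar>) \<longlonglongrightarrow> 0"
    using approx[of "a / 4"] by auto
  have "\<forall>\<^sub>F n in sequentially. (LINT x|lborel. \<bar>conv s (mol n) x - s x\<bar>) < a / 4"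
    by (rule order_tendstoD(2)[OF s(3)]) (use a in simp)
  then show "\<forall>\<^sub>F n in sequentially. (LINT x|lborel. \<bar>conv g (mol n) x - g x\<bar>) < a"
  proof eventually_elim
    case (elim n)
    have r: "inverse (real (Suc n)) > 0" by simp
    have d: "integrable lborel (\<lambda>x. g x - s x)" using g s(1) by simp
    note i = conv_integrable(1)[OF g r, folded mol_def] conv_integrable(1)[OF s(1) r, folded mol_def]
      conv_integrable(1)[OF d r, folded mol_def]
    have "(LINT x|lborel. \<bar>conv g (mol n) x - g x\<bar>) \<le>
      (LINT x|lborel. \<bar>conv (\<lambda>x. g x - s x) (mol n) x\<bar> + \<bar>conv s (mol n) x - s x\<bar> + \<bar>g x - s x\<bar>)"
    proof (rule integral_mono)
      fix x
      have "conv (\<lambda>x. g x - s x) (mol n) x = conv g (mol n) x - conv s (mol n) x"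
        unfolding mol_def by (rule conv_diff[OF g s(1) kernel_mollifier]) simp
      then show "\<bar>conv g (mol n) x - g x\<bar> \<le> \<bar>conv (\<lambda>x. g x - s x) (mol n) x\<bar> + \<bar>conv s (mol n) x - s x\<bar> + \<bar>g x - s x\<bar>"
        by linarith
    qed (use i g s(1) in auto)
    also have "\<dots> = (LINT x|lborel. \<bar>conv (\<lambda>x. g x - s x) (mol n) x\<bar>) + (LINT x|lborel. \<bar>conv s (mol n) x - s x\<bar>)
       + (LINT x|lborel. \<bar>g x - s x\<bar>)"
      using i g s(1) by simp
    also have "(LINT x|lborel. \<bar>conv (\<lambda>x. g x - s x) (mol n) x\<bar>) \<le> (LINT x|lborel. \<bar>g x - s x\<bar>)"
      unfolding mol_def by (rule conv_integrable(2)[OF d r])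
    finally show ?case using elim s(2) a by linarith
  qed
qed

text \<open>For an open set \<open>U\<close> the mollifications converge pointwise only inside \<open>U\<close>. Since they have the
  same integral as the indicator of \<open>U\<close>, what is missing inside \<open>U\<close> equals what leaks outside.\<close>

lemma conv_indicator_open_L1_tendsto:
  fixes U :: "(real^'n::finite) set"
  assumes U: "open U" and fin: "emeasure lborel U < \<infinity>"
  shows "(\<lambda>n. LINT x|lborel. \<bar>conv (indicator U) (mol n) x - indicator U x\<bar>) \<longlonglongrightarrow> 0"
proof -
  let ?g = "indicator U :: real^'n \<Rightarrow> real"
  have [measurable]: "U \<in> sets borel" using U by simp
  have g: "integrable lborel ?g" using fin by (simp add: integrable_indicator_iff)
  have r: "inverse (real (Suc n)) > 0" for n by simp
  have i: "integrable lborel (conv ?g (mol n))" for n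
    unfolding mol_def by (rule conv_integrable(1)[OF g r])
  have c0: "conv ?g (mol n) x \<ge> 0" for n x unfolding mol_def by (rule conv_nonneg) simp
  have c1: "conv ?g (mol n) x \<le> 1" for n x
  proof -
    have "conv ?g (mol n) x \<le> (LINT y|lborel. mollifier (inverse (real (Suc n))) (x - y))"
      unfolding conv_def mol_def
      by (intro integral_mono mollifier_integrable_integrand[OF g r] mollifier_reflect_integrable[OF r])
         (auto simp: indicator_def mollifier_nonneg)
    then show ?thesis using mollifier_reflect_integral[OF r[of n], of x] by simp
  qed
  have "(\<lambda>n. LINT x|lborel. 2 * (?g x * (1 - conv ?g (mol n) x))) \<longlonglongrightarrow> (LINT x::real^'n|lborel. 0)"
  proof (rule integral_dominated_convergence[where w="\<lambda>x. 2 * ?g x"])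
    show "AE x in lborel. (\<lambda>n. 2 * (?g x * (1 - conv ?g (mol n) x))) \<longlonglongrightarrow> 0"
    proof (rule AE_I2)
      fix x
      show "(\<lambda>n. 2 * (?g x * (1 - conv ?g (mol n) x))) \<longlonglongrightarrow> 0"
      proof (cases "x \<in> U")
        case True
        then have "(\<lambda>n. conv ?g (mol n) x) \<longlonglongrightarrow> 1" by (intro mol_conv_tendsto[OF U]) auto
        from tendsto_diff[OF tendsto_const[of 1] this] have "(\<lambda>n. 1 - conv ?g (mol n) x) \<longlonglongrightarrow> 0" by simp
        then show ?thesis by (intro tendsto_mult_right_zero)
      qed simp
    qed
    show "AE x in lborel. norm (2 * (?g x * (1 - conv ?g (mol n) x))) \<le> 2 * ?g x" for n
      using c0 c1 by (intro AE_I2) (auto simp: indicator_def)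
  qed (use g i in auto)
  moreover have "(LINT x|lborel. \<bar>conv ?g (mol n) x - ?g x\<bar>) = (LINT x|lborel. 2 * (?g x * (1 - conv ?g (mol n) x)))" for n
  proof -
    have e: "\<bar>conv ?g (mol n) x - ?g x\<bar> = 2 * (?g x * (1 - conv ?g (mol n) x)) + (conv ?g (mol n) x - ?g x)" for x
      using c0[of n x] c1[of n x] by (auto simp: indicator_def)
    have j: "integrable lborel (\<lambda>x. 2 * (?g x * (1 - conv ?g (mol n) x)))"
    proof (rule Bochner_Integration.integrable_bound[of _ "\<lambda>x. 2 * ?g x"])
      show "AE x in lborel. norm (2 * (?g x * (1 - conv ?g (mol n) x))) \<le> norm (2 * ?g x)"
        using c0 c1 by (intro AE_I2) (auto simp: indicator_def)
    qed (use g i in auto)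
    have "(LINT x|lborel. conv ?g (mol n) x) = (LINT x|lborel. ?g x)"
      unfolding mol_def by (rule conv_integral_nonneg[OF g r]) simp
    then show ?thesis unfolding e using j i[of n] g by simp
  qed
  ultimately show ?thesis by simp
qed

text \<open>Outer regularity reduces indicators of Borel sets of finite measure to open sets. Sums
  follow from the triangle inequality, and limits of dominated approximants from the density
  argument.\<close>

theorem conv_L1_tendsto:
  fixes g :: "real^'n::finite \<Rightarrow> real"
  assumes "integrable lborel g"
  shows "(\<lambda>n. LINT x|lborel. \<bar>conv g (mol n) x - g x\<bar>) \<longlonglongrightarrow> 0"
  using assms
proof (induction rule: integrable_induct)
  case (base A c)
  have [measurable]: "A \<in> sets borel" using base by simp
  have iA: "integrable lborel (indicator A :: real^'n \<Rightarrow> real)" using base by (simp add: integrable_indicator_iff)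
  have "(\<lambda>n. LINT x|lborel. \<bar>conv (indicator A) (mol n) x - indicator A x\<bar>) \<longlonglongrightarrow> 0"
  proof (rule conv_L1_tendsto_approx[OF iA])
    fix e :: real assume e: "e > 0"
    obtain U where U: "open U" "A \<subseteq> U" "emeasure lborel (U - A) < e"
      using outer_regular_lborel[of A e] base e by auto
    have [measurable]: "U \<in> sets borel" using U by simp
    have "emeasure lborel U = emeasure lborel (U - A) + emeasure lborel A"
      using U(2) by (subst plus_emeasure) (auto simp: Un_absorb2 intro!: arg_cong[where f="emeasure lborel"])
    then have fin: "emeasure lborel U < \<infinity>"
      using U(3) base(2) by (auto simp: less_top[symmetric] top_unique)
    have "(\<lambda>x. \<bar>indicator A x - indicator U x\<bar>) = (indicator (U - A) :: real^'n \<Rightarrow> real)"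
      by (rule ext) (use U(2) in \<open>auto simp: indicator_def\<close>)
    moreover have "measure lborel (U - A) \<le> e"
      using U(3) e unfolding measure_def by (intro enn2real_leI) auto
    ultimately show "\<exists>s. integrable lborel s \<and> (LINT x|lborel. \<bar>indicator A x - s x\<bar>) \<le> e \<and>
      (\<lambda>n. LINT x|lborel. \<bar>conv s (mol n) x - s x\<bar>) \<longlonglongrightarrow> 0"
      using conv_indicator_open_L1_tendsto[OF U(1) fin] fin
      by (intro exI[of _ "indicator U"]) (auto simp: integrable_indicator_iff)
  qed
  from tendsto_mult_right_zero[OF this, of "\<bar>c\<bar>"]
  have "(\<lambda>n. LINT x|lborel. \<bar>c\<bar> * \<bar>conv (indicator A) (mol n) x - indicator A x\<bar>) \<longlonglongrightarrow> 0" by simp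
  moreover have "\<bar>c\<bar> * \<bar>conv (indicator A) (mol n) x - indicator A x\<bar> =
      \<bar>conv (\<lambda>x. indicator A x *\<^sub>R c) (mol n) x - indicator A x *\<^sub>R c\<bar>" for n x
    by (simp add: conv_def abs_mult[symmetric] right_diff_distrib mult_ac)
  ultimately show ?case by simp
next
  case (add f g)
  have r: "inverse (real (Suc n)) > 0" for n by simp
  show ?case
  proof (rule tendsto_sandwich[OF _ _ tendsto_const])
    show "\<forall>\<^sub>F n in sequentially. 0 \<le> (LINT x|lborel. \<bar>conv (\<lambda>x. f x + g x) (mol n) x - (f x + g x)\<bar>)"
      by simp
    show "\<forall>\<^sub>F n in sequentially. (LINT x|lborel. \<bar>conv (\<lambda>x. f x + g x) (mol n) x - (f x + g x)\<bar>)
       \<le> (LINT x|lborel. \<bar>conv f (mol n) x - f x\<bar>) + (LINT x|lborel. \<bar>conv g (mol n) x - g x\<bar>)"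
    proof (rule always_eventually, rule allI)
      fix n
      have fg: "integrable lborel (\<lambda>x. f x + g x)" using add by simp
      note i = conv_integrable(1)[OF add.hyps(1) r[of n], folded mol_def] conv_integrable(1)[OF add.hyps(2) r[of n], folded mol_def]
        conv_integrable(1)[OF fg r[of n], folded mol_def]
      have "(LINT x|lborel. \<bar>conv (\<lambda>x. f x + g x) (mol n) x - (f x + g x)\<bar>)
        \<le> (LINT x|lborel. \<bar>conv f (mol n) x - f x\<bar> + \<bar>conv g (mol n) x - g x\<bar>)"
      proof (rule integral_mono)
        fix x
        have "conv (\<lambda>x. f x + g x) (mol n) x = conv f (mol n) x + conv g (mol n) x"
          unfolding mol_def by (rule conv_add[OF add.hyps kernel_mollifier]) simp
        then show "\<bar>conv (\<lambda>x. f x + g x) (mol n) x - (f x + g x)\<bar> \<le> \<bar>conv f (mol n) x - f x\<bar> + \<bar>conv g (mol n) x - g x\<bar>"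
          by linarith
      qed (use i add in auto)
      then show "(LINT x|lborel. \<bar>conv (\<lambda>x. f x + g x) (mol n) x - (f x + g x)\<bar>)
        \<le> (LINT x|lborel. \<bar>conv f (mol n) x - f x\<bar>) + (LINT x|lborel. \<bar>conv g (mol n) x - g x\<bar>)"
        using i add by simp
    qed
    show "(\<lambda>n. (LINT x|lborel. \<bar>conv f (mol n) x - f x\<bar>) + (LINT x|lborel. \<bar>conv g (mol n) x - g x\<bar>)) \<longlonglongrightarrow> 0"
      using tendsto_add[OF add.IH] by simp
  qed
next
  case (lim f s)
  show ?case
  proof (rule conv_L1_tendsto_approx[OF lim.hyps(4)])
    fix e :: real assume e: "e > 0"
    have "(\<lambda>i. LINT x|lborel. \<bar>f x - s i x\<bar>) \<longlonglongrightarrow> (LINT x::real^'n|lborel. 0)"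
    \<comment> \<open>The approximants of the induction principle satisfy |s i x| \<le> 2 |f x|,
      which accounts for the factor 3.\<close>
    proof (rule integral_dominated_convergence[where w="\<lambda>x. 3 * \<bar>f x\<bar>"])
      show "AE x in lborel. (\<lambda>i. \<bar>f x - s i x\<bar>) \<longlonglongrightarrow> 0"
      proof (rule AE_I2)
        fix x
        have "(\<lambda>i. s i x) \<longlonglongrightarrow> f x" using lim.hyps(2) by simp
        from tendsto_diff[OF tendsto_const[of "f x"] this] have "(\<lambda>i. f x - s i x) \<longlonglongrightarrow> 0" by simp
        then show "(\<lambda>i. \<bar>f x - s i x\<bar>) \<longlonglongrightarrow> 0" by (rule tendsto_rabs_zero)
      qed
      show "AE x in lborel. norm \<bar>f x - s i x\<bar> \<le> 3 * \<bar>f x\<bar>" for i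
      proof (rule AE_I2)
        fix x
        show "norm \<bar>f x - s i x\<bar> \<le> 3 * \<bar>f x\<bar>" using lim.hyps(3)[of x i] by simp
      qed
    qed (use lim in auto)
    then have "\<forall>\<^sub>F i in sequentially. (LINT x|lborel. \<bar>f x - s i x\<bar>) < e"
      using e by (intro order_tendstoD(2)) auto
    then obtain i where "(LINT x|lborel. \<bar>f x - s i x\<bar>) < e"
      by (auto simp: eventually_sequentially)
    then show "\<exists>s. integrable lborel s \<and> (LINT x|lborel. \<bar>f x - s x\<bar>) \<le> e \<and>
      (\<lambda>n. LINT x|lborel. \<bar>conv s (mol n) x - s x\<bar>) \<longlonglongrightarrow> 0"
      using lim.hyps(1) lim.IH by (intro exI[of _ "s i"]) auto
  qed
qed

subsection \<open>Limits of products\<close>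

lemma integrable_mult_L2:
  fixes f g :: "'a \<Rightarrow> real"
  assumes [measurable]: "f \<in> borel_measurable M" "g \<in> borel_measurable M"
    and "integrable M (\<lambda>x. (f x)\<^sup>2)" "integrable M (\<lambda>x. (g x)\<^sup>2)"
  shows "integrable M (\<lambda>x. f x * g x)"
proof (rule Bochner_Integration.integrable_bound[of _ "\<lambda>x. (f x)\<^sup>2 + (g x)\<^sup>2"])
  show "AE x in M. norm (f x * g x) \<le> norm ((f x)\<^sup>2 + (g x)\<^sup>2)"
  proof (rule AE_I2)
    fix x
    have "2 * (\<bar>f x\<bar> * \<bar>g x\<bar>) \<le> (f x)\<^sup>2 + (g x)\<^sup>2"
      using sum_squares_bound[of "\<bar>f x\<bar>" "\<bar>g x\<bar>"] by (simp add: mult.assoc)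
    moreover have "0 \<le> \<bar>f x\<bar> * \<bar>g x\<bar>" by simp
    ultimately show "norm (f x * g x) \<le> norm ((f x)\<^sup>2 + (g x)\<^sup>2)"
      unfolding real_norm_def abs_mult by linarith
  qed
qed (use assms in auto)

lemma Cauchy_Schwarz_integral:
  fixes f g :: "'a \<Rightarrow> real"
  assumes [measurable]: "f \<in> borel_measurable M" "g \<in> borel_measurable M"
    and f: "integrable M (\<lambda>x. (f x)\<^sup>2)" and g: "integrable M (\<lambda>x. (g x)\<^sup>2)"
  shows "(LINT x|M. \<bar>f x * g x\<bar>)\<^sup>2 \<le> (LINT x|M. (f x)\<^sup>2) * (LINT x|M. (g x)\<^sup>2)"
proof -
  have fg: "integrable M (\<lambda>x. \<bar>f x * g x\<bar>)"
    using integrable_mult_L2[OF assms] by simp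
  have "(\<integral>\<^sup>+x. ennreal \<bar>f x\<bar> * ennreal \<bar>g x\<bar> \<partial>M)\<^sup>2
      \<le> (\<integral>\<^sup>+x. (ennreal \<bar>f x\<bar>)\<^sup>2 \<partial>M) * (\<integral>\<^sup>+x. (ennreal \<bar>g x\<bar>)\<^sup>2 \<partial>M)"
    by (rule Cauchy_Schwarz_nn_integral) auto
  also have "(\<integral>\<^sup>+x. ennreal \<bar>f x\<bar> * ennreal \<bar>g x\<bar> \<partial>M) = ennreal (LINT x|M. \<bar>f x * g x\<bar>)"
    using nn_integral_eq_integral[OF fg] by (simp add: abs_mult ennreal_mult)
  also have "(\<integral>\<^sup>+x. (ennreal \<bar>f x\<bar>)\<^sup>2 \<partial>M) = ennreal (LINT x|M. (f x)\<^sup>2)"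
    using nn_integral_eq_integral[OF f] by (simp add: ennreal_power)
  also have "(\<integral>\<^sup>+x. (ennreal \<bar>g x\<bar>)\<^sup>2 \<partial>M) = ennreal (LINT x|M. (g x)\<^sup>2)"
    using nn_integral_eq_integral[OF g] by (simp add: ennreal_power)
  finally show ?thesis
    by (simp add: ennreal_power ennreal_mult[symmetric] integral_nonneg_AE ennreal_le_iff)
qed

lemma L2_tendsto_imp_L1_mult:
  fixes y u :: "'a \<Rightarrow> real"
  assumes [measurable]: "y \<in> borel_measurable M" "u \<in> borel_measurable M" "\<And>n. v n \<in> borel_measurable M"
    and y: "integrable M (\<lambda>x. (y x)\<^sup>2)" and uv: "\<And>n::nat. integrable M (\<lambda>x. (v n x - u x)\<^sup>2)"
    and lim: "(\<lambda>n. LINT x|M. (v n x - u x)\<^sup>2) \<longlonglongrightarrow> 0"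
  shows "(\<lambda>n. LINT x|M. \<bar>y x * v n x - y x * u x\<bar>) \<longlonglongrightarrow> 0"
proof -
  have "(\<lambda>n. sqrt ((LINT x|M. (y x)\<^sup>2) * (LINT x|M. (v n x - u x)\<^sup>2))) \<longlonglongrightarrow> sqrt ((LINT x|M. (y x)\<^sup>2) * 0)"
    by (intro tendsto_intros lim)
  then have l: "(\<lambda>n. sqrt ((LINT x|M. (y x)\<^sup>2) * (LINT x|M. (v n x - u x)\<^sup>2))) \<longlonglongrightarrow> 0" by simp
  have b: "(LINT x|M. \<bar>y x * v n x - y x * u x\<bar>) \<le> sqrt ((LINT x|M. (y x)\<^sup>2) * (LINT x|M. (v n x - u x)\<^sup>2))" for n
    using Cauchy_Schwarz_integral[of y M "\<lambda>x. v n x - u x"] y uv[of n]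
    by (intro real_le_rsqrt) (simp add: right_diff_distrib)
  show ?thesis
    by (rule tendsto_sandwich[OF _ _ tendsto_const l]) (auto simp: b)
qed

text \<open>The difference of the products splits into a_n (h_n - g), controlled by the uniform
  bound, and (a_n - b) g, controlled by dominated convergence. The bounded factors will be
  derivatives of truncations, which converge only almost everywhere, and the L1 factors mollified
  gradients.\<close>

lemma bounded_AE_mult_L1_tendsto:
  fixes g :: "'a \<Rightarrow> real"
  assumes [measurable]: "\<And>n. a n \<in> borel_measurable M" "b \<in> borel_measurable M"
    and bd: "\<And>n x. \<bar>a n x\<bar> \<le> B" and ae: "AE x in M. (\<lambda>n. a n x) \<longlonglongrightarrow> b x"
    and h: "\<And>n::nat. integrable M (h n)" and g: "integrable M g"
    and lim: "(\<lambda>n. LINT x|M. \<bar>h n x - g x\<bar>) \<longlonglongrightarrow> 0"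
  shows "(\<lambda>n. LINT x|M. a n x * h n x) \<longlonglongrightarrow> (LINT x|M. b x * g x)"
proof -
  have [measurable]: "g \<in> borel_measurable M" "\<And>n. h n \<in> borel_measurable M"
    using g h by (auto dest: borel_measurable_integrable)
  have B: "B \<ge> 0" using bd[of 0 undefined] by linarith
  have i1: "integrable M (\<lambda>x. a n x * (h n x - g x))" for n
    by (rule Bochner_Integration.integrable_bound[of _ "\<lambda>x. B * \<bar>h n x - g x\<bar>"])
       (use h g bd B in \<open>auto simp: abs_mult intro!: AE_I2 mult_right_mono\<close>)
  have i2: "integrable M (\<lambda>x. a n x * g x)" for n
    by (rule Bochner_Integration.integrable_bound[of _ "\<lambda>x. B * \<bar>g x\<bar>"])
       (use h g bd B in \<open>auto simp: abs_mult intro!: AE_I2 mult_right_mono\<close>)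
  have "(\<lambda>n. LINT x|M. a n x * (h n x - g x)) \<longlonglongrightarrow> 0"
  proof (rule Lim_null_comparison)
    show "(\<lambda>n. B * (LINT x|M. \<bar>h n x - g x\<bar>)) \<longlonglongrightarrow> 0"
      by (intro tendsto_mult_right_zero lim)
    show "\<forall>\<^sub>F n in sequentially. norm (LINT x|M. a n x * (h n x - g x)) \<le> B * (LINT x|M. \<bar>h n x - g x\<bar>)"
    proof (rule always_eventually, rule allI)
      fix n
      have "norm (LINT x|M. a n x * (h n x - g x)) \<le> (LINT x|M. norm (a n x * (h n x - g x)))"
        by (rule integral_norm_bound)
      also have "\<dots> \<le> (LINT x|M. B * \<bar>h n x - g x\<bar>)"
        by (rule integral_mono[OF integrable_norm[OF i1]])
           (use h g bd in \<open>auto simp: abs_mult intro!: mult_right_mono\<close>)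
      finally show "norm (LINT x|M. a n x * (h n x - g x)) \<le> B * (LINT x|M. \<bar>h n x - g x\<bar>)" by simp
    qed
  qed
  moreover have "(\<lambda>n. LINT x|M. a n x * g x) \<longlonglongrightarrow> (LINT x|M. b x * g x)"
  proof (rule integral_dominated_convergence[where w="\<lambda>x. B * \<bar>g x\<bar>"])
    show "AE x in M. (\<lambda>n. a n x * g x) \<longlonglongrightarrow> b x * g x"
      using ae by eventually_elim (intro tendsto_mult tendsto_const)
    show "AE x in M. norm (a n x * g x) \<le> B * \<bar>g x\<bar>" for n
      by (intro AE_I2) (simp add: abs_mult bd mult_right_mono)
  qed (use g in auto)
  ultimately have "(\<lambda>n. (LINT x|M. a n x * (h n x - g x)) + (LINT x|M. a n x * g x)) \<longlonglongrightarrow> 0 + (LINT x|M. b x * g x)"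
    by (rule tendsto_add)
  moreover have "(LINT x|M. a n x * h n x) = (LINT x|M. a n x * (h n x - g x)) + (LINT x|M. a n x * g x)" for n
    using i1[of n] i2[of n] by (subst Bochner_Integration.integral_add[symmetric]) (auto simp: algebra_simps)
  ultimately show ?thesis by simp
qed

lemma conv_square_integrable:
  assumes g: "integrable lborel g" "integrable lborel (\<lambda>x. (g x)\<^sup>2)"
  shows "integrable lborel (\<lambda>x. (conv g (mol n) x)\<^sup>2)"
    "(LINT x|lborel. (conv g (mol n) x)\<^sup>2) \<le> (LINT x|lborel. (g x)\<^sup>2)"
proof -
  have r: "inverse (real (Suc n)) > 0" by simp
  note c = conv_integrable[OF g(2) r, folded mol_def]
  have [measurable]: "conv g (mol n) \<in> borel_measurable borel"
    unfolding mol_def by (rule conv_measurable[OF g(1) kernel_mollifier]) simp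
  have le: "(conv g (mol n) x)\<^sup>2 \<le> \<bar>conv (\<lambda>x. (g x)\<^sup>2) (mol n) x\<bar>" for x
    using conv_square_le[OF g r, folded mol_def] abs_ge_self order_trans by blast
  show 1: "integrable lborel (\<lambda>x. (conv g (mol n) x)\<^sup>2)"
    by (rule Bochner_Integration.integrable_bound[OF c(1)]) (simp_all add: le)
  have "(LINT x|lborel. (conv g (mol n) x)\<^sup>2) \<le> (LINT x|lborel. \<bar>conv (\<lambda>x. (g x)\<^sup>2) (mol n) x\<bar>)"
    by (rule integral_mono[OF 1 integrable_abs[OF c(1)] le])
  then show "(LINT x|lborel. (conv g (mol n) x)\<^sup>2) \<le> (LINT x|lborel. (g x)\<^sup>2)"
    using c(2) by simp
qed

lemma conv_abs_le:
  assumes g: "integrable lborel g" and B: "AE y in lborel. \<bar>g y\<bar> \<le> B"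
  shows "\<bar>conv g (mol n) x\<bar> \<le> B"
proof -
  have r: "inverse (real (Suc n)) > 0" by simp
  let ?m = "\<lambda>y. mollifier (inverse (real (Suc n))) (x - y)"
  have i: "integrable lborel (\<lambda>y. g y * ?m y)" by (rule mollifier_integrable_integrand[OF g r])
  have "\<bar>conv g (mol n) x\<bar> \<le> (LINT y|lborel. norm (g y * ?m y))"
    unfolding conv_def mol_def using integral_norm_bound[of lborel "\<lambda>y. g y * ?m y"] by simp
  also have "\<dots> \<le> (LINT y|lborel. B * ?m y)"
  proof (rule integral_mono_AE[OF integrable_norm[OF i] integrable_mult_right[OF mollifier_reflect_integrable[OF r]]])
    show "AE y in lborel. norm (g y * ?m y) \<le> B * ?m y"
      using B by eventually_elim (simp add: abs_mult mollifier_nonneg mult_right_mono)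
  qed
  finally show ?thesis using mollifier_reflect_integral[OF r, of x] by simp
qed

text \<open>Deduced from L1 convergence. For the part of g of height at most N the error is bounded
  by 2 N, so its square is at most 2 N times the L1 error. The remaining part is small in L2, and
  convolution does not increase its L2 norm.\<close>

theorem conv_L2_tendsto:
  fixes g :: "real^'n::finite \<Rightarrow> real"
  assumes g: "integrable lborel g" "integrable lborel (\<lambda>x. (g x)\<^sup>2)"
  shows "integrable lborel (\<lambda>x. (conv g (mol n) x - g x)\<^sup>2)"
    and "(\<lambda>n. LINT x|lborel. (conv g (mol n) x - g x)\<^sup>2) \<longlonglongrightarrow> 0"
proof -
  have r: "inverse (real (Suc n)) > 0" for n by simp
  have gm [measurable]: "g \<in> borel_measurable borel" using g(1) by (auto dest: borel_measurable_integrable)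
  have cm [measurable]: "conv f (mol n) \<in> borel_measurable borel" if "integrable lborel f" for f :: "real^'n \<Rightarrow> real" and n
    unfolding mol_def by (rule conv_measurable[OF that kernel_mollifier]) simp
  have [measurable]: "conv g (mol n) \<in> borel_measurable borel" for n by (rule cm[OF g(1)])
  have i: "integrable lborel (\<lambda>x. (conv g (mol n) x - g x)\<^sup>2)" for n
    using conv_square_integrable(1)[OF g] g integrable_mult_L2[of "conv g (mol n)" lborel g]
    by (simp add: power2_diff mult.assoc)
  show "integrable lborel (\<lambda>x. (conv g (mol n) x - g x)\<^sup>2)" by (rule i)
  show "(\<lambda>n. LINT x|lborel. (conv g (mol n) x - g x)\<^sup>2) \<longlonglongrightarrow> 0"
  proof (rule order_tendstoI)
    fix a :: real assume "a < 0"
    moreover have "0 \<le> (LINT x|lborel. (conv g (mol n) x - g x)\<^sup>2)" for n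
      by (rule integral_nonneg_AE) simp
    ultimately show "\<forall>\<^sub>F n in sequentially. a < (LINT x|lborel. (conv g (mol n) x - g x)\<^sup>2)"
      by (intro always_eventually allI) (meson less_le_trans)
  next
    fix a :: real assume a: "0 < a"
    define b where "b N x = (if \<bar>g x\<bar> \<le> real N then g x else 0)" for N x
    have [measurable]: "b N \<in> borel_measurable borel" for N unfolding b_def[abs_def] by measurable
    have "(\<lambda>N. LINT x|lborel. (g x - b N x)\<^sup>2) \<longlonglongrightarrow> (LINT x::real^'n|lborel. 0)"
    proof (rule integral_dominated_convergence[where w="\<lambda>x. (g x)\<^sup>2"])
      show "AE x in lborel. (\<lambda>N. (g x - b N x)\<^sup>2) \<longlonglongrightarrow> 0"
      proof (rule AE_I2)
        fix x
        obtain N where N: "\<bar>g x\<bar> \<le> real N" using real_arch_simple by blast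
        have "\<forall>\<^sub>F n in sequentially. 0 = (g x - b n x)\<^sup>2"
          unfolding eventually_sequentially by (rule exI[of _ N]) (use N in \<open>auto simp: b_def\<close>)
        then show "(\<lambda>N. (g x - b N x)\<^sup>2) \<longlonglongrightarrow> 0" by (rule Lim_transform_eventually[OF tendsto_const])
      qed
    qed (use g in \<open>auto simp: b_def\<close>)
    \<comment> \<open>The remainder and its convolution both enter with a factor 3, costing at most
      a / 4 together; a / 2 is reserved for the bounded part.\<close>
    then have "\<forall>\<^sub>F N in sequentially. (LINT x|lborel. (g x - b N x)\<^sup>2) < a / 24"
      using a by (intro order_tendstoD(2)) auto
    then obtain N where N: "(LINT x|lborel. (g x - b N x)\<^sup>2) < a / 24"
      by (auto simp: eventually_sequentially)
    have ib: "integrable lborel (b N)" "integrable lborel (\<lambda>x. g x - b N x)"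
      by (rule Bochner_Integration.integrable_bound[OF g(1)]; auto simp: b_def)+
    have ie2: "integrable lborel (\<lambda>x. (g x - b N x)\<^sup>2)"
      by (rule Bochner_Integration.integrable_bound[OF g(2)]; auto simp: b_def)
    have bN: "\<bar>b N x\<bar> \<le> real N" for x by (simp add: b_def)
    have cN: "\<bar>conv (b N) (mol n) x\<bar> \<le> real N" for n x
      by (rule conv_abs_le[OF ib(1)]) (simp add: bN)
    have "(\<lambda>n. LINT x|lborel. \<bar>conv (b N) (mol n) x - b N x\<bar>) \<longlonglongrightarrow> 0"
      by (rule conv_L1_tendsto[OF ib(1)])
    then have "(\<lambda>n. (6 * real N) * (LINT x|lborel. \<bar>conv (b N) (mol n) x - b N x\<bar>)) \<longlonglongrightarrow> 0"
      by (rule tendsto_mult_right_zero)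
    then have "\<forall>\<^sub>F n in sequentially. (6 * real N) * (LINT x|lborel. \<bar>conv (b N) (mol n) x - b N x\<bar>) < a / 2"
      using a by (intro order_tendstoD(2)) auto
    then show "\<forall>\<^sub>F n in sequentially. (LINT x|lborel. (conv g (mol n) x - g x)\<^sup>2) < a"
    proof eventually_elim
      case (elim n)
      let ?c = "conv (b N) (mol n)" and ?e = "conv (\<lambda>x. g x - b N x) (mol n)"
      note j = conv_integrable(1)[OF ib(1) r, folded mol_def] conv_square_integrable[OF ib(2) ie2]
      have "(LINT x|lborel. (conv g (mol n) x - g x)\<^sup>2) \<le>
        (LINT x|lborel. 6 * real N * \<bar>?c x - b N x\<bar> + 3 * (?e x)\<^sup>2 + 3 * (g x - b N x)\<^sup>2)"
      proof (rule integral_mono[OF i])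
        fix x
        have "?e x = conv g (mol n) x - ?c x"
          unfolding mol_def by (rule conv_diff[OF g(1) ib(1) kernel_mollifier]) simp
        then have e: "conv g (mol n) x - g x = (?c x - b N x) + ?e x + (-(g x - b N x))" by simp
        have sq: "(p + q + s)\<^sup>2 \<le> 3 * p\<^sup>2 + 3 * q\<^sup>2 + 3 * s\<^sup>2" for p q s :: real
          using sum_squares_bound[of p q] sum_squares_bound[of p s] sum_squares_bound[of q s]
          by (simp add: power2_eq_square algebra_simps)
        have "\<bar>?c x - b N x\<bar> \<le> 2 * real N" using bN[of x] cN[of n x] by linarith
        then have "(?c x - b N x)\<^sup>2 \<le> 2 * real N * \<bar>?c x - b N x\<bar>"
          using mult_right_mono[of "\<bar>?c x - b N x\<bar>" "2 * real N" "\<bar>?c x - b N x\<bar>"]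
          by (simp add: power2_eq_square)
        then show "(conv g (mol n) x - g x)\<^sup>2 \<le> 6 * real N * \<bar>?c x - b N x\<bar> + 3 * (?e x)\<^sup>2 + 3 * (g x - b N x)\<^sup>2"
          unfolding e using sq[of "?c x - b N x" "?e x" "-(g x - b N x)", unfolded power2_minus] by linarith
      qed (use j ib ie2 in auto)
      also have "\<dots> = 6 * real N * (LINT x|lborel. \<bar>?c x - b N x\<bar>) + 3 * (LINT x|lborel. (?e x)\<^sup>2) + 3 * (LINT x|lborel. (g x - b N x)\<^sup>2)"
        using j ib ie2 by simp
      finally show ?case using elim N j(3)[of n] a by linarith
    qed
  qed
qed

subsection \<open>Integration in the plane\<close>

definition v2 :: "real \<Rightarrow> real \<Rightarrow> real^2" where
  "v2 a b = a *\<^sub>R axis 1 1 + b *\<^sub>R axis 2 1"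

lemma v2_nth [simp]: "v2 a b $ 1 = a" "v2 a b $ 2 = b"
  by (simp_all add: v2_def axis_def)

lemma v2_measurable [measurable (raw)]:
  "f \<in> borel_measurable M \<Longrightarrow> g \<in> borel_measurable M \<Longrightarrow> (\<lambda>x. v2 (f x) (g x)) \<in> borel_measurable M"
  unfolding v2_def by (intro borel_measurable_add borel_measurable_scaleR) auto

text \<open>Boxes determine Lebesgue measure, so side lengths are all that has to be compared. The
  purpose is Fubini along horizontal and vertical lines.\<close>

lemma lborel_eq_distr_v2: "(lborel :: (real^2) measure) = distr (lborel \<Otimes>\<^sub>M lborel) borel (\<lambda>(a, b). v2 a b)"
proof (rule lborel_eqI)
  have [measurable]: "(\<lambda>(a, b). v2 a b) \<in> borel_measurable (lborel \<Otimes>\<^sub>M lborel)" by measurable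
  have B: "(Basis :: (real^2) set) = {axis 1 1, axis 2 1}"
    by (auto simp: Basis_vec_def UNIV_2)
  have ne: "axis 1 (1::real) \<noteq> (axis 2 1 :: real^2)" by (simp add: axis_eq_axis)
  fix l u :: "real^2" assume le: "\<And>b. b \<in> Basis \<Longrightarrow> l \<bullet> b \<le> u \<bullet> b"
  then have le: "l $ 1 \<le> u $ 1" "l $ 2 \<le> u $ 2" unfolding B by (auto simp: cart_eq_inner_axis)
  have "(\<lambda>(a, b). v2 a b) -` box l u \<inter> space (lborel \<Otimes>\<^sub>M lborel) = {l $ 1<..<u $ 1} \<times> {l $ 2<..<u $ 2}"
    by (auto simp: mem_box_cart forall_2 space_pair_measure)
  then have "emeasure (distr (lborel \<Otimes>\<^sub>M lborel) borel (\<lambda>(a, b). v2 a b)) (box l u) =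
     emeasure (lborel \<Otimes>\<^sub>M lborel) ({l $ 1<..<u $ 1} \<times> {l $ 2<..<u $ 2})"
    by (subst emeasure_distr) auto
  also have "\<dots> = ennreal (u $ 1 - l $ 1) * ennreal (u $ 2 - l $ 2)"
    using le by (subst lborel.emeasure_pair_measure_Times) auto
  also have "\<dots> = (\<Prod>b\<in>Basis. (u - l) \<bullet> b)"
    unfolding B using ne le by (simp add: ennreal_mult inner_diff_left cart_eq_inner_axis[symmetric])
  finally show "emeasure (distr (lborel \<Otimes>\<^sub>M lborel) borel (\<lambda>(a, b). v2 a b)) (box l u) = (\<Prod>b\<in>Basis. (u - l) \<bullet> b)" .
qed simp

lemma nn_integral_plane:
  fixes g :: "real^2 \<Rightarrow> ennreal"
  assumes [measurable]: "g \<in> borel_measurable borel"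
  shows "(\<integral>\<^sup>+x. g x \<partial>lborel) = (\<integral>\<^sup>+a. \<integral>\<^sup>+b. g (v2 a b) \<partial>lborel \<partial>lborel)"
    and "(\<integral>\<^sup>+x. g x \<partial>lborel) = (\<integral>\<^sup>+b. \<integral>\<^sup>+a. g (v2 a b) \<partial>lborel \<partial>lborel)"
proof -
  have [measurable]: "(\<lambda>(a, b). v2 a b) \<in> borel_measurable (lborel \<Otimes>\<^sub>M lborel)" by measurable
  have "(\<integral>\<^sup>+x. g x \<partial>lborel) = (\<integral>\<^sup>+z. g (case z of (a, b) \<Rightarrow> v2 a b) \<partial>(lborel \<Otimes>\<^sub>M lborel))"
    by (subst lborel_eq_distr_v2, subst nn_integral_distr) auto
  also have 1: "\<dots> = (\<integral>\<^sup>+a. \<integral>\<^sup>+b. g (v2 a b) \<partial>lborel \<partial>lborel)"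
    by (subst lborel.nn_integral_fst[symmetric]) auto
  finally show "(\<integral>\<^sup>+x. g x \<partial>lborel) = (\<integral>\<^sup>+a. \<integral>\<^sup>+b. g (v2 a b) \<partial>lborel \<partial>lborel)" .
  also have "\<dots> = (\<integral>\<^sup>+b. \<integral>\<^sup>+a. g (v2 a b) \<partial>lborel \<partial>lborel)"
    by (rule lborel_pair.Fubini'[symmetric]) measurable
  finally show "(\<integral>\<^sup>+x. g x \<partial>lborel) = (\<integral>\<^sup>+b. \<integral>\<^sup>+a. g (v2 a b) \<partial>lborel \<partial>lborel)" .
qed

text \<open>Phrased with the extended nonnegative integral so that it can be used on every line and
  then integrated over all lines without asking for integrability on each of them.\<close>

lemma FTC_abs_le:
  fixes \<phi> \<phi>' :: "real \<Rightarrow> real"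
  assumes "a \<le> b" "\<And>x. (\<phi> has_real_derivative \<phi>' x) (at x)" "continuous_on UNIV \<phi>'"
  shows "ennreal \<bar>\<phi> b - \<phi> a\<bar> \<le> (\<integral>\<^sup>+x. ennreal \<bar>\<phi>' x\<bar> * indicator {a..b} x \<partial>lborel)"
proof -
  have c: "isCont \<phi>' x" for x using assms(3) continuous_on_eq_continuous_at open_UNIV by blast
  note F = has_bochner_integral_FTC_Icc_real[OF assms(1) assms(2) c]
  have i: "integrable lborel (\<lambda>x. \<phi>' x * indicator {a..b} x)"
    and e: "(LINT x|lborel. \<phi>' x * indicator {a..b} x) = \<phi> b - \<phi> a"
    using F by (auto simp: has_bochner_integral_iff)
  show ?thesis
    using integral_norm_bound_ennreal[OF i]
    by (simp add: e abs_mult ennreal_mult' ennreal_indicator)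
qed

lemma C1_grad_lines:
  assumes "C1_grad g D"
  shows "((\<lambda>t. g (p + v2 t b)) has_real_derivative D (p + v2 t b) $ 1) (at t)"
    and "((\<lambda>t. g (p + v2 b t)) has_real_derivative D (p + v2 b t) $ 2) (at t)"
proof -
  have "((\<lambda>t. p + v2 t b) has_derivative (\<lambda>h. h *\<^sub>R axis 1 1)) (at t)"
    "((\<lambda>t. p + v2 b t) has_derivative (\<lambda>h. h *\<^sub>R axis 2 1)) (at t)"
    unfolding v2_def by (auto intro!: derivative_eq_intros)
  from this[THEN has_derivative_compose, OF C1_gradD[OF assms] ]
  show "((\<lambda>t. g (p + v2 t b)) has_real_derivative D (p + v2 t b) $ 1) (at t)"
    "((\<lambda>t. g (p + v2 b t)) has_real_derivative D (p + v2 b t) $ 2) (at t)"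
    by (auto simp: has_field_derivative_def cart_eq_inner_axis mult_commute_abs)
qed

lemma v2_continuous [continuous_intros]:
  "continuous_on A f \<Longrightarrow> continuous_on A g \<Longrightarrow> continuous_on A (\<lambda>x. v2 (f x) (g x))"
  unfolding v2_def by (intro continuous_intros)

lemma C1_grad_eq_0:
  assumes "C1_grad g D" "closed K" "\<And>x. x \<notin> K \<Longrightarrow> g x = 0" "x \<notin> K"
  shows "D x = 0"
proof -
  have "partial i g x = 0" for i
    by (rule partial_eq_0_outside[of "- K"]) (use assms in auto)
  then show ?thesis using C1_grad_partial[OF assms(1)] by (simp add: vec_eq_iff)
qed

lemma C1_grad_measurable:
  assumes "C1_grad g D" shows "g \<in> borel_measurable borel" "D \<in> borel_measurable borel"
    "(\<lambda>x. D x $ i) \<in> borel_measurable borel"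
  using C1_grad_continuous[OF assms] C1_grad_continuous_grad[OF assms]
  by (auto intro!: borel_measurable_continuous_onI continuous_on_component)

text \<open>By translation invariance every difference quotient of g integrates to 0. The quotients
  are bounded by the Lipschitz constant and converge to the partial derivative, so dominated
  convergence applies.\<close>

lemma C1_compact_support_integral_0:
  fixes g :: "real^'n::finite \<Rightarrow> real"
  assumes g: "C1_grad g D" and K: "compact K" "\<And>x. x \<notin> K \<Longrightarrow> g x = 0"
  shows "(LINT x|lborel. D x $ i) = 0"
proof -
  define t where "t n = inverse (real (Suc n))" for n
  have t: "t n > 0" "t n \<le> 1" "t \<longlonglongrightarrow> 0" for n
    using LIMSEQ_inverse_real_of_nat unfolding t_def by (auto simp: inverse_le_1_iff)
  let ?e = "axis i 1 :: real^'n"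
  define q where "q n x = (g (x + t n *\<^sub>R ?e) - g x) / t n" for n x
  have gi: "integrable lborel g"
    by (rule integrable_continuous_compact_support[OF C1_grad_continuous[OF g] K])
  note [measurable] = C1_grad_measurable[OF g]
  have tr: "integrable lborel (\<lambda>x. g (x + c))" "(LINT x|lborel. g (x + c)) = (LINT x|lborel. g x)" for c
  proof -
    have "integrable (distr lborel borel ((+) c)) g" using gi by (simp add: lborel_distr_plus)
    then show "integrable lborel (\<lambda>x. g (x + c))"
      by (subst (asm) integrable_distr_eq) (auto simp: add.commute)
    have "(LINT x|lborel. g x) = (LINT x|distr lborel borel ((+) c). g x)" by (simp add: lborel_distr_plus)
    also have "\<dots> = (LINT x|lborel. g (x + c))"
      by (subst integral_distr) (auto simp: add.commute)
    finally show "(LINT x|lborel. g (x + c)) = (LINT x|lborel. g x)" by simp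
  qed
  have q0: "(LINT x|lborel. q n x) = 0" for n
    unfolding q_def using tr[of "t n *\<^sub>R ?e"] gi by simp
  have D0: "D x = 0" if "x \<notin> K" for x
    using C1_grad_eq_0[OF g compact_imp_closed[OF K(1)] K(2) that] .
  obtain L where L: "L \<ge> 0" "\<And>x. norm (D x) \<le> L"
    using continuous_compact_support_bounded[OF C1_grad_continuous_grad[OF g] K(1) D0] by blast
  note lip = C1_grad_lipschitz[OF g L(2)]
  \<comment> \<open>The increments are at most 1, so the unit enlargement of K contains the supports
    of all difference quotients and carries an integrable majorant.\<close>
  define K' where "K' = {x + y |x y. x \<in> K \<and> y \<in> cball (0 :: real^'n) 1}"
  have K': "compact K'" unfolding K'_def by (intro compact_sums K compact_cball)
  have [measurable]: "K' \<in> sets borel" using K' by (intro borel_closed compact_imp_closed)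
  have "(\<lambda>n. LINT x|lborel. q n x) \<longlonglongrightarrow> (LINT x|lborel. D x $ i)"
  proof (rule integral_dominated_convergence[where w="\<lambda>x. L * indicator K' x"])
    show "integrable lborel (\<lambda>x. L * indicator K' x)"
      using emeasure_compact_finite[OF K'] by (intro integrable_mult_right) (auto simp: integrable_indicator_iff less_top)
    show "(\<lambda>x. D x $ i) \<in> borel_measurable lborel" "q n \<in> borel_measurable lborel" for n
      unfolding q_def[abs_def] by measurable
    show "AE x in lborel. norm (q n x) \<le> L * indicator K' x" for n
    proof (rule AE_I2)
      fix x
      show "norm (q n x) \<le> L * indicator K' x"
      proof (cases "x \<in> K'")
        case True
        then show ?thesis using lip[of "x + t n *\<^sub>R ?e" x] t(1)[of n]
          by (simp add: q_def divide_le_eq)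
      next
        case False
        have "x \<notin> K"
        proof
          assume "x \<in> K" then have "x + 0 \<in> K'" unfolding K'_def by force
          with False show False by simp
        qed
        moreover have "x + t n *\<^sub>R ?e \<notin> K"
        proof
          assume "x + t n *\<^sub>R ?e \<in> K"
          moreover have "- (t n *\<^sub>R ?e) \<in> cball 0 1" using t(1,2)[of n] by simp
          ultimately have "(x + t n *\<^sub>R ?e) + (- (t n *\<^sub>R ?e)) \<in> K'" unfolding K'_def by blast
          with False show False by simp
        qed
        ultimately show ?thesis using False K(2) by (simp add: q_def)
      qed
    qed
    show "AE x in lborel. (\<lambda>n. q n x) \<longlonglongrightarrow> D x $ i"
    proof (rule AE_I2)
      fix x
      have "((\<lambda>s. x + s *\<^sub>R ?e) has_derivative (\<lambda>h. h *\<^sub>R ?e)) (at 0)"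
        by (auto intro!: derivative_eq_intros)
      moreover have "(g has_derivative (\<lambda>h. D x \<bullet> h)) (at (x + 0 *\<^sub>R ?e))"
        using C1_gradD[OF g, of x] by simp
      ultimately have "((\<lambda>s. g (x + s *\<^sub>R ?e)) has_derivative (\<lambda>h. D x \<bullet> (h *\<^sub>R ?e))) (at 0)"
        by (rule has_derivative_compose)
      then have "((\<lambda>s. g (x + s *\<^sub>R ?e)) has_real_derivative D x $ i) (at 0)"
        by (auto simp: has_field_derivative_def cart_eq_inner_axis mult_commute_abs)
      then have "((\<lambda>s. (g (x + s *\<^sub>R ?e) - g x) / s) \<longlongrightarrow> D x $ i) (at 0)"
        by (simp add: DERIV_def)
      moreover have "filterlim t (at 0) sequentially"
        unfolding filterlim_at using t by (auto intro!: always_eventually) (metis less_irrefl)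
      ultimately show "(\<lambda>n. q n x) \<longlonglongrightarrow> D x $ i"
        unfolding q_def by (rule filterlim_compose)
    qed
  qed
  then show ?thesis by (simp add: q0 LIMSEQ_const_iff)
qed

text \<open>The Gagliardo-Nirenberg argument: |g| at a point is at most the integral of |D| over the
  horizontal line through it, and also over the vertical one. The product of these two bounds is a
  function of b times a function of a, so its integral over the plane factorises.\<close>

lemma planar_Sobolev:
  fixes g :: "real^2 \<Rightarrow> real"
  assumes g: "C1_grad g D" and K: "compact K" "\<And>x. x \<notin> K \<Longrightarrow> g x = 0"
  shows "(\<integral>\<^sup>+x. ennreal ((g x)\<^sup>2) \<partial>lborel) \<le> (\<integral>\<^sup>+x. ennreal (norm (D x)) \<partial>lborel)\<^sup>2"
proof -
  note [measurable] = C1_grad_measurable[OF g]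
  obtain M where M: "M > 0" "\<And>x. x \<in> K \<Longrightarrow> norm x \<le> M"
    using compact_imp_bounded[OF K(1)] by (auto simp: bounded_pos)
  have z: "g (v2 a b) = 0" if "\<bar>a\<bar> > M \<or> \<bar>b\<bar> > M" for a b
    using M(2)[of "v2 a b"] component_le_norm_cart[of "v2 a b" 1] component_le_norm_cart[of "v2 a b" 2] that
    by (intro K(2)) auto
  define A where "A b = (\<integral>\<^sup>+t. ennreal (norm (D (v2 t b))) \<partial>lborel)" for b
  define B where "B a = (\<integral>\<^sup>+t. ennreal (norm (D (v2 a t))) \<partial>lborel)" for a
  have cont: "continuous_on UNIV (\<lambda>t. D (v2 t b) $ i)" "continuous_on UNIV (\<lambda>t. D (v2 b t) $ i)" for b i
    by (auto intro!: continuous_on_component continuous_on_compose2[OF C1_grad_continuous_grad[OF g, of UNIV]] continuous_intros)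
  have mA: "A \<in> borel_measurable borel" and mB: "B \<in> borel_measurable borel"
    unfolding A_def[abs_def] B_def[abs_def] by measurable
  have gA: "ennreal \<bar>g (v2 a b)\<bar> \<le> A b" for a b
  proof -
    \<comment> \<open>A starting point where g vanishes because it lies left of the support; if a is
      already that far left, the starting point is a itself and the bound is trivial.\<close>
    define m where "m = min a (- M - 1)"
    have "ennreal \<bar>g (v2 a b) - g (v2 m b)\<bar> \<le> (\<integral>\<^sup>+x. ennreal \<bar>D (v2 x b) $ 1\<bar> * indicator {m..a} x \<partial>lborel)"
      using C1_grad_lines(1)[OF g, of 0 b] cont(1)[of b 1]
      by (intro FTC_abs_le) (auto simp: m_def)
    also have "\<dots> \<le> A b"
      unfolding A_def by (intro nn_integral_mono) (auto simp: indicator_def component_le_norm_cart ennreal_leI)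
    finally show ?thesis using z[of m b] z[of a b] M(1) by (auto simp: m_def min_def split: if_splits)
  qed
  have gB: "ennreal \<bar>g (v2 a b)\<bar> \<le> B a" for a b
  proof -
    define m where "m = min b (- M - 1)"
    have "ennreal \<bar>g (v2 a b) - g (v2 a m)\<bar> \<le> (\<integral>\<^sup>+x. ennreal \<bar>D (v2 a x) $ 2\<bar> * indicator {m..b} x \<partial>lborel)"
      using C1_grad_lines(2)[OF g, of 0 a] cont(2)[of a 2]
      by (intro FTC_abs_le) (auto simp: m_def)
    also have "\<dots> \<le> B a"
      unfolding B_def by (intro nn_integral_mono) (auto simp: indicator_def component_le_norm_cart ennreal_leI)
    finally show ?thesis using z[of a m] z[of a b] M(1) by (auto simp: m_def min_def split: if_splits)
  qed
  have "(\<integral>\<^sup>+x. ennreal ((g x)\<^sup>2) \<partial>lborel) = (\<integral>\<^sup>+a. \<integral>\<^sup>+b. ennreal ((g (v2 a b))\<^sup>2) \<partial>lborel \<partial>lborel)"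
    by (rule nn_integral_plane) measurable
  also have "\<dots> \<le> (\<integral>\<^sup>+a. \<integral>\<^sup>+b. B a * A b \<partial>lborel \<partial>lborel)"
  proof (intro nn_integral_mono)
    fix a b
    have "ennreal ((g (v2 a b))\<^sup>2) = ennreal \<bar>g (v2 a b)\<bar> * ennreal \<bar>g (v2 a b)\<bar>"
      by (simp add: ennreal_mult[symmetric] power2_eq_square abs_mult_self_eq)
    also have "\<dots> \<le> B a * A b" by (intro mult_mono gA gB) auto
    finally show "ennreal ((g (v2 a b))\<^sup>2) \<le> B a * A b" .
  qed
  also have "\<dots> = (\<integral>\<^sup>+a. B a \<partial>lborel) * (\<integral>\<^sup>+b. A b \<partial>lborel)"
    using mA mB by (simp add: nn_integral_cmult nn_integral_multc)
  also have "(\<integral>\<^sup>+b. A b \<partial>lborel) = (\<integral>\<^sup>+x. ennreal (norm (D x)) \<partial>lborel)"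
    unfolding A_def by (rule nn_integral_plane(2)[symmetric]) measurable
  also have "(\<integral>\<^sup>+a. B a \<partial>lborel) = (\<integral>\<^sup>+x. ennreal (norm (D x)) \<partial>lborel)"
    unfolding B_def by (rule nn_integral_plane(1)[symmetric]) measurable
  finally show ?thesis by (simp add: power2_eq_square)
qed


subsection \<open>Squares\<close>

definition osquare :: "real^2 \<Rightarrow> real \<Rightarrow> (real^2) set" where
  "osquare p s = {x. \<forall>i. \<bar>x $ i - p $ i\<bar> < s}"

definition csquare :: "real^2 \<Rightarrow> real \<Rightarrow> (real^2) set" where
  "csquare p s = {x. \<forall>i. \<bar>x $ i - p $ i\<bar> \<le> s}"

lemma osquare_eq_box: "osquare p s = box (p - v2 s s) (p + v2 s s)"
  by (auto simp: osquare_def mem_box_cart forall_2)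

lemma csquare_eq_cbox: "csquare p s = cbox (p - v2 s s) (p + v2 s s)"
  by (auto simp: csquare_def mem_box_cart forall_2)

lemma open_osquare: "open (osquare p s)"
  by (simp add: osquare_eq_box open_box)

lemma compact_csquare: "compact (csquare p s)"
  by (simp add: csquare_eq_cbox compact_cbox)

lemma osquare_sets [measurable]: "osquare p s \<in> sets borel"
  by (simp add: osquare_eq_box)

lemma csquare_sets [measurable]: "csquare p s \<in> sets borel"
  by (simp add: csquare_eq_cbox)

lemma osquare_subset_csquare: "s \<le> s' \<Longrightarrow> osquare p s \<subseteq> csquare p s'"
  by (clarsimp simp: osquare_def csquare_def) (meson less_imp_le less_le_trans)

lemma osquare_mono: "s \<le> s' \<Longrightarrow> osquare p s \<subseteq> osquare p s'"
  by (clarsimp simp: osquare_def) (meson less_le_trans)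

lemma csquare_mono: "s \<le> s' \<Longrightarrow> csquare p s \<subseteq> csquare p s'"
  by (clarsimp simp: csquare_def) (meson order_trans)

lemma csquare_subset_osquare: "s < s' \<Longrightarrow> csquare p s \<subseteq> osquare p s'"
  by (clarsimp simp: osquare_def csquare_def) (meson le_less_trans)

lemma emeasure_csquare:
  assumes "s \<ge> 0"
  shows "emeasure lborel (csquare p s) = ennreal (4 * s\<^sup>2)" "emeasure lborel (osquare p s) = ennreal (4 * s\<^sup>2)"
proof -
  have B: "(Basis :: (real^2) set) = {axis 1 1, axis 2 1}"
    by (auto simp: Basis_vec_def UNIV_2)
  have ne: "axis 1 (1::real) \<noteq> (axis 2 1 :: real^2)" by (simp add: axis_eq_axis)
  show "emeasure lborel (csquare p s) = ennreal (4 * s\<^sup>2)"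
    unfolding csquare_eq_cbox emeasure_lborel_cbox_eq B
    using ne assms by (simp add: cart_eq_inner_axis[symmetric] power2_eq_square)
  show "emeasure lborel (osquare p s) = ennreal (4 * s\<^sup>2)"
    unfolding osquare_eq_box emeasure_lborel_box_eq B
    using ne assms by (simp add: cart_eq_inner_axis[symmetric] power2_eq_square)
qed

lemma square_boundary_null: "emeasure lborel (csquare p s - osquare p s) = 0"
proof (cases "s \<ge> 0")
  case True
  have "emeasure lborel (csquare p s - osquare p s) = emeasure lborel (csquare p s) - emeasure lborel (osquare p s)"
    by (rule emeasure_Diff) (use True osquare_subset_csquare in \<open>auto simp: emeasure_csquare\<close>)
  then show ?thesis using True by (simp add: emeasure_csquare)
next
  case False
  then have "csquare p s = {}" by (force simp: csquare_def)
  then show ?thesis by simp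
qed

text \<open>The fundamental theorem of calculus followed by Cauchy-Schwarz against the constant 1 on
  the interval. On a side of length 2 s with energy at most \<theta> / s the right-hand side no
  longer depends on s.\<close>

lemma oscillation_le_energy:
  fixes \<phi> \<phi>' :: "real \<Rightarrow> real"
  assumes \<phi>: "\<And>x. (\<phi> has_real_derivative \<phi>' x) (at x)" "continuous_on UNIV \<phi>'"
    and q: "(\<integral>\<^sup>+x. ennreal ((\<phi>' x)\<^sup>2) * indicator {\<alpha>..\<beta>} x \<partial>lborel) \<le> ennreal q" "q \<ge> 0"
    and t: "t \<in> {\<alpha>..\<beta>}" "t' \<in> {\<alpha>..\<beta>}"
  shows "(\<phi> t - \<phi> t')\<^sup>2 \<le> (\<beta> - \<alpha>) * q"
  using t
proof (induction t' t rule: linorder_wlog)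
  case (sym a b)
  then show ?case by (simp add: power2_commute)
next
  case (le t' t)
  have [measurable]: "\<phi>' \<in> borel_measurable borel" by (rule borel_measurable_continuous_onI[OF \<phi>(2)])
  have "ennreal \<bar>\<phi> t - \<phi> t'\<bar> \<le> (\<integral>\<^sup>+x. ennreal \<bar>\<phi>' x\<bar> * indicator {t'..t} x \<partial>lborel)"
    by (rule FTC_abs_le[OF le(1) \<phi>])
  also have "\<dots> \<le> (\<integral>\<^sup>+x. (ennreal \<bar>\<phi>' x\<bar> * indicator {\<alpha>..\<beta>} x) * indicator {\<alpha>..\<beta>} x \<partial>lborel)"
    using le by (intro nn_integral_mono) (auto simp: indicator_def)
  finally have "(ennreal \<bar>\<phi> t - \<phi> t'\<bar>)\<^sup>2 \<le> (\<integral>\<^sup>+x. (ennreal \<bar>\<phi>' x\<bar> * indicator {\<alpha>..\<beta>} x) * indicator {\<alpha>..\<beta>} x \<partial>lborel)\<^sup>2"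
    by (rule power_mono) simp
  also have "\<dots> \<le> (\<integral>\<^sup>+x. (ennreal \<bar>\<phi>' x\<bar> * indicator {\<alpha>..\<beta>} x)\<^sup>2 \<partial>lborel) * (\<integral>\<^sup>+x. (indicator {\<alpha>..\<beta>} x)\<^sup>2 \<partial>lborel)"
    by (rule Cauchy_Schwarz_nn_integral) auto
  also have "(\<integral>\<^sup>+x. (ennreal \<bar>\<phi>' x\<bar> * indicator {\<alpha>..\<beta>} x)\<^sup>2 \<partial>lborel) = (\<integral>\<^sup>+x. ennreal ((\<phi>' x)\<^sup>2) * indicator {\<alpha>..\<beta>} x \<partial>lborel)"
    by (intro nn_integral_cong) (auto simp: indicator_def ennreal_power)
  also have "(\<integral>\<^sup>+x. (indicator {\<alpha>..\<beta>} x)\<^sup>2 \<partial>lborel) = (\<integral>\<^sup>+x. indicator {\<alpha>..\<beta>} x \<partial>lborel)"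
    by (intro nn_integral_cong) (auto simp: indicator_def)
  also have "\<dots> = ennreal (\<beta> - \<alpha>)" using le by simp
  also have "(\<integral>\<^sup>+x. ennreal ((\<phi>' x)\<^sup>2) * indicator {\<alpha>..\<beta>} x \<partial>lborel) * ennreal (\<beta> - \<alpha>) \<le> ennreal q * ennreal (\<beta> - \<alpha>)"
    by (rule mult_right_mono[OF q(1)]) simp
  finally have "ennreal ((\<phi> t - \<phi> t')\<^sup>2) \<le> ennreal (q * (\<beta> - \<alpha>))"
    using q(2) le by (simp add: ennreal_power ennreal_mult)
  then show ?case using q(2) le by (simp add: ennreal_le_iff mult.commute)
qed

text \<open>The Courant--Lebesgue lemma, with boundaries of squares in place of circles so that no
  polar coordinates are needed.\<close>

lemma Courant_Lebesgue_square:
  fixes g :: "real^2 \<Rightarrow> real"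
  assumes g: "C1_grad g D" and r: "0 < r" "r < R"
    and E: "(\<integral>\<^sup>+x. ennreal ((norm (D x))\<^sup>2) * indicator (csquare p R) x \<partial>lborel) < ennreal E"
  shows "\<exists>s\<in>{r..R}. \<exists>y. \<forall>x\<in>csquare p s - osquare p s. \<bar>g x - g y\<bar> \<le> 2 * sqrt (8 * E / ln (R / r))"
proof -
  note [measurable] = C1_grad_measurable[OF g]
  \<comment> \<open>Each of the four families of sides sweeps out part of the large square, so for r
    \<le> s \<le> R the side energies together integrate to less than 4 E. If they exceeded \<theta>
    / s for every s, they would integrate to at least \<theta> ln (R / r), which this choice makes
    equal to 4 E.\<close>
  define \<theta> where "\<theta> = 4 * E / ln (R / r)"
  have ln0: "ln (R / r) > 0" using r by simp
  have E0: "E > 0"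
  proof (rule ccontr)
    assume "\<not> E > 0"
    then have "ennreal E = 0" by (simp add: ennreal_neg)
    with E show False by simp
  qed
  have \<theta>: "\<theta> > 0" using E0 ln0 by (simp add: \<theta>_def)
  let ?G = "\<lambda>x. ennreal ((norm (D x))\<^sup>2)"
  define S1 where "S1 s = (\<integral>\<^sup>+t. ?G (p + v2 t s) * indicator {-s..s} t \<partial>lborel)" for s
  define S2 where "S2 s = (\<integral>\<^sup>+t. ?G (p + v2 t (-s)) * indicator {-s..s} t \<partial>lborel)" for s
  define S3 where "S3 s = (\<integral>\<^sup>+t. ?G (p + v2 s t) * indicator {-s..s} t \<partial>lborel)" for s
  define S4 where "S4 s = (\<integral>\<^sup>+t. ?G (p + v2 (-s) t) * indicator {-s..s} t \<partial>lborel)" for s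
  define I where "I = (\<integral>\<^sup>+x. ?G x * indicator (csquare p R) x \<partial>lborel)"
  have I: "I = (\<integral>\<^sup>+x. ?G (p + x) * indicator (csquare p R) (p + x) \<partial>lborel)"
    unfolding I_def by (rule nn_integral_lborel_translate[symmetric]) measurable
  have I12: "I = (\<integral>\<^sup>+s. \<integral>\<^sup>+t. ?G (p + v2 t s) * indicator (csquare p R) (p + v2 t s) \<partial>lborel \<partial>lborel)" (is "_ = (\<integral>\<^sup>+s. ?F1 s \<partial>lborel)")
    unfolding I by (rule nn_integral_plane(2)) measurable
  have I34: "I = (\<integral>\<^sup>+s. \<integral>\<^sup>+t. ?G (p + v2 s t) * indicator (csquare p R) (p + v2 s t) \<partial>lborel \<partial>lborel)" (is "_ = (\<integral>\<^sup>+s. ?F3 s \<partial>lborel)")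
    unfolding I by (rule nn_integral_plane(1)) measurable
  have m: "?F1 \<in> borel_measurable borel" "?F3 \<in> borel_measurable borel" by measurable
  have flip: "(\<integral>\<^sup>+s. F s \<partial>lborel) = (\<integral>\<^sup>+s. F (- s) \<partial>lborel)" if [measurable]: "F \<in> borel_measurable borel" for F :: "real \<Rightarrow> ennreal"
    using nn_integral_real_affine[of F "-1" 0] by simp
  have b1: "(\<integral>\<^sup>+s. S1 s * indicator {r..R} s \<partial>lborel) \<le> I"
    unfolding I12 S1_def
    by (intro nn_integral_mono) (auto simp: indicator_def csquare_def forall_2 intro!: nn_integral_mono split: if_splits)
  have b2: "(\<integral>\<^sup>+s. S2 s * indicator {r..R} s \<partial>lborel) \<le> I"
    unfolding I12 flip[OF m(1)] S2_def
    by (intro nn_integral_mono) (auto simp: indicator_def csquare_def forall_2 intro!: nn_integral_mono split: if_splits)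
  have b3: "(\<integral>\<^sup>+s. S3 s * indicator {r..R} s \<partial>lborel) \<le> I"
    unfolding I34 S3_def
    by (intro nn_integral_mono) (auto simp: indicator_def csquare_def forall_2 intro!: nn_integral_mono split: if_splits)
  have b4: "(\<integral>\<^sup>+s. S4 s * indicator {r..R} s \<partial>lborel) \<le> I"
    unfolding I34 flip[OF m(2)] S4_def
    by (intro nn_integral_mono) (auto simp: indicator_def csquare_def forall_2 intro!: nn_integral_mono split: if_splits)
  have mS [measurable]: "S1 \<in> borel_measurable borel" "S2 \<in> borel_measurable borel" "S3 \<in> borel_measurable borel" "S4 \<in> borel_measurable borel"
    unfolding S1_def[abs_def] S2_def[abs_def] S3_def[abs_def] S4_def[abs_def] indicator_def atLeastAtMost_iff
    by measurable
  have "\<exists>s\<in>{r..R}. S1 s + S2 s + S3 s + S4 s \<le> ennreal (\<theta> / s)"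
  proof (rule ccontr)
    assume "\<not> ?thesis"
    then have "ennreal (\<theta> / s) * indicator {r..R} s \<le> (S1 s + S2 s + S3 s + S4 s) * indicator {r..R} s" for s
      by (auto simp: indicator_def not_le less_imp_le)
    then have "(\<integral>\<^sup>+s. ennreal (\<theta> / s) * indicator {r..R} s \<partial>lborel)
      \<le> (\<integral>\<^sup>+s. (S1 s + S2 s + S3 s + S4 s) * indicator {r..R} s \<partial>lborel)"
      by (intro nn_integral_mono) auto
    also have "\<dots> = (\<integral>\<^sup>+s. S1 s * indicator {r..R} s \<partial>lborel) + (\<integral>\<^sup>+s. S2 s * indicator {r..R} s \<partial>lborel)
       + (\<integral>\<^sup>+s. S3 s * indicator {r..R} s \<partial>lborel) + (\<integral>\<^sup>+s. S4 s * indicator {r..R} s \<partial>lborel)"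
      by (simp add: distrib_right nn_integral_add)
    also have "\<dots> \<le> I + I + I + I" by (intro add_mono b1 b2 b3 b4)
    also have "\<dots> = (1 + 1 + 1 + 1) * I" by (simp only: distrib_right mult_1)
    also have "\<dots> = 4 * I" by simp
    also have "\<dots> < ennreal (4 * E)"
      using E E0 unfolding I_def by (simp add: ennreal_mult' ennreal_mult_strict_left_mono)
    finally have less: "(\<integral>\<^sup>+s. ennreal (\<theta> / s) * indicator {r..R} s \<partial>lborel) < ennreal (4 * E)" .
    have "(\<integral>\<^sup>+s. ennreal (\<theta> / s) * indicator {r..R} s \<partial>lborel) = ennreal (\<theta> * ln R - \<theta> * ln r)"
    proof (rule nn_integral_FTC_Icc)
      show "((\<lambda>s. \<theta> * ln s) has_real_derivative \<theta> / x) (at x)" if "x \<in> {r..R}" for x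
      proof -
        have "x > 0" using that r by simp
        then have "((\<lambda>s. \<theta> * ln s) has_real_derivative \<theta> * (1 / x)) (at x)"
          by (intro DERIV_cmult DERIV_ln_divide)
        then show ?thesis by simp
      qed
    qed (use r \<theta> in auto)
    moreover have "\<theta> * ln R - \<theta> * ln r = \<theta> * ln (R / r)"
      using r by (simp add: ln_div right_diff_distrib)
    moreover have "\<theta> * ln (R / r) = 4 * E" using ln0 by (simp add: \<theta>_def)
    ultimately show False using less by simp
  qed
  then obtain s where s: "s \<in> {r..R}" "S1 s + S2 s + S3 s + S4 s \<le> ennreal (\<theta> / s)" by blast
  then have s0: "s > 0" using r by auto
  have cont: "continuous_on UNIV (\<lambda>t. D (p + v2 t b) $ i)" "continuous_on UNIV (\<lambda>t. D (p + v2 b t) $ i)" for b i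
    by (auto intro!: continuous_on_component continuous_on_compose2[OF C1_grad_continuous_grad[OF g, of UNIV]] continuous_intros)
  have side1: "\<bar>g (p + v2 t b) - g (p + v2 t' b)\<bar> \<le> sqrt (2 * \<theta>)"
    if "b \<in> {s, -s}" "t \<in> {-s..s}" "t' \<in> {-s..s}" for b t t'
  proof -
    have "(\<integral>\<^sup>+t. ennreal ((D (p + v2 t b) $ 1)\<^sup>2) * indicator {-s..s} t \<partial>lborel) \<le> (\<integral>\<^sup>+t. ?G (p + v2 t b) * indicator {-s..s} t \<partial>lborel)"
      by (intro nn_integral_mono mult_right_mono ennreal_leI)
         (auto simp: component_le_norm_cart intro!: power2_le_iff_abs_le[THEN iffD2])
    also have "\<dots> \<le> S1 s + S2 s + S3 s + S4 s"
      using that(1) unfolding S1_def S2_def by (auto simp: add_increasing2 add_increasing)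
    finally have "(g (p + v2 t b) - g (p + v2 t' b))\<^sup>2 \<le> (s - (- s)) * (\<theta> / s)"
      using s(2) that \<theta> s0
      by (intro oscillation_le_energy[OF C1_grad_lines(1)[OF g] cont(1)]) (auto intro: order_trans)
    then have "(g (p + v2 t b) - g (p + v2 t' b))\<^sup>2 \<le> 2 * \<theta>" using s0 by simp
    then show ?thesis using real_sqrt_le_mono by fastforce
  qed
  have side2: "\<bar>g (p + v2 b t) - g (p + v2 b t')\<bar> \<le> sqrt (2 * \<theta>)"
    if "b \<in> {s, -s}" "t \<in> {-s..s}" "t' \<in> {-s..s}" for b t t'
  proof -
    have "(\<integral>\<^sup>+t. ennreal ((D (p + v2 b t) $ 2)\<^sup>2) * indicator {-s..s} t \<partial>lborel) \<le> (\<integral>\<^sup>+t. ?G (p + v2 b t) * indicator {-s..s} t \<partial>lborel)"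
      by (intro nn_integral_mono mult_right_mono ennreal_leI)
         (auto simp: component_le_norm_cart intro!: power2_le_iff_abs_le[THEN iffD2])
    also have "\<dots> \<le> S1 s + S2 s + S3 s + S4 s"
      using that(1) unfolding S3_def S4_def by (auto simp: add_increasing2 add_increasing)
    finally have "(g (p + v2 b t) - g (p + v2 b t'))\<^sup>2 \<le> (s - (- s)) * (\<theta> / s)"
      using s(2) that \<theta> s0
      by (intro oscillation_le_energy[OF C1_grad_lines(2)[OF g] cont(2)]) (auto intro: order_trans)
    then have "(g (p + v2 b t) - g (p + v2 b t'))\<^sup>2 \<le> 2 * \<theta>" using s0 by simp
    then show ?thesis using real_sqrt_le_mono by fastforce
  qed
  \<comment> \<open>Any boundary point reaches the corner p + (s, s) along at most two sides, and
    each side contributes an oscillation of sqrt (2 \<theta>).\<close>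
  have "\<bar>g x - g (p + v2 s s)\<bar> \<le> 2 * sqrt (2 * \<theta>)" if x: "x \<in> csquare p s - osquare p s" for x
  proof -
    define a b where "a = x $ 1 - p $ 1" and "b = x $ 2 - p $ 2"
    have xe: "x = p + v2 a b" by (simp add: vec_eq_iff forall_2 a_def b_def)
    have ab: "a \<in> {-s..s}" "b \<in> {-s..s}" "b \<in> {s, -s} \<or> a \<in> {s, -s}"
      using x by (auto simp: a_def b_def csquare_def osquare_def forall_2 abs_le_iff)
    have ss: "s \<in> {-s..s}" using s0 by simp
    from ab(3) show ?thesis
    proof
      assume b: "b \<in> {s, -s}"
      have "\<bar>g (p + v2 a b) - g (p + v2 s b)\<bar> \<le> sqrt (2 * \<theta>)" by (rule side1[OF b ab(1) ss])
      moreover have "\<bar>g (p + v2 s b) - g (p + v2 s s)\<bar> \<le> sqrt (2 * \<theta>)" by (rule side2[OF _ ab(2) ss]) simp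
      ultimately show ?thesis unfolding xe by linarith
    next
      assume a: "a \<in> {s, -s}"
      have "\<bar>g (p + v2 a b) - g (p + v2 a s)\<bar> \<le> sqrt (2 * \<theta>)" by (rule side2[OF a ab(2) ss])
      moreover have "\<bar>g (p + v2 a s) - g (p + v2 s s)\<bar> \<le> sqrt (2 * \<theta>)" by (rule side1[OF _ ab(1) ss]) simp
      ultimately show ?thesis unfolding xe by linarith
    qed
  qed
  moreover have "2 * \<theta> = 8 * E / ln (R / r)" by (simp add: \<theta>_def)
  ultimately show ?thesis using s(1) by (intro bexI[of _ s] exI[of _ "p + v2 s s"]) auto
qed

subsection \<open>A smooth truncation\<close>

text \<open>A C^1 substitute for the positive part: its slope lies in [0, 1], it vanishes for t
  \<le> 0, and it is at least \<sigma> / 2 from t = \<sigma> on. With \<sigma> the gap between two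
  levels it is the truncation of the iteration; with \<sigma> tending to 0 it recovers the positive
  part itself.\<close>

definition ramp :: "real \<Rightarrow> real \<Rightarrow> real" where
  "ramp \<sigma> t = (max 0 t)\<^sup>2 / (max 0 t + \<sigma>)"

definition ramp' :: "real \<Rightarrow> real \<Rightarrow> real" where
  "ramp' \<sigma> t = max 0 t * (max 0 t + 2 * \<sigma>) / (max 0 t + \<sigma>)\<^sup>2"

lemma ramp_nonpos [simp]: "t \<le> 0 \<Longrightarrow> ramp \<sigma> t = 0" "t \<le> 0 \<Longrightarrow> ramp' \<sigma> t = 0"
  by (simp_all add: ramp_def ramp'_def)

lemma ramp_has_derivative:
  assumes "\<sigma> > 0" shows "(ramp \<sigma> has_real_derivative ramp' \<sigma> t) (at t)"
proof -
  consider "t > 0" | "t < 0" | "t = 0" by linarith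
  then show ?thesis
  proof cases
    case 1
    have "((\<lambda>t. t\<^sup>2 / (t + \<sigma>)) has_real_derivative ramp' \<sigma> t) (at t)"
      using 1 assms by (auto intro!: derivative_eq_intros simp: ramp'_def power2_eq_square algebra_simps)
    then show ?thesis
      by (rule has_field_derivative_transform_within_open[of _ _ _ "{0<..}"]) (use 1 in \<open>auto simp: ramp_def\<close>)
  next
    case 2
    have "((\<lambda>_. 0) has_real_derivative 0) (at t)" by simp
    then have "(ramp \<sigma> has_real_derivative 0) (at t)"
      by (rule has_field_derivative_transform_within_open[of _ _ _ "{..<0}"]) (use 2 in auto)
    then show ?thesis using 2 by simp
  next
    case 3
    have "((\<lambda>h. (ramp \<sigma> (0 + h) - ramp \<sigma> 0) / h) \<longlongrightarrow> 0) (at 0)"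
    proof (rule Lim_null_comparison)
      show "\<forall>\<^sub>F h in at 0. norm ((ramp \<sigma> (0 + h) - ramp \<sigma> 0) / h) \<le> \<bar>h\<bar> / \<sigma>"
        unfolding eventually_at
      proof (intro exI[of _ 1] conjI ballI impI)
        fix h :: real assume h: "h \<noteq> 0 \<and> dist h 0 < 1"
        show "norm ((ramp \<sigma> (0 + h) - ramp \<sigma> 0) / h) \<le> \<bar>h\<bar> / \<sigma>"
        proof (cases "h > 0")
          case True
          then have "h / (h + \<sigma>) \<le> h / \<sigma>" using assms by (intro divide_left_mono) auto
          then show ?thesis using True assms by (simp add: ramp_def power2_eq_square)
        next
          case False
          then show ?thesis using assms by (simp add: divide_le_0_iff)
        qed
      qed simp
      have "((\<lambda>h. \<bar>h\<bar> / \<sigma>) \<longlongrightarrow> \<bar>0\<bar> / \<sigma>) (at 0)"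
        by (intro tendsto_intros) (use assms in auto)
      then show "((\<lambda>h. \<bar>h\<bar> / \<sigma>) \<longlongrightarrow> 0) (at 0)" by simp
    qed
    then have "(ramp \<sigma> has_real_derivative 0) (at 0)" by (simp add: DERIV_def)
    then show ?thesis using 3 by simp
  qed
qed

lemma ramp'_bounds: assumes "\<sigma> > 0" shows "0 \<le> ramp' \<sigma> t" "ramp' \<sigma> t \<le> 1"
proof -
  have "(max 0 t + \<sigma>)\<^sup>2 > 0" using assms by (intro zero_less_power) (simp add: add_nonneg_pos)
  moreover have "max 0 t * (max 0 t + 2 * \<sigma>) \<le> (max 0 t + \<sigma>)\<^sup>2"
    by (simp add: power2_eq_square algebra_simps)
  ultimately show "ramp' \<sigma> t \<le> 1" by (simp add: ramp'_def)
  show "0 \<le> ramp' \<sigma> t" using assms by (auto simp: ramp'_def intro!: divide_nonneg_nonneg mult_nonneg_nonneg)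
qed

lemma ramp'_continuous: "\<sigma> > 0 \<Longrightarrow> continuous_on A (ramp' \<sigma>)"
  unfolding ramp'_def[abs_def] by (intro continuous_intros) (auto simp: max_def)

lemma ramp_continuous: "\<sigma> > 0 \<Longrightarrow> continuous_on A (ramp \<sigma>)"
  unfolding ramp_def[abs_def] by (intro continuous_intros) (auto simp: max_def)

lemma ramp_nonneg: "\<sigma> > 0 \<Longrightarrow> 0 \<le> ramp \<sigma> t"
  by (auto simp: ramp_def intro!: divide_nonneg_nonneg)

lemma ramp_le: "\<sigma> > 0 \<Longrightarrow> ramp \<sigma> t \<le> max 0 t"
  by (auto simp: ramp_def divide_le_eq power2_eq_square algebra_simps max_def)

lemma ramp_ge: assumes "\<sigma> > 0" "t \<ge> \<sigma>" shows "ramp \<sigma> t \<ge> \<sigma> / 2"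
proof -
  have "\<sigma> * t \<le> t * t" "\<sigma> * \<sigma> \<le> t * t" using assms by (auto intro!: mult_mono)
  then have "\<sigma> * (t + \<sigma>) \<le> 2 * t\<^sup>2" by (simp add: algebra_simps power2_eq_square)
  then show ?thesis using assms by (simp add: ramp_def max_def field_simps)
qed

subsection \<open>Stampacchia's iteration\<close>

text \<open>Along the levels k_n = k0 + d (1 - 2^(-n)) the gaps halve, which costs a factor 4 per
  step. A geometric bound \<Phi> q^n pays for it through the extra power \<beta> when q powr \<beta>
  = 1 / 4. The induction then closes exactly if 4 L \<Phi> powr \<beta> = q d^2, and this equation
  determines d.\<close>

lemma Stampacchia_iteration:
  fixes \<phi> :: "real \<Rightarrow> real"
  assumes nonneg: "\<And>k. 0 \<le> \<phi> k" and anti: "\<And>k h. k \<le> h \<Longrightarrow> \<phi> h \<le> \<phi> k"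
    and dec: "\<And>k h. k0 \<le> k \<Longrightarrow> k < h \<Longrightarrow> \<phi> h \<le> L / (h - k)\<^sup>2 * \<phi> k powr (1 + \<beta>)"
    and L: "L > 0" and \<beta>: "\<beta> > 0" and \<Phi>: "\<phi> k0 \<le> \<Phi>" "\<Phi> > 0"
  shows "\<phi> (k0 + sqrt (4 * L * \<Phi> powr \<beta> * 4 powr (1 / \<beta>))) = 0"
proof -
  define d where "d = sqrt (4 * L * \<Phi> powr \<beta> * 4 powr (1 / \<beta>))"
  define q where "q = (4::real) powr (- (1 / \<beta>))"
  have d: "d > 0" "d\<^sup>2 = 4 * L * \<Phi> powr \<beta> * 4 powr (1 / \<beta>)" using L \<Phi> by (auto simp: d_def)
  have q0: "q > 0" by (simp add: q_def)
  have "q < 4 powr 0" unfolding q_def by (rule powr_less_mono) (use \<beta> in auto)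
  then have q1: "q < 1" by simp
  have "q powr \<beta> = 4 powr (- 1)" unfolding q_def powr_powr using \<beta> by simp
  then have q\<beta>: "q powr \<beta> = 1 / 4" by (simp add: powr_minus)
  define k where "k n = k0 + d * (1 - (1/2)^n)" for n :: nat
  have kk: "k (Suc n) - k n = d * (1/2)^(Suc n)" for n by (simp add: k_def algebra_simps)
  have k_ge: "k0 \<le> k n" for n using d by (simp add: k_def power_le_one)
  have main: "\<phi> (k n) \<le> \<Phi> * q ^ n" for n
  proof (induction n)
    case 0 show ?case using \<Phi> by (simp add: k_def)
  next
    case (Suc n)
    have lt: "k n < k (Suc n)" using kk[of n] d(1) by (metis diff_gt_0_iff_gt mult_pos_pos zero_less_power half_gt_zero zero_less_one)
    have "\<phi> (k (Suc n)) \<le> L / (k (Suc n) - k n)\<^sup>2 * \<phi> (k n) powr (1 + \<beta>)"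
      by (rule dec[OF k_ge lt])
    also have "\<dots> \<le> L / (k (Suc n) - k n)\<^sup>2 * (\<Phi> * q ^ n) powr (1 + \<beta>)"
      using L nonneg Suc \<beta> by (intro mult_left_mono powr_mono2) auto
    also have "(\<Phi> * q ^ n) powr (1 + \<beta>) = (\<Phi> * q ^ n) * (\<Phi> powr \<beta> * (1/4) ^ n)"
      using \<Phi> q0 by (simp add: powr_add powr_mult q\<beta>[symmetric] powr_realpow[symmetric] powr_powr mult.commute)
    also have "L / (k (Suc n) - k n)\<^sup>2 = L * 4 ^ Suc n / d\<^sup>2"
      using power_mult[of "2::real" 2 n]
      by (simp add: mult.commute[of 2 n]; simp add: kk power_mult_distrib power_mult[symmetric] power_divide power_even_eq)
    also have "L * 4 ^ Suc n / d\<^sup>2 * ((\<Phi> * q ^ n) * (\<Phi> powr \<beta> * (1/4) ^ n)) = \<Phi> * q ^ n * (4 * L * \<Phi> powr \<beta> / d\<^sup>2)"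
      by (simp add: power_one_over field_simps)
    also have "4 * L * \<Phi> powr \<beta> / d\<^sup>2 = q"
      using L \<Phi> by (simp add: d(2) q_def powr_minus field_simps)
    finally show ?case by (simp add: mult_ac)
  qed
  have "\<phi> (k0 + d) \<le> \<Phi> * q ^ n" for n
    using anti[of "k n" "k0 + d"] main[of n] d by (simp add: k_def algebra_simps)
  moreover have "(\<lambda>n. \<Phi> * q ^ n) \<longlonglongrightarrow> 0"
    using q0 q1 by (intro tendsto_mult_right_zero LIMSEQ_realpow_zero) auto
  ultimately have "\<phi> (k0 + d) \<le> 0" by (intro LIMSEQ_le_const) auto
  then show ?thesis using nonneg[of "k0 + d"] by (simp add: d_def)
qed

text \<open>Hoelder's inequality with a cruder constant, obtained by splitting at height \<mu>:
  where |f| is larger, |f| / \<mu> raised to \<epsilon> is at least 1. The value of \<mu> balances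
  the two contributions, \<mu> powr (- \<epsilon>) and \<mu>^2 |A|, both of which become |A| to the
  power \<epsilon> / (2 + \<epsilon>).\<close>

lemma integral_square_le_measure_powr:
  fixes f :: "'a \<Rightarrow> real"
  assumes [measurable]: "f \<in> borel_measurable M" "A \<in> sets M" and fin: "emeasure M A < \<infinity>" and e: "\<epsilon> > 0"
    and f: "integrable M (\<lambda>x. \<bar>f x\<bar> powr (2 + \<epsilon>))" "(LINT x|M. \<bar>f x\<bar> powr (2 + \<epsilon>)) \<le> N"
    and f2: "integrable M (\<lambda>x. (f x)\<^sup>2)"
  shows "(LINT x|M. indicator A x * (f x)\<^sup>2) \<le> (N + 1) * measure M A powr (\<epsilon> / (2 + \<epsilon>))"
proof (cases "measure M A = 0")
  case True
  then have "A \<in> null_sets M" using fin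
    by (intro null_setsI) (auto simp: emeasure_eq_ennreal_measure less_top)
  then have "AE x in M. indicator A x * (f x)\<^sup>2 = 0"
    by (rule AE_not_in[THEN eventually_mono]) auto
  then have "(LINT x|M. indicator A x * (f x)\<^sup>2) = 0" by (rule integral_eq_zero_AE)
  then show ?thesis using True by simp
next
  case False
  then have m: "measure M A > 0" by (simp add: zero_less_measure_iff)
  define \<mu> where "\<mu> = measure M A powr (- 1 / (2 + \<epsilon>))"
  have l: "\<mu> > 0" using m by (simp add: \<mu>_def)
  have pt: "(f x)\<^sup>2 \<le> \<mu> powr (- \<epsilon>) * \<bar>f x\<bar> powr (2 + \<epsilon>) + \<mu>\<^sup>2" for x
  proof (cases "\<bar>f x\<bar> \<le> \<mu>")
    case True
    then have "(f x)\<^sup>2 \<le> \<mu>\<^sup>2" by (metis abs_ge_zero power2_abs power_mono)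
    moreover have "0 \<le> \<mu> powr (- \<epsilon>) * \<bar>f x\<bar> powr (2 + \<epsilon>)" by simp
    ultimately show ?thesis by linarith
  next
    case False
    then have f0: "\<bar>f x\<bar> > 0" using l by linarith
    have "1 \<le> \<mu> powr (- \<epsilon>) * \<bar>f x\<bar> powr \<epsilon>"
    proof -
      have "\<mu> powr \<epsilon> \<le> \<bar>f x\<bar> powr \<epsilon>" using False l e by (intro powr_mono2) auto
      then show ?thesis using l by (simp add: powr_minus field_simps)
    qed
    then have "(f x)\<^sup>2 * 1 \<le> (f x)\<^sup>2 * (\<mu> powr (- \<epsilon>) * \<bar>f x\<bar> powr \<epsilon>)" by (intro mult_left_mono) auto
    also have "\<dots> = \<mu> powr (- \<epsilon>) * \<bar>f x\<bar> powr (2 + \<epsilon>)"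
      using f0 by (simp add: powr_add powr_numeral power2_abs)
    finally show ?thesis using zero_le_power2[of \<mu>] by linarith
  qed
  have iA: "integrable M (indicator A :: 'a \<Rightarrow> real)" using fin by (simp add: integrable_indicator_iff)
  have "(LINT x|M. indicator A x * (f x)\<^sup>2) \<le> (LINT x|M. \<mu> powr (- \<epsilon>) * \<bar>f x\<bar> powr (2 + \<epsilon>) + \<mu>\<^sup>2 * indicator A x)"
  proof (rule integral_mono)
    show "integrable M (\<lambda>x. indicator A x * (f x)\<^sup>2)"
      using integrable_mult_indicator[OF assms(2) f2] by simp
    show "indicator A x * (f x)\<^sup>2 \<le> \<mu> powr (- \<epsilon>) * \<bar>f x\<bar> powr (2 + \<epsilon>) + \<mu>\<^sup>2 * indicator A x" for x
      using pt[of x] by (auto simp: indicator_def)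
  qed (use f(1) iA in auto)
  also have "\<dots> = \<mu> powr (- \<epsilon>) * (LINT x|M. \<bar>f x\<bar> powr (2 + \<epsilon>)) + \<mu>\<^sup>2 * measure M A"
    using f(1) iA by simp
  also have "\<dots> \<le> \<mu> powr (- \<epsilon>) * N + \<mu>\<^sup>2 * measure M A"
    using f(2) by (simp add: mult_left_mono)
  also have "\<mu> powr (- \<epsilon>) = measure M A powr (\<epsilon> / (2 + \<epsilon>))"
    by (simp add: \<mu>_def powr_powr)
  also have "\<mu>\<^sup>2 * measure M A = measure M A powr (\<epsilon> / (2 + \<epsilon>))"
  proof -
    have "\<mu>\<^sup>2 * measure M A = measure M A powr (- 2 / (2 + \<epsilon>)) * measure M A powr 1"
      using m by (simp add: \<mu>_def powr_numeral[symmetric] powr_powr del: powr_numeral)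
    also have "\<dots> = measure M A powr (- 2 / (2 + \<epsilon>) + 1)" by (simp only: powr_add)
    also have "- 2 / (2 + \<epsilon>) + 1 = \<epsilon> / (2 + \<epsilon>)" using e by (simp add: field_simps)
    finally show ?thesis .
  qed
  finally show ?thesis by (simp add: algebra_simps)
qed

section \<open>Truncations of mollifications as test functions on squares\<close>

lemma C1_grad_compose:
  assumes "C1_grad g D" "\<And>t. (T has_real_derivative T' t) (at t)" "continuous_on UNIV T'"
  shows "C1_grad (\<lambda>x. T (g x)) (\<lambda>x. T' (g x) *\<^sub>R D x)"
  unfolding C1_grad_def
proof (intro conjI allI)
  show "((\<lambda>x. T (g x)) has_derivative (\<lambda>h. (T' (g x) *\<^sub>R D x) \<bullet> h)) (at x)" for x
    using has_derivative_compose[OF C1_gradD[OF assms(1), of x], of T "(*) (T' (g x))"] assms(2)[of "g x"]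
    by (simp add: has_field_derivative_def)
  show "continuous_on UNIV (\<lambda>x. T' (g x) *\<^sub>R D x)"
    by (intro continuous_intros C1_grad_continuous_grad[OF assms(1)]
        continuous_on_compose2[OF assms(3) C1_grad_continuous[OF assms(1)]]) auto
qed

lemma C1_grad_transform_open_cover:
  assumes "open S" "open S'" "S \<union> S' = UNIV" and g: "C1_grad g D"
    and "\<And>x. x \<in> S \<Longrightarrow> h x = g x" "\<And>x. x \<in> S \<Longrightarrow> E x = D x"
    and "\<And>x. x \<in> S' \<Longrightarrow> h x = 0" "\<And>x. x \<in> S' \<Longrightarrow> E x = 0"
  shows "C1_grad h E"
  unfolding C1_grad_def
proof (intro conjI allI)
  fix x
  show "(h has_derivative (\<lambda>y. E x \<bullet> y)) (at x)"
  proof (cases "x \<in> S")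
    case True
    have "(h has_derivative (\<lambda>y. D x \<bullet> y)) (at x)"
      by (rule has_derivative_transform_within_open[OF C1_gradD[OF g] assms(1) True]) (use assms in auto)
    then show ?thesis using assms(6)[OF True] by simp
  next
    case False
    then have x: "x \<in> S'" using assms(3) by auto
    have "((\<lambda>_. 0) has_derivative (\<lambda>_. 0)) (at x)" by simp
    then have "(h has_derivative (\<lambda>_. 0)) (at x)"
      by (rule has_derivative_transform_within_open[OF _ assms(2) x]) (use assms in auto)
    then show ?thesis using assms(8)[OF x] by simp
  qed
next
  have "continuous_on S E" using C1_grad_continuous_grad[OF g, of S] assms(6) by (simp cong: continuous_on_cong)
  moreover have "continuous_on S' E" using assms(8) by (simp cong: continuous_on_cong)
  ultimately have "continuous_on (S \<union> S') E" using assms(1,2) by (intro continuous_on_open_Un)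
  then show "continuous_on UNIV E" using assms(3) by simp
qed

text \<open>Because g is strictly below the level k on the boundary, the part of the closed square
  where g \<ge> k is compact and contained in the open square. Cutting off with the indicator of the
  square therefore creates no jump, and the support is admissible for a test function.\<close>

lemma C1_grad_ramp_cutoff:
  assumes g: "C1_grad g D" and \<sigma>: "\<sigma> > 0"
    and M: "\<And>x. x \<in> csquare p s - osquare p s \<Longrightarrow> g x \<le> M" "M < k"
  shows "\<exists>K. compact K \<and> K \<subseteq> osquare p s \<and> (\<forall>x. x \<notin> K \<longrightarrow> indicator (osquare p s) x * ramp \<sigma> (g x - k) = 0)"
    and "C1_grad (\<lambda>x. indicator (osquare p s) x * ramp \<sigma> (g x - k))
       (\<lambda>x. (indicator (osquare p s) x * ramp' \<sigma> (g x - k)) *\<^sub>R D x)"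
proof -
  define K where "K = csquare p s \<inter> {x. k \<le> g x}"
  have cl: "closed {x. k \<le> g x}"
    by (intro closed_Collect_le continuous_intros C1_grad_continuous[OF g])
  have K: "compact K" unfolding K_def by (intro compact_Int_closed compact_csquare cl)
  have sub: "K \<subseteq> osquare p s" using M by (force simp: K_def)
  have z: "indicator (osquare p s) x * ramp \<sigma> (g x - k) = 0" if "x \<notin> K" for x
    using that osquare_subset_csquare[of s s p] by (auto simp: K_def indicator_def)
  show "\<exists>K. compact K \<and> K \<subseteq> osquare p s \<and> (\<forall>x. x \<notin> K \<longrightarrow> indicator (osquare p s) x * ramp \<sigma> (g x - k) = 0)"
    using K sub z by blast
  have gk: "C1_grad (\<lambda>x. g x - k) D"
    using g unfolding C1_grad_def by (auto intro!: derivative_eq_intros)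
  show "C1_grad (\<lambda>x. indicator (osquare p s) x * ramp \<sigma> (g x - k))
       (\<lambda>x. (indicator (osquare p s) x * ramp' \<sigma> (g x - k)) *\<^sub>R D x)"
  proof (rule C1_grad_transform_open_cover[OF open_osquare, where S'="- K"])
    show "C1_grad (\<lambda>x. ramp \<sigma> (g x - k)) (\<lambda>x. ramp' \<sigma> (g x - k) *\<^sub>R D x)"
      by (rule C1_grad_compose[OF gk ramp_has_derivative[OF \<sigma>] ramp'_continuous[OF \<sigma>]])
    show "open (- K)" using compact_imp_closed[OF K] by auto
    show "osquare p s \<union> - K = UNIV" using sub by auto
    show "indicator (osquare p s) x * ramp \<sigma> (g x - k) = 0" if "x \<in> - K" for x
      using z that by simp
    show "(indicator (osquare p s) x * ramp' \<sigma> (g x - k)) *\<^sub>R D x = 0" if "x \<in> - K" for x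
      using that osquare_subset_csquare[of s s p] by (auto simp: K_def indicator_def)
  qed auto
qed

text \<open>Membership in the moving squares stabilises at every point off the boundary of the limit
  square, and that boundary is a null set.\<close>

lemma indicator_osquare_tendsto:
  assumes s: "sn \<longlonglongrightarrow> s" and x: "x \<notin> csquare p s - osquare p s"
  shows "(\<lambda>n. indicator (osquare p (sn n)) x :: real) \<longlonglongrightarrow> indicator (osquare p s) x"
proof (cases "x \<in> osquare p s")
  case True
  have "\<forall>\<^sub>F n in sequentially. \<bar>x $ i - p $ i\<bar> < sn n" for i
    using True by (intro order_tendstoD(1)[OF s]) (auto simp: osquare_def)
  then have "\<forall>\<^sub>F n in sequentially. \<forall>i. \<bar>x $ i - p $ i\<bar> < sn n"
    by (simp add: eventually_all_finite)
  then have "\<forall>\<^sub>F n in sequentially. indicator (osquare p s) x = (indicator (osquare p (sn n)) x :: real)"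
    by eventually_elim (use True in \<open>auto simp: osquare_def\<close>)
  then show ?thesis by (rule Lim_transform_eventually[OF tendsto_const])
next
  case False
  then have "x \<notin> csquare p s" using x by blast
  then obtain i where i: "s < \<bar>x $ i - p $ i\<bar>" by (auto simp: csquare_def not_le)
  have "\<forall>\<^sub>F n in sequentially. sn n < \<bar>x $ i - p $ i\<bar>" by (rule order_tendstoD(2)[OF s i])
  then have "\<forall>\<^sub>F n in sequentially. indicator (osquare p s) x = (indicator (osquare p (sn n)) x :: real)"
  proof eventually_elim
    case (elim n)
    then have "x \<notin> osquare p (sn n)" by (auto simp: osquare_def intro!: exI[of _ i])
    then show ?case using False by simp
  qed
  then show ?thesis by (rule Lim_transform_eventually[OF tendsto_const])
qed

subsection \<open>The weak maximum principle\<close>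

text \<open>What the De Giorgi-Stampacchia part needs to know: w is the truncated derivative, W its
  weak gradient, Y the flux D^2H(\<nabla>u) \<nabla>v. Keeping Y as a separate field, linked to W by
  one quadratic inequality, makes the hypotheses symmetric under a change of sign. The gradient
  relation is recorded only for mollifications at points of the closed square and for indices from
  \<open>n0\<close> on, when the mollification balls stay in the region where it is known.\<close>

locale elliptic_square =
  fixes w f :: "real^2 \<Rightarrow> real" and W Y :: "real^2 \<Rightarrow> real^2" and p :: "real^2" and R c \<epsilon> N :: real and n0 :: nat
  assumes R: "R > 0" and c: "c > 0" and \<epsilon>: "\<epsilon> > 0"
    and w: "integrable lborel w"
    and W: "\<And>i. integrable lborel (\<lambda>x. W x $ i)" "\<And>i. integrable lborel (\<lambda>x. (W x $ i)\<^sup>2)"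
    and Y: "\<And>i. (\<lambda>x. Y x $ i) \<in> borel_measurable borel" "\<And>i. integrable lborel (\<lambda>x. (Y x $ i)\<^sup>2)"
    and f: "f \<in> borel_measurable borel" "integrable lborel (\<lambda>x. (f x)\<^sup>2)"
      "integrable lborel (\<lambda>x. \<bar>f x\<bar> powr (2 + \<epsilon>))" "(LINT x|lborel. \<bar>f x\<bar> powr (2 + \<epsilon>)) \<le> N"
    and weak_grad_w: "\<And>n x i. n0 \<le> n \<Longrightarrow> x \<in> csquare p R \<Longrightarrow>
        partial i (conv w (mol n)) x = conv (\<lambda>y. W y $ i) (mol n) x"
    and weak_eq: "\<And>\<phi> D K. C1_grad \<phi> D \<Longrightarrow> compact K \<Longrightarrow> K \<subseteq> osquare p R \<Longrightarrow> (\<And>x. x \<notin> K \<Longrightarrow> \<phi> x = 0) \<Longrightarrow>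
        (LINT x|lborel. Y x \<bullet> D x) = (LINT x|lborel. f x * D x $ 1)"
    and elliptic: "AE x in lborel. x \<in> csquare p R \<longrightarrow> c * (norm (W x))\<^sup>2 \<le> Y x \<bullet> W x"
begin

lemma measurable_data [measurable]:
  "w \<in> borel_measurable borel" "f \<in> borel_measurable borel" "W \<in> borel_measurable borel" "Y \<in> borel_measurable borel"
  "\<And>i. (\<lambda>x. W x $ i) \<in> borel_measurable borel" "\<And>i. (\<lambda>x. Y x $ i) \<in> borel_measurable borel"
proof -
  show w: "w \<in> borel_measurable borel" using borel_measurable_integrable[OF w] by simp
  show "f \<in> borel_measurable borel" by (rule f)
  show Wi: "(\<lambda>x. W x $ i) \<in> borel_measurable borel" for i using borel_measurable_integrable[OF W(1)] by simp
  show Yi: "(\<lambda>x. Y x $ i) \<in> borel_measurable borel" for i by (rule Y)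
  show "W \<in> borel_measurable borel"
    by (subst borel_measurable_euclidean_space) (auto simp: Basis_vec_def inner_axis Wi)
  show "Y \<in> borel_measurable borel"
    by (subst borel_measurable_euclidean_space) (auto simp: Basis_vec_def inner_axis Yi)
qed

text \<open>The mollified weak gradient. It is globally square integrable and converges to W on the
  whole plane, but it is known to be the gradient of the mollified w only on the closed
  square.\<close>

definition V :: "nat \<Rightarrow> real^2 \<Rightarrow> real^2" where
  "V n x = (\<chi> i. conv (\<lambda>y. W y $ i) (mol n) x)"

lemma C1_conv_w: "C1_grad (conv w (mol n)) (grad (conv w (mol n)))"
proof -
  note g = conv_C1_grad[OF w kernel_mol, of n]
  then show ?thesis using C1_grad_eq[OF g] by (simp add: C1_grad_def)
qed

lemma grad_conv_w: "n0 \<le> n \<Longrightarrow> x \<in> csquare p R \<Longrightarrow> grad (conv w (mol n)) x = V n x"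
  by (simp add: vec_eq_iff grad_def V_def weak_grad_w)

lemma V_measurable [measurable]: "(\<lambda>x. V n x $ i) \<in> borel_measurable borel" "V n \<in> borel_measurable borel"
proof -
  show 1: "(\<lambda>x. V n x $ i) \<in> borel_measurable borel" for i
    using conv_measurable[OF W(1) kernel_mol] by (simp add: V_def)
  show "V n \<in> borel_measurable borel"
    by (subst borel_measurable_euclidean_space) (auto simp: Basis_vec_def inner_axis 1)
qed

lemma conv_w_measurable [measurable]: "conv w (mol n) \<in> borel_measurable borel"
  by (rule conv_measurable[OF w kernel_mol])

lemma V_integrable: "integrable lborel (\<lambda>x. V n x $ i)" "integrable lborel (\<lambda>x. (V n x $ i)\<^sup>2)"
  using conv_integrable(1)[OF W(1)[of i], of "inverse (real (Suc n))"] conv_square_integrable(1)[OF W, of i n]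
  by (simp_all add: V_def mol_def)

lemma V_diff:
  "integrable lborel (\<lambda>x. (V n x $ i - W x $ i)\<^sup>2)"
  "(\<lambda>n. LINT x|lborel. (V n x $ i - W x $ i)\<^sup>2) \<longlonglongrightarrow> 0"
  "(\<lambda>n. LINT x|lborel. \<bar>V n x $ i - W x $ i\<bar>) \<longlonglongrightarrow> 0"
  using conv_L2_tendsto[OF W, of i] conv_L1_tendsto[OF W(1), of i] by (simp_all add: V_def)

lemma mult_V_L1:
  assumes [measurable]: "y \<in> borel_measurable borel" and y: "integrable lborel (\<lambda>x. (y x)\<^sup>2)"
  shows "(\<lambda>n. LINT x|lborel. \<bar>y x * V n x $ i - y x * W x $ i\<bar>) \<longlonglongrightarrow> 0"
    "integrable lborel (\<lambda>x. y x * V n x $ i)" "integrable lborel (\<lambda>x. y x * W x $ i)"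
  using y W V_integrable V_diff by (auto intro!: L2_tendsto_imp_L1_mult integrable_mult_L2)

lemma inner_sum2: "(x :: real^2) \<bullet> y = x $ 1 * y $ 1 + x $ 2 * y $ 2"
  by (simp add: inner_vec_def UNIV_2)

lemma norm_sq2: "(norm (x :: real^2))\<^sup>2 = (x $ 1)\<^sup>2 + (x $ 2)\<^sup>2"
  by (metis inner_sum2 power2_eq_square power2_norm_eq_inner)

lemma norm_W_integrable: "integrable lborel (\<lambda>x. norm (W x))" "integrable lborel (\<lambda>x. (norm (W x))\<^sup>2)"
proof -
  show "integrable lborel (\<lambda>x. (norm (W x))\<^sup>2)" using W(2) by (simp add: norm_sq2)
  show "integrable lborel (\<lambda>x. norm (W x))"
    by (rule Bochner_Integration.integrable_bound[of _ "\<lambda>x. \<Sum>i\<in>UNIV. \<bar>W x $ i\<bar>"])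
       (use W(1) in \<open>auto simp: norm_le_l1_cart intro!: AE_I2\<close>)
qed

lemma norm_V_integrable: "integrable lborel (\<lambda>x. norm (V n x))"
  by (rule Bochner_Integration.integrable_bound[of _ "\<lambda>x. \<Sum>i\<in>UNIV. \<bar>V n x $ i\<bar>"])
     (use V_integrable(1) in \<open>auto simp: norm_le_l1_cart intro!: AE_I2\<close>)

lemma norm_V_L1: "(\<lambda>n. LINT x|lborel. \<bar>norm (V n x) - norm (W x)\<bar>) \<longlonglongrightarrow> 0"
proof (rule tendsto_sandwich[OF _ _ tendsto_const])
  show "(\<lambda>n. (LINT x|lborel. \<bar>V n x $ 1 - W x $ 1\<bar>) + (LINT x|lborel. \<bar>V n x $ 2 - W x $ 2\<bar>)) \<longlonglongrightarrow> 0"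
    using tendsto_add[OF V_diff(3)[of 1] V_diff(3)[of 2]] by simp
  show "\<forall>\<^sub>F n in sequentially. (LINT x|lborel. \<bar>norm (V n x) - norm (W x)\<bar>)
     \<le> (LINT x|lborel. \<bar>V n x $ 1 - W x $ 1\<bar>) + (LINT x|lborel. \<bar>V n x $ 2 - W x $ 2\<bar>)"
  proof (rule always_eventually, rule allI)
    fix n
    have "(LINT x|lborel. \<bar>norm (V n x) - norm (W x)\<bar>) \<le> (LINT x|lborel. \<bar>V n x $ 1 - W x $ 1\<bar> + \<bar>V n x $ 2 - W x $ 2\<bar>)"
    proof (rule integral_mono)
      show "\<bar>norm (V n x) - norm (W x)\<bar> \<le> \<bar>V n x $ 1 - W x $ 1\<bar> + \<bar>V n x $ 2 - W x $ 2\<bar>" for x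
        using order_trans[OF norm_triangle_ineq3 norm_le_l1_cart, of "V n x" "W x"] by (simp add: UNIV_2)
    qed (use norm_V_integrable norm_W_integrable V_integrable W in auto)
    then show "(LINT x|lborel. \<bar>norm (V n x) - norm (W x)\<bar>)
     \<le> (LINT x|lborel. \<bar>V n x $ 1 - W x $ 1\<bar>) + (LINT x|lborel. \<bar>V n x $ 2 - W x $ 2\<bar>)"
      using V_integrable W by simp
  qed
qed auto

text \<open>The test function is a truncation of the mollified w, since only the mollification has
  controlled boundary values, on the square of half-side \<open>sn n\<close>. Its gradient is the
  bounded factor \<open>an n\<close> times \<open>V\<close>, so both sides of the weak equation pass
  to the limit. The two conclusions are a Caccioppoli type bound from ellipticity and the planar
  Sobolev inequality for the truncation of w.\<close>

lemma truncated_energy: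
  assumes \<nu>: "strict_mono \<nu>" "\<And>n. n0 \<le> \<nu> n" and ae: "AE x in lborel. (\<lambda>n. conv w (mol (\<nu> n)) x) \<longlonglongrightarrow> w x"
    and sn: "\<And>n. sn n \<le> R" "sn \<longlonglongrightarrow> s"
    and M: "\<And>n x. x \<in> csquare p (sn n) - osquare p (sn n) \<Longrightarrow> conv w (mol (\<nu> n)) x \<le> M n" "M \<longlonglongrightarrow> m"
    and k: "m < k" and \<sigma>: "\<sigma> > 0"
  defines "a \<equiv> \<lambda>x. indicator (osquare p s) x * ramp' \<sigma> (w x - k)"
  shows "(LINT x|lborel. a x * (norm (W x))\<^sup>2) \<le> (1 / c\<^sup>2) * (LINT x|lborel. a x * (f x)\<^sup>2)"
    and "(\<integral>\<^sup>+x. ennreal ((indicator (osquare p s) x * ramp \<sigma> (w x - k))\<^sup>2) \<partial>lborel) \<le> (ennreal (LINT x|lborel. a x * norm (W x)))\<^sup>2"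
proof -
  define an where "an n x = indicator (osquare p (sn n)) x * ramp' \<sigma> (conv w (mol (\<nu> n)) x - k)" for n x
  define \<phi> where "\<phi> n x = indicator (osquare p (sn n)) x * ramp \<sigma> (conv w (mol (\<nu> n)) x - k)" for n x
  have [measurable]: "ramp' \<sigma> \<in> borel_measurable borel" "ramp \<sigma> \<in> borel_measurable borel"
    by (intro borel_measurable_continuous_onI ramp'_continuous ramp_continuous \<sigma>)+
  have an_meas [measurable]: "an n \<in> borel_measurable borel" for n unfolding an_def[abs_def] by measurable
  have a_meas [measurable]: "a \<in> borel_measurable borel" unfolding a_def by measurable
  have \<phi>_meas [measurable]: "\<phi> n \<in> borel_measurable borel" for n unfolding \<phi>_def[abs_def] by measurable
  have a01: "0 \<le> a x" "a x \<le> 1" and an01: "0 \<le> an n x" "an n x \<le> 1" for x n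
    using ramp'_bounds[OF \<sigma>] by (auto simp: a_def an_def indicator_def)
  then have an_abs: "\<bar>an n x\<bar> \<le> 1" for n x by simp
  have sR: "s \<le> R" by (rule LIMSEQ_le_const2[OF sn(2)]) (use sn(1) in auto)
  have bnd: "AE x in lborel. x \<notin> csquare p s - osquare p s"
    by (rule AE_not_in) (auto simp: null_sets_def square_boundary_null)
  have cramp': "isCont (ramp' \<sigma>) t" and cramp: "isCont (ramp \<sigma>) t" for t
    using ramp'_continuous[OF \<sigma>] ramp_continuous[OF \<sigma>] continuous_on_eq_continuous_at open_UNIV by blast+
  have an_lim: "AE x in lborel. (\<lambda>n. an n x) \<longlonglongrightarrow> a x"
    using ae bnd
  proof eventually_elim
    case (elim x)
    then have "(\<lambda>n. conv w (mol (\<nu> n)) x - k) \<longlonglongrightarrow> w x - k" by (intro tendsto_intros)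
    then show ?case unfolding an_def a_def
      by (intro tendsto_mult indicator_osquare_tendsto[OF sn(2)] elim isCont_tendsto_compose[OF cramp'])
  qed
  have \<phi>_lim: "AE x in lborel. (\<lambda>n. \<phi> n x) \<longlonglongrightarrow> indicator (osquare p s) x * ramp \<sigma> (w x - k)"
    using ae bnd
  proof eventually_elim
    case (elim x)
    then have "(\<lambda>n. conv w (mol (\<nu> n)) x - k) \<longlonglongrightarrow> w x - k" by (intro tendsto_intros)
    then show ?case unfolding \<phi>_def
      by (intro tendsto_mult indicator_osquare_tendsto[OF sn(2)] elim isCont_tendsto_compose[OF cramp])
  qed
  have ev: "\<forall>\<^sub>F n in sequentially. M n < k" by (rule order_tendstoD(2)[OF M(2) k])
  \<comment> \<open>Outside the moving square the factor \<open>an\<close> vanishes, which makes the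
    identity global although the gradients agree only on the closed square.\<close>
  have grad_eq: "an n x *\<^sub>R grad (conv w (mol (\<nu> n))) x = an n x *\<^sub>R V (\<nu> n) x" for n x
  proof (cases "x \<in> osquare p (sn n)")
    case True
    then have "x \<in> csquare p R" using osquare_subset_csquare[OF sn(1), of p n] by auto
    then show ?thesis using grad_conv_w[OF \<nu>(2)] by simp
  qed (simp add: an_def)
  have test: "C1_grad (\<phi> n) (\<lambda>x. an n x *\<^sub>R V (\<nu> n) x) \<and>
      (\<exists>K. compact K \<and> K \<subseteq> osquare p R \<and> (\<forall>x. x \<notin> K \<longrightarrow> \<phi> n x = 0))" if Mk: "M n < k" for n
  proof -
    note cutoff = C1_grad_ramp_cutoff[OF C1_conv_w \<sigma> M(1) Mk]
    have "C1_grad (\<phi> n) (\<lambda>x. an n x *\<^sub>R V (\<nu> n) x)"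
      unfolding grad_eq[symmetric] unfolding \<phi>_def[abs_def] an_def by (rule cutoff(2))
    moreover have "\<exists>K. compact K \<and> K \<subseteq> osquare p (sn n) \<and> (\<forall>x. x \<notin> K \<longrightarrow> \<phi> n x = 0)"
      unfolding \<phi>_def by (rule cutoff(1))
    ultimately show ?thesis using osquare_mono[OF sn(1), of p n] by (meson order_trans)
  qed
  note sub = LIMSEQ_subseq_LIMSEQ[OF _ \<nu>(1), unfolded o_def]
  have lim_mult: "(\<lambda>n. LINT x|lborel. an n x * (y x * V (\<nu> n) x $ i)) \<longlonglongrightarrow> (LINT x|lborel. a x * (y x * W x $ i))"
    and int_mult: "integrable lborel (\<lambda>x. an n x * (y x * V (\<nu> n) x $ i))" "integrable lborel (\<lambda>x. a x * (y x * W x $ i))"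
    if [measurable]: "y \<in> borel_measurable borel" and y: "integrable lborel (\<lambda>x. (y x)\<^sup>2)" for y i n
  proof -
    note L = mult_V_L1[OF that, where i=i]
    show "(\<lambda>n. LINT x|lborel. an n x * (y x * V (\<nu> n) x $ i)) \<longlonglongrightarrow> (LINT x|lborel. a x * (y x * W x $ i))"
      by (rule bounded_AE_mult_L1_tendsto[OF _ _ an_abs an_lim L(2) L(3) sub[OF L(1)]]) auto
    show "integrable lborel (\<lambda>x. an n x * (y x * V (\<nu> n) x $ i))"
      by (rule Bochner_Integration.integrable_bound[OF L(2)[of "\<nu> n"]])
         (auto simp: abs_mult an01 mult_left_le_one_le)
    show "integrable lborel (\<lambda>x. a x * (y x * W x $ i))"
      by (rule Bochner_Integration.integrable_bound[OF L(3)])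
         (auto simp: abs_mult a01 mult_left_le_one_le)
  qed
  note Y1 = lim_mult[OF Y(1)[of 1] Y(2)[of 1], where i=1] lim_mult[OF Y(1)[of 2] Y(2)[of 2], where i=2]
  have lhs: "(\<lambda>n. LINT x|lborel. Y x \<bullet> (an n x *\<^sub>R V (\<nu> n) x)) \<longlonglongrightarrow> (LINT x|lborel. a x * (Y x \<bullet> W x))"
  proof -
    have "(LINT x|lborel. Y x \<bullet> (an n x *\<^sub>R V (\<nu> n) x)) =
      (LINT x|lborel. an n x * (Y x $ 1 * V (\<nu> n) x $ 1)) + (LINT x|lborel. an n x * (Y x $ 2 * V (\<nu> n) x $ 2))" for n
      using int_mult(1)[OF Y(1) Y(2)]
      by (subst Bochner_Integration.integral_add[symmetric]) (auto simp: inner_sum2 algebra_simps)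
    moreover have "(LINT x|lborel. a x * (Y x \<bullet> W x)) =
      (LINT x|lborel. a x * (Y x $ 1 * W x $ 1)) + (LINT x|lborel. a x * (Y x $ 2 * W x $ 2))"
      using int_mult(2)[OF Y(1) Y(2)]
      by (subst Bochner_Integration.integral_add[symmetric]) (auto simp: inner_sum2 algebra_simps)
    ultimately show ?thesis using tendsto_add[OF Y1] by simp
  qed
  have rhs: "(\<lambda>n. LINT x|lborel. f x * (an n x *\<^sub>R V (\<nu> n) x) $ 1) \<longlonglongrightarrow> (LINT x|lborel. a x * (f x * W x $ 1))"
    using lim_mult[OF f(1) f(2), where i=1] by (simp add: mult_ac)
  have "\<forall>\<^sub>F n in sequentially. (LINT x|lborel. Y x \<bullet> (an n x *\<^sub>R V (\<nu> n) x)) = (LINT x|lborel. f x * (an n x *\<^sub>R V (\<nu> n) x) $ 1)"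
    using ev
  proof eventually_elim
    case (elim n)
    then obtain K where K: "C1_grad (\<phi> n) (\<lambda>x. an n x *\<^sub>R V (\<nu> n) x)" "compact K" "K \<subseteq> osquare p R" "\<And>x. x \<notin> K \<Longrightarrow> \<phi> n x = 0"
      using test by blast
    show ?case by (rule weak_eq[OF K])
  qed
  then have eq: "(LINT x|lborel. a x * (Y x \<bullet> W x)) = (LINT x|lborel. a x * (f x * W x $ 1))"
    using LIMSEQ_unique[OF Lim_transform_eventually[OF lhs] rhs] by simp
  have i1: "integrable lborel (\<lambda>x. a x * (norm (W x))\<^sup>2)"
    by (rule Bochner_Integration.integrable_bound[OF norm_W_integrable(2)]) (auto simp: abs_mult a01 mult_left_le_one_le)
  have i2: "integrable lborel (\<lambda>x. a x * (f x)\<^sup>2)"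
    by (rule Bochner_Integration.integrable_bound[OF f(2)]) (auto simp: abs_mult a01 mult_left_le_one_le)
  have i3: "integrable lborel (\<lambda>x. a x * (Y x \<bullet> W x))"
    using Bochner_Integration.integrable_add[OF int_mult(2)[OF Y(1)[of 1] Y(2)[of 1], where i=1] int_mult(2)[OF Y(1)[of 2] Y(2)[of 2], where i=2]]
    by (simp add: inner_sum2 algebra_simps)
  have "(LINT x|lborel. c * (a x * (norm (W x))\<^sup>2)) \<le> (LINT x|lborel. a x * (Y x \<bullet> W x))"
  proof (rule integral_mono_AE)
    show "AE x in lborel. c * (a x * (norm (W x))\<^sup>2) \<le> a x * (Y x \<bullet> W x)"
      using elliptic
    proof eventually_elim
      case (elim x)
      show ?case
      proof (cases "x \<in> osquare p s")
        case True
        then have "c * (norm (W x))\<^sup>2 \<le> Y x \<bullet> W x" using elim osquare_subset_csquare[OF sR, of p] by auto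
        from mult_left_mono[OF this a01(1)[of x]] show ?thesis by (simp add: mult_ac)
      qed (simp add: a_def)
    qed
  qed (use i1 i3 in auto)
  also have "\<dots> = (LINT x|lborel. a x * (f x * W x $ 1))" by (rule eq)
  \<comment> \<open>Young's inequality with weight c: half of the energy on the left is returned and
    absorbed there.\<close>
  also have "\<dots> \<le> (LINT x|lborel. (c / 2) * (a x * (norm (W x))\<^sup>2) + (1 / (2 * c)) * (a x * (f x)\<^sup>2))"
  proof (rule integral_mono)
    show "integrable lborel (\<lambda>x. a x * (f x * W x $ 1))" by (rule int_mult(2)[OF f(1) f(2)])
    show "integrable lborel (\<lambda>x. (c / 2) * (a x * (norm (W x))\<^sup>2) + (1 / (2 * c)) * (a x * (f x)\<^sup>2))"
      using i1 i2 by auto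
    fix x
    have "0 \<le> (f x - c * W x $ 1)\<^sup>2 / (2 * c)" using c by simp
    also have "\<dots> = (1 / (2 * c)) * (f x)\<^sup>2 + (c / 2) * (W x $ 1)\<^sup>2 - f x * W x $ 1"
      using c by (simp add: power2_eq_square field_simps)
    finally have "f x * W x $ 1 \<le> (c / 2) * (W x $ 1)\<^sup>2 + (1 / (2 * c)) * (f x)\<^sup>2" by simp
    also have "\<dots> \<le> (c / 2) * (norm (W x))\<^sup>2 + (1 / (2 * c)) * (f x)\<^sup>2"
      using c by (simp add: norm_sq2)
    finally have "a x * (f x * W x $ 1) \<le> a x * ((c / 2) * (norm (W x))\<^sup>2 + (1 / (2 * c)) * (f x)\<^sup>2)"
      by (rule mult_left_mono) (rule a01)
    then show "a x * (f x * W x $ 1) \<le> (c / 2) * (a x * (norm (W x))\<^sup>2) + (1 / (2 * c)) * (a x * (f x)\<^sup>2)"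
      by (simp add: algebra_simps)
  qed
  also have "\<dots> = (c / 2) * (LINT x|lborel. a x * (norm (W x))\<^sup>2) + (1 / (2 * c)) * (LINT x|lborel. a x * (f x)\<^sup>2)"
    using i1 i2 by simp
  finally have "(c / 2) * (LINT x|lborel. a x * (norm (W x))\<^sup>2) \<le> (1 / (2 * c)) * (LINT x|lborel. a x * (f x)\<^sup>2)"
    by (simp add: field_simps)
  then have "(2 / c) * ((c / 2) * (LINT x|lborel. a x * (norm (W x))\<^sup>2)) \<le> (2 / c) * ((1 / (2 * c)) * (LINT x|lborel. a x * (f x)\<^sup>2))"
    using c by (intro mult_left_mono) auto
  then show "(LINT x|lborel. a x * (norm (W x))\<^sup>2) \<le> (1 / c\<^sup>2) * (LINT x|lborel. a x * (f x)\<^sup>2)"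
    using c by (simp add: power2_eq_square)
  have nlim: "(\<lambda>n. LINT x|lborel. an n x * norm (V (\<nu> n) x)) \<longlonglongrightarrow> (LINT x|lborel. a x * norm (W x))"
    by (rule bounded_AE_mult_L1_tendsto[OF _ _ an_abs an_lim norm_V_integrable norm_W_integrable(1) sub[OF norm_V_L1]]) auto
  have in_: "integrable lborel (\<lambda>x. an n x * norm (V (\<nu> n) x))" for n
    by (rule Bochner_Integration.integrable_bound[OF norm_V_integrable[of "\<nu> n"]]) (auto simp: abs_mult an01 mult_left_le_one_le)
  \<comment> \<open>Fatou's lemma is enough: the test functions converge almost everywhere, and
    their Sobolev bounds converge to the desired right-hand side.\<close>
  have "(\<integral>\<^sup>+x. ennreal ((indicator (osquare p s) x * ramp \<sigma> (w x - k))\<^sup>2) \<partial>lborel)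
     = (\<integral>\<^sup>+x. liminf (\<lambda>n. ennreal ((\<phi> n x)\<^sup>2)) \<partial>lborel)"
  proof (rule nn_integral_cong_AE)
    show "AE x in lborel. ennreal ((indicator (osquare p s) x * ramp \<sigma> (w x - k))\<^sup>2) = liminf (\<lambda>n. ennreal ((\<phi> n x)\<^sup>2))"
      using \<phi>_lim
    proof eventually_elim
      case (elim x)
      then have "(\<lambda>n. ennreal ((\<phi> n x)\<^sup>2)) \<longlonglongrightarrow> ennreal ((indicator (osquare p s) x * ramp \<sigma> (w x - k))\<^sup>2)"
        by (intro tendsto_ennrealI tendsto_power)
      then show ?case by (intro lim_imp_Liminf[symmetric]) auto
    qed
  qed
  also have "\<dots> \<le> liminf (\<lambda>n. \<integral>\<^sup>+x. ennreal ((\<phi> n x)\<^sup>2) \<partial>lborel)"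
    by (rule nn_integral_liminf) measurable
  also have "\<dots> \<le> liminf (\<lambda>n. (ennreal (LINT x|lborel. an n x * norm (V (\<nu> n) x)))\<^sup>2)"
  proof (rule Liminf_mono)
    show "\<forall>\<^sub>F n in sequentially. (\<integral>\<^sup>+x. ennreal ((\<phi> n x)\<^sup>2) \<partial>lborel) \<le> (ennreal (LINT x|lborel. an n x * norm (V (\<nu> n) x)))\<^sup>2"
      using ev
    proof eventually_elim
      case (elim n)
      then obtain K where K: "C1_grad (\<phi> n) (\<lambda>x. an n x *\<^sub>R V (\<nu> n) x)" "compact K" "K \<subseteq> osquare p R" "\<And>x. x \<notin> K \<Longrightarrow> \<phi> n x = 0"
        using test by blast
      have "(\<integral>\<^sup>+x. ennreal (norm (an n x *\<^sub>R V (\<nu> n) x)) \<partial>lborel) = ennreal (LINT x|lborel. an n x * norm (V (\<nu> n) x))"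
        using nn_integral_eq_integral[OF in_[of n]] by (simp add: an01)
      then show ?case using planar_Sobolev[OF K(1,2,4)] by simp
    qed
  qed
  also have "\<dots> = (ennreal (LINT x|lborel. a x * norm (W x)))\<^sup>2"
  proof -
    have "(\<lambda>n. ennreal ((LINT x|lborel. an n x * norm (V (\<nu> n) x))\<^sup>2)) \<longlonglongrightarrow> ennreal ((LINT x|lborel. a x * norm (W x))\<^sup>2)"
      by (intro tendsto_ennrealI tendsto_power nlim)
    moreover have "0 \<le> (LINT x|lborel. an n x * norm (V (\<nu> n) x))" "0 \<le> (LINT x|lborel. a x * norm (W x))" for n
      by (auto intro!: integral_nonneg_AE simp: an01 a01)
    ultimately have "(\<lambda>n. (ennreal (LINT x|lborel. an n x * norm (V (\<nu> n) x)))\<^sup>2) \<longlonglongrightarrow> (ennreal (LINT x|lborel. a x * norm (W x)))\<^sup>2"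
      by (simp add: ennreal_power)
    then show ?thesis by (intro lim_imp_Liminf) auto
  qed
  finally show "(\<integral>\<^sup>+x. ennreal ((indicator (osquare p s) x * ramp \<sigma> (w x - k))\<^sup>2) \<partial>lborel) \<le> (ennreal (LINT x|lborel. a x * norm (W x)))\<^sup>2" .
qed

end

section \<open>Decay of superlevel sets, maximum principle and oscillation\<close>

lemma conv_uminus: "conv (\<lambda>x. - g x) k x = - conv g k x"
  by (simp add: conv_def)

lemma partial_uminus: "g differentiable at x \<Longrightarrow> partial i (\<lambda>x. - g x) x = - partial i g x"
  using partial_eqI[OF has_derivative_minus, of g "frechet_derivative g (at x)" x i]
  by (simp add: partial_def frechet_derivative_works)

context elliptic_square
begin

lemma N_nonneg: "N \<ge> 0"
  using f(4) by (rule order_trans[rotated]) (auto intro!: integral_nonneg_AE)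

text \<open>With A_k the superlevel set and \<sigma> = h - k, the chain is (\<sigma> / 2)^2 |A_h|
  \<le> (\<integral> a |W|)^2 \<le> |A_k| \<integral> a |W|^2 \<le> |A_k| c^(-2) \<integral> a f^2,
  and the last integral is at most (N + 1) |A_k| to the power \<epsilon> / (2 + \<epsilon>). The
  ingredients are the lower bound of \<open>ramp\<close>, planar Sobolev, Cauchy-Schwarz, the energy
  bound and the integrability of f.\<close>

lemma level_decay:
  assumes \<nu>: "strict_mono \<nu>" "\<And>n. n0 \<le> \<nu> n" and ae: "AE x in lborel. (\<lambda>n. conv w (mol (\<nu> n)) x) \<longlonglongrightarrow> w x"
    and sn: "\<And>n. sn n \<le> R" "sn \<longlonglongrightarrow> s"
    and M: "\<And>n x. x \<in> csquare p (sn n) - osquare p (sn n) \<Longrightarrow> conv w (mol (\<nu> n)) x \<le> M n" "M \<longlonglongrightarrow> m"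
    and k: "m < k" "k < h" and s0: "0 \<le> s"
  defines "\<mu> \<equiv> \<lambda>t. measure lborel {x \<in> osquare p s. t < w x}"
  shows "\<mu> h \<le> (4 * (N + 1) / c\<^sup>2) / (h - k)\<^sup>2 * \<mu> k powr (1 + \<epsilon> / (2 + \<epsilon>))"
proof -
  define \<sigma> where "\<sigma> = h - k"
  have \<sigma>: "\<sigma> > 0" using k by (simp add: \<sigma>_def)
  define A where "A t = {x \<in> osquare p s. t < w x}" for t
  have A_sets [measurable]: "A t \<in> sets borel" for t
    unfolding A_def using osquare_sets[of p s] by measurable
  have finA: "emeasure lborel (A t) < \<infinity>" for t
  proof -
    have "emeasure lborel (A t) \<le> emeasure lborel (osquare p s)" by (rule emeasure_mono) (auto simp: A_def)
    also have "\<dots> < \<infinity>" using emeasure_csquare(2)[OF s0] by simp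
    finally show ?thesis .
  qed
  define a where "a x = indicator (osquare p s) x * ramp' \<sigma> (w x - k)" for x
  have [measurable]: "ramp' \<sigma> \<in> borel_measurable borel"
    by (intro borel_measurable_continuous_onI ramp'_continuous \<sigma>)
  have a_meas [measurable]: "a \<in> borel_measurable borel" unfolding a_def[abs_def] by measurable
  have a01: "0 \<le> a x" "a x \<le> 1" for x using ramp'_bounds[OF \<sigma>] by (auto simp: a_def indicator_def)
  have aA: "a x = indicator (A k) x * a x" for x by (auto simp: a_def A_def indicator_def)
  note en = truncated_energy[OF \<nu> ae sn M k(1) \<sigma>, folded a_def]
  have i1: "integrable lborel (\<lambda>x. a x * (norm (W x))\<^sup>2)"
    by (rule Bochner_Integration.integrable_bound[OF norm_W_integrable(2)]) (auto simp: abs_mult a01 mult_left_le_one_le)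
  have i2: "integrable lborel (\<lambda>x. a x * (f x)\<^sup>2)"
    by (rule Bochner_Integration.integrable_bound[OF f(2)]) (auto simp: abs_mult a01 mult_left_le_one_le)
  have i3: "integrable lborel (\<lambda>x. (a x * norm (W x))\<^sup>2)"
    by (rule Bochner_Integration.integrable_bound[OF norm_W_integrable(2)])
       (auto simp: power_mult_distrib a01 mult_left_le_one_le power_le_one)
  have iA: "integrable lborel (indicator (A k) :: real^2 \<Rightarrow> real)"
    using finA by (simp add: integrable_indicator_iff)
  have af: "(LINT x|lborel. a x * (f x)\<^sup>2) \<le> (N + 1) * \<mu> k powr (\<epsilon> / (2 + \<epsilon>))"
  proof -
    have "(LINT x|lborel. a x * (f x)\<^sup>2) \<le> (LINT x|lborel. indicator (A k) x * (f x)\<^sup>2)"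
    proof (rule integral_mono[OF i2])
      show "integrable lborel (\<lambda>x. indicator (A k) x * (f x)\<^sup>2)"
        using integrable_mult_indicator[OF _ f(2), of "A k"] by simp
      show "a x * (f x)\<^sup>2 \<le> indicator (A k) x * (f x)\<^sup>2" for x
        using a01[of x] aA[of x] by (intro mult_right_mono) (auto simp: indicator_def split: if_splits)
    qed
    also have "\<dots> \<le> (N + 1) * measure lborel (A k) powr (\<epsilon> / (2 + \<epsilon>))"
      by (rule integral_square_le_measure_powr[OF _ _ finA \<epsilon> f(3,4,2)]) auto
    finally show ?thesis by (simp add: \<mu>_def A_def)
  qed
  have "(LINT x|lborel. a x * norm (W x)) = (LINT x|lborel. \<bar>indicator (A k) x * (a x * norm (W x))\<bar>)"
    using a01 aA by (intro Bochner_Integration.integral_cong) (auto simp: indicator_def split: if_splits)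
  then have "(LINT x|lborel. a x * norm (W x))\<^sup>2 \<le> (LINT x|lborel. (indicator (A k) x)\<^sup>2) * (LINT x|lborel. (a x * norm (W x))\<^sup>2)"
    using Cauchy_Schwarz_integral[of "indicator (A k)" lborel "\<lambda>x. a x * norm (W x)"] iA i3
    by (simp add: power2_eq_square[of "indicator (A k) x" for x] indicator_inter_arith[symmetric])
  also have "(LINT x|lborel. (indicator (A k) x)\<^sup>2) = \<mu> k"
    by (simp add: power2_eq_square indicator_inter_arith[symmetric] \<mu>_def A_def)
  also have "(LINT x|lborel. (a x * norm (W x))\<^sup>2) \<le> (LINT x|lborel. a x * (norm (W x))\<^sup>2)"
  proof (rule integral_mono[OF i3 i1])
    fix x
    have "(a x)\<^sup>2 * (norm (W x))\<^sup>2 \<le> a x * (norm (W x))\<^sup>2"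
      using a01[of x] by (intro mult_right_mono) (auto simp: power2_eq_square mult_left_le_one_le)
    then show "(a x * norm (W x))\<^sup>2 \<le> a x * (norm (W x))\<^sup>2" by (simp add: power_mult_distrib)
  qed
  also have "\<dots> \<le> (1 / c\<^sup>2) * (LINT x|lborel. a x * (f x)\<^sup>2)" by (rule en(1))
  also have "\<dots> \<le> (1 / c\<^sup>2) * ((N + 1) * \<mu> k powr (\<epsilon> / (2 + \<epsilon>)))" by (rule mult_left_mono[OF af]) simp
  finally have up: "(LINT x|lborel. a x * norm (W x))\<^sup>2 \<le> \<mu> k * ((1 / c\<^sup>2) * ((N + 1) * \<mu> k powr (\<epsilon> / (2 + \<epsilon>))))"
    by (simp add: \<mu>_def mult_left_mono)
  have "ennreal ((\<sigma> / 2)\<^sup>2) * emeasure lborel (A h) = (\<integral>\<^sup>+x. ennreal ((\<sigma> / 2)\<^sup>2) * indicator (A h) x \<partial>lborel)"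
    by (subst nn_integral_cmult_indicator) auto
  also have "\<dots> \<le> (\<integral>\<^sup>+x. ennreal ((indicator (osquare p s) x * ramp \<sigma> (w x - k))\<^sup>2) \<partial>lborel)"
  proof (rule nn_integral_mono)
    fix x
    show "ennreal ((\<sigma> / 2)\<^sup>2) * indicator (A h) x \<le> ennreal ((indicator (osquare p s) x * ramp \<sigma> (w x - k))\<^sup>2)"
    proof (cases "x \<in> A h")
      case True
      then have "\<sigma> / 2 \<le> ramp \<sigma> (w x - k)" by (intro ramp_ge \<sigma>) (simp add: A_def \<sigma>_def)
      then have "(\<sigma> / 2)\<^sup>2 \<le> (ramp \<sigma> (w x - k))\<^sup>2" using \<sigma> by (intro power_mono) auto
      then show ?thesis using True by (auto simp: A_def intro!: ennreal_leI)
    qed simp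
  qed
  also have "\<dots> \<le> (ennreal (LINT x|lborel. a x * norm (W x)))\<^sup>2" by (rule en(2))
  also have "\<dots> = ennreal ((LINT x|lborel. a x * norm (W x))\<^sup>2)"
    by (intro ennreal_power integral_nonneg_AE) (auto simp: a01)
  also have "\<dots> \<le> ennreal (\<mu> k * ((1 / c\<^sup>2) * ((N + 1) * \<mu> k powr (\<epsilon> / (2 + \<epsilon>)))))"
    by (rule ennreal_leI[OF up])
  also have "emeasure lborel (A h) = ennreal (\<mu> h)"
    using finA[of h] by (simp add: \<mu>_def A_def emeasure_eq_ennreal_measure less_top)
  finally have "(\<sigma> / 2)\<^sup>2 * \<mu> h \<le> \<mu> k * ((1 / c\<^sup>2) * ((N + 1) * \<mu> k powr (\<epsilon> / (2 + \<epsilon>))))"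
    using N_nonneg by (subst (asm) ennreal_mult[symmetric]) (auto simp: \<mu>_def)
  also have "\<dots> = ((N + 1) / c\<^sup>2) * \<mu> k powr (1 + \<epsilon> / (2 + \<epsilon>))"
  proof -
    have "\<mu> k * \<mu> k powr (\<epsilon> / (2 + \<epsilon>)) = \<mu> k powr 1 * \<mu> k powr (\<epsilon> / (2 + \<epsilon>))" by (simp add: \<mu>_def)
    then show ?thesis by (simp add: powr_add)
  qed
  finally have "(\<sigma> / 2)\<^sup>2 * \<mu> h \<le> ((N + 1) / c\<^sup>2) * \<mu> k powr (1 + \<epsilon> / (2 + \<epsilon>))" .
  then have "(4 / \<sigma>\<^sup>2) * ((\<sigma> / 2)\<^sup>2 * \<mu> h) \<le> (4 / \<sigma>\<^sup>2) * (((N + 1) / c\<^sup>2) * \<mu> k powr (1 + \<epsilon> / (2 + \<epsilon>)))"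
    by (rule mult_left_mono) simp
  moreover have "(4 / \<sigma>\<^sup>2) * ((\<sigma> / 2)\<^sup>2 * \<mu> h) = \<mu> h" using \<sigma> by (simp add: power_divide)
  moreover have "(4 / \<sigma>\<^sup>2) * (((N + 1) / c\<^sup>2) * \<mu> k powr (1 + \<epsilon> / (2 + \<epsilon>)))
      = (4 * (N + 1) / c\<^sup>2) / (h - k)\<^sup>2 * \<mu> k powr (1 + \<epsilon> / (2 + \<epsilon>))"
  proof -
    have "(4 / a) * ((b / e) * X) = (4 * b / e) / a * X" for a b e X :: real by (simp add: mult_ac)
    then show ?thesis unfolding \<sigma>_def .
  qed
  ultimately show ?thesis by linarith
qed

text \<open>The increment produced by Stampacchia's iteration for L = 4 (N + 1) / c^2, \<beta> =
  \<epsilon> / (2 + \<epsilon>) and initial measure at most 4 R^2, the area of the largest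
  square.\<close>

definition sup_defect :: real where
  "sup_defect = sqrt (4 * (4 * (N + 1) / c\<^sup>2) * (4 * R\<^sup>2) powr (\<epsilon> / (2 + \<epsilon>)) * 4 powr (1 / (\<epsilon> / (2 + \<epsilon>))))"

text \<open>The iteration can start only at levels k0 > m, because the truncation must vanish near
  the boundary for all late mollifications. Levels m + 1 / (j + 1) and a countable union of null
  sets then give the bound with m itself.\<close>

lemma weak_maximum_principle:
  assumes \<nu>: "strict_mono \<nu>" "\<And>n. n0 \<le> \<nu> n" and ae: "AE x in lborel. (\<lambda>n. conv w (mol (\<nu> n)) x) \<longlonglongrightarrow> w x"
    and sn: "\<And>n. sn n \<le> R" "sn \<longlonglongrightarrow> s"
    and M: "\<And>n x. x \<in> csquare p (sn n) - osquare p (sn n) \<Longrightarrow> conv w (mol (\<nu> n)) x \<le> M n" "M \<longlonglongrightarrow> m"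
    and s0: "0 \<le> s"
  shows "AE x in lborel. x \<in> osquare p s \<longrightarrow> w x \<le> m + sup_defect"
proof -
  define \<mu> where "\<mu> t = measure lborel {x \<in> osquare p s. t < w x}" for t
  have A_sets [measurable]: "{x \<in> osquare p s. t < w x} \<in> sets borel" for t
    using osquare_sets[of p s] by measurable
  have sR: "s \<le> R" by (rule LIMSEQ_le_const2[OF sn(2)]) (use sn(1) in auto)
  have finQ: "emeasure lborel (osquare p s) = ennreal (4 * s\<^sup>2)" by (rule emeasure_csquare[OF s0])
  have finA: "emeasure lborel {x \<in> osquare p s. t < w x} \<le> ennreal (4 * s\<^sup>2)" for t
    unfolding finQ[symmetric] by (rule emeasure_mono) auto
  have fm: "{x \<in> osquare p s. t < w x} \<in> fmeasurable lborel" for t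
    using finA[of t] by (intro fmeasurableI) (auto simp: less_top[symmetric] top_unique intro: order_le_less_trans)
  have zero: "\<mu> (k0 + sup_defect) = 0" if k0: "m < k0" for k0
    unfolding sup_defect_def
  proof (rule Stampacchia_iteration)
    show "0 \<le> \<mu> k" for k by (simp add: \<mu>_def)
    show "\<mu> h \<le> \<mu> k" if "k \<le> h" for k h
      unfolding \<mu>_def using that fm by (intro measure_mono_fmeasurable) auto
    show "\<mu> h \<le> (4 * (N + 1) / c\<^sup>2) / (h - k)\<^sup>2 * \<mu> k powr (1 + \<epsilon> / (2 + \<epsilon>))" if "k0 \<le> k" "k < h" for k h
      unfolding \<mu>_def using level_decay[OF \<nu> ae sn M _ that(2) s0] that(1) k0 by simp
    show "4 * (N + 1) / c\<^sup>2 > 0" using c N_nonneg by (intro divide_pos_pos) auto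
    show "\<epsilon> / (2 + \<epsilon>) > 0" using \<epsilon> by simp
    have "\<mu> k0 \<le> 4 * s\<^sup>2" unfolding \<mu>_def measure_def using finA by (intro enn2real_leI) auto
    also have "\<dots> \<le> 4 * R\<^sup>2" using sR s0 by (simp add: power_mono)
    finally show "\<mu> k0 \<le> 4 * R\<^sup>2" .
    show "4 * R\<^sup>2 > 0" using R by simp
  qed
  have "AE x in lborel. x \<in> osquare p s \<longrightarrow> w x \<le> m + inverse (real (Suc j)) + sup_defect" for j
  proof -
    have "\<mu> (m + inverse (real (Suc j)) + sup_defect) = 0" by (rule zero) simp
    then have "{x \<in> osquare p s. m + inverse (real (Suc j)) + sup_defect < w x} \<in> null_sets lborel"
      using fm[of "m + inverse (real (Suc j)) + sup_defect"]
      by (intro null_setsI) (auto simp: \<mu>_def fmeasurable_def emeasure_eq_ennreal_measure less_top)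
    then show ?thesis
      by (rule AE_not_in[THEN eventually_mono]) auto
  qed
  then have "AE x in lborel. \<forall>j. x \<in> osquare p s \<longrightarrow> w x \<le> m + inverse (real (Suc j)) + sup_defect"
    unfolding AE_all_countable by blast
  then show ?thesis
  proof eventually_elim
    case (elim x)
    show ?case
    proof
      assume x: "x \<in> osquare p s"
      have "(\<lambda>j. m + inverse (real (Suc j)) + sup_defect) \<longlonglongrightarrow> m + 0 + sup_defect"
        by (intro tendsto_intros LIMSEQ_inverse_real_of_nat)
      then have "w x \<le> m + 0 + sup_defect"
        by (rule LIMSEQ_le_const) (use elim x in auto)
      then show "w x \<le> m + sup_defect" by simp
    qed
  qed
qed

text \<open>The equation is linear in f and Y, and ellipticity is quadratic in the pair (W, Y), so
  changing all signs is harmless. Lower bounds for w thus follow from upper bounds for -w, although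
  the underlying truncation of v is one-sided.\<close>

lemma elliptic_square_uminus:
  "elliptic_square (\<lambda>x. - w x) (\<lambda>x. - f x) (\<lambda>x. - W x) (\<lambda>x. - Y x) p R c \<epsilon> N n0"
proof
  show "partial i (conv (\<lambda>x. - w x) (mol n)) x = conv (\<lambda>y. (- W y) $ i) (mol n) x"
    if "n0 \<le> n" "x \<in> csquare p R" for n x i
  proof -
    have "conv w (mol n) differentiable at x" using C1_gradD[OF C1_conv_w] by (auto simp: differentiable_def)
    moreover have "conv (\<lambda>x. - w x) (mol n) = (\<lambda>x. - conv w (mol n) x)" by (rule ext) (rule conv_uminus)
    ultimately show ?thesis
      using weak_grad_w[OF that, of i] by (simp add: conv_uminus partial_uminus)
  qed
  show "(LINT x|lborel. - Y x \<bullet> D x) = (LINT x|lborel. - f x * D x $ 1)"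
    if "C1_grad \<phi> D" "compact K" "K \<subseteq> osquare p R" "\<And>x. x \<notin> K \<Longrightarrow> \<phi> x = 0" for \<phi> D K
    using weak_eq[OF that] by simp
qed (use R c \<epsilon> w W Y f elliptic in auto)

text \<open>Courant-Lebesgue is applied to each mollification, so the half-side and the reference
  value on the boundary depend on the index. Both range in compact intervals; along a common
  subsequence they converge and the mollifications converge almost everywhere, which is the
  situation of the maximum principle. Applied to w and to -w it confines w around the limit l of the
  reference values, on a square that contains the one of half-side r.\<close>

theorem essential_oscillation:
  assumes r: "0 < r" "r < R" and B: "AE x in lborel. \<bar>w x\<bar> \<le> B"
    and E: "(LINT x|lborel. (norm (W x))\<^sup>2) < E"
  shows "\<exists>l. AE x in lborel. x \<in> osquare p r \<longrightarrow> \<bar>w x - l\<bar> \<le> 2 * sqrt (8 * E / ln (R / r)) + sup_defect"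
proof -
  define \<kappa> where "\<kappa> = 2 * sqrt (8 * E / ln (R / r))"
  define g where "g j = conv w (mol (j + n0))" for j
  have energy: "(\<integral>\<^sup>+x. ennreal ((norm (grad (g j) x))\<^sup>2) * indicator (csquare p R) x \<partial>lborel) < ennreal E" for j
  proof -
    have i: "integrable lborel (\<lambda>x. (norm (V (j + n0) x))\<^sup>2)" using V_integrable(2) by (simp add: norm_sq2)
    have "(\<integral>\<^sup>+x. ennreal ((norm (grad (g j) x))\<^sup>2) * indicator (csquare p R) x \<partial>lborel)
      \<le> (\<integral>\<^sup>+x. ennreal ((norm (V (j + n0) x))\<^sup>2) \<partial>lborel)"
      by (rule nn_integral_mono) (auto simp: g_def grad_conv_w indicator_def)
    also have "\<dots> = ennreal (LINT x|lborel. (norm (V (j + n0) x))\<^sup>2)"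
      by (rule nn_integral_eq_integral[OF i]) auto
    also have "(LINT x|lborel. (norm (V (j + n0) x))\<^sup>2) = (LINT x|lborel. (V (j + n0) x $ 1)\<^sup>2) + (LINT x|lborel. (V (j + n0) x $ 2)\<^sup>2)"
      using V_integrable(2) by (simp add: norm_sq2)
    also have "\<dots> \<le> (LINT x|lborel. (W x $ 1)\<^sup>2) + (LINT x|lborel. (W x $ 2)\<^sup>2)"
      unfolding V_def by (simp add: add_mono conv_square_integrable(2)[OF W])
    also have "\<dots> = (LINT x|lborel. (norm (W x))\<^sup>2)" using W(2) by (simp add: norm_sq2)
    also have "ennreal \<dots> < ennreal E" using E by (intro ennreal_lessI) (auto intro: le_less_trans[rotated] integral_nonneg_AE)
    finally show ?thesis by (simp add: ennreal_leI)
  qed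
  have "\<exists>s\<in>{r..R}. \<exists>y. \<forall>x\<in>csquare p s - osquare p s. \<bar>g j x - g j y\<bar> \<le> \<kappa>" for j
    using Courant_Lebesgue_square[OF C1_conv_w[of "j + n0"] r, of p E] energy[of j] unfolding g_def \<kappa>_def by blast
  then obtain s y where s: "\<And>j. s j \<in> {r..R}"
    and y: "\<And>j x. x \<in> csquare p (s j) - osquare p (s j) \<Longrightarrow> \<bar>g j x - g j (y j)\<bar> \<le> \<kappa>" by metis
  have gB: "\<bar>g j x\<bar> \<le> B" for j x unfolding g_def by (rule conv_abs_le[OF w B])
  have "(\<lambda>j. LINT x|lborel. norm (g j x - w x)) \<longlonglongrightarrow> 0"
    using LIMSEQ_ignore_initial_segment[OF conv_L1_tendsto[OF w], of n0] by (simp add: g_def)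
  moreover have "integrable lborel (\<lambda>x. g j x - w x)" for j
    using conv_integrable(1)[OF w, of "inverse (real (Suc (j + n0)))"] w by (auto simp: g_def mol_def)
  ultimately obtain \<rho> where \<rho>: "strict_mono \<rho>" "AE x in lborel. (\<lambda>j. g (\<rho> j) x - w x) \<longlonglongrightarrow> 0"
    using tendsto_L1_AE_subseq[of lborel "\<lambda>j x. g j x - w x"] by auto
  \<comment> \<open>Half-side and reference value are extracted as a pair so that a single
    subsequence serves both.\<close>
  have "compact ({r..R} \<times> {-B..B})" by (intro compact_Times) auto
  moreover have "\<forall>j. (s (\<rho> j), g (\<rho> j) (y (\<rho> j))) \<in> {r..R} \<times> {-B..B}"
    using s gB by (auto simp: abs_le_iff minus_le_iff)
  ultimately obtain Sl \<rho>' where \<rho>': "Sl \<in> {r..R} \<times> {-B..B}" "strict_mono \<rho>'"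
      "((\<lambda>j. (s (\<rho> j), g (\<rho> j) (y (\<rho> j)))) \<circ> \<rho>') \<longlonglongrightarrow> Sl"
    unfolding compact_def by meson
  obtain S l where Sl: "Sl = (S, l)" by (cases Sl)
  define \<tau> where "\<tau> = (\<lambda>j. \<rho> (\<rho>' j))"
  define \<nu> where "\<nu> j = \<tau> j + n0" for j
  have st: "strict_mono \<tau>" using \<rho>(1) \<rho>'(2) by (auto simp: \<tau>_def strict_mono_def)
  have Srl: "r \<le> S" using \<rho>'(1) Sl by auto
  have lims: "(\<lambda>j. s (\<tau> j)) \<longlonglongrightarrow> S" "(\<lambda>j. g (\<tau> j) (y (\<tau> j))) \<longlonglongrightarrow> l"
    using tendsto_fst[OF \<rho>'(3)] tendsto_snd[OF \<rho>'(3)] by (simp_all add: Sl o_def \<tau>_def)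
  have \<nu>: "strict_mono \<nu>" "\<And>n. n0 \<le> \<nu> n" using st by (auto simp: \<nu>_def strict_mono_def)
  have ae: "AE x in lborel. (\<lambda>n. conv w (mol (\<nu> n)) x) \<longlonglongrightarrow> w x"
    using \<rho>(2)
  proof eventually_elim
    case (elim x)
    from LIMSEQ_subseq_LIMSEQ[OF elim \<rho>'(2)] have "(\<lambda>j. g (\<tau> j) x - w x) \<longlonglongrightarrow> 0" by (simp add: o_def \<tau>_def)
    then show ?case by (simp add: LIM_zero_iff g_def \<nu>_def)
  qed
  have sR: "s (\<tau> n) \<le> R" for n using s by auto
  have S0: "0 \<le> S" using Srl r by simp
  have up: "AE x in lborel. x \<in> osquare p S \<longrightarrow> w x \<le> (l + \<kappa>) + sup_defect"
  proof (rule weak_maximum_principle[OF \<nu> ae sR lims(1) _ _ S0])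
    show "conv w (mol (\<nu> n)) x \<le> g (\<tau> n) (y (\<tau> n)) + \<kappa>" if "x \<in> csquare p (s (\<tau> n)) - osquare p (s (\<tau> n))" for n x
      using y[OF that] by (simp add: g_def \<nu>_def)
    show "(\<lambda>n. g (\<tau> n) (y (\<tau> n)) + \<kappa>) \<longlonglongrightarrow> l + \<kappa>" by (intro tendsto_intros lims)
  qed
  interpret neg: elliptic_square "\<lambda>x. - w x" "\<lambda>x. - f x" "\<lambda>x. - W x" "\<lambda>x. - Y x" p R c \<epsilon> N n0
    by (rule elliptic_square_uminus)
  have ae': "AE x in lborel. (\<lambda>n. conv (\<lambda>x. - w x) (mol (\<nu> n)) x) \<longlonglongrightarrow> - w x"
    using ae by eventually_elim (auto simp: conv_uminus intro: tendsto_minus)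
  have lo: "AE x in lborel. x \<in> osquare p S \<longrightarrow> - w x \<le> (- l + \<kappa>) + neg.sup_defect"
  proof (rule neg.weak_maximum_principle[OF \<nu> ae' sR lims(1) _ _ S0])
    show "conv (\<lambda>x. - w x) (mol (\<nu> n)) x \<le> - g (\<tau> n) (y (\<tau> n)) + \<kappa>" if "x \<in> csquare p (s (\<tau> n)) - osquare p (s (\<tau> n))" for n x
      using y[OF that] by (simp add: g_def \<nu>_def conv_uminus)
    show "(\<lambda>n. - g (\<tau> n) (y (\<tau> n)) + \<kappa>) \<longlonglongrightarrow> - l + \<kappa>" by (intro tendsto_intros lims)
  qed
  have "AE x in lborel. x \<in> osquare p r \<longrightarrow> \<bar>w x - l\<bar> \<le> \<kappa> + sup_defect"
    using up lo
  proof eventually_elim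
    case (elim x)
    then show ?case using osquare_mono[OF Srl, of p]
      by (auto simp: neg.sup_defect_def sup_defect_def abs_le_iff)
  qed
  then show ?thesis unfolding \<kappa>_def by blast
qed

end

subsection \<open>Products and compositions of functions with a continuous gradient\<close>

lemma C1_grad_mult:
  assumes f: "C1_grad f Df" and g: "C1_grad g Dg"
  shows "C1_grad (\<lambda>x. f x * g x) (\<lambda>x. f x *\<^sub>R Dg x + g x *\<^sub>R Df x)"
  unfolding C1_grad_def
proof (intro conjI allI)
  show "((\<lambda>x. f x * g x) has_derivative (\<lambda>h. (f x *\<^sub>R Dg x + g x *\<^sub>R Df x) \<bullet> h)) (at x)" for x
    using has_derivative_mult[OF C1_gradD[OF f] C1_gradD[OF g], of x]
    by (simp add: inner_add_left mult.commute)
  show "continuous_on UNIV (\<lambda>x. f x *\<^sub>R Dg x + g x *\<^sub>R Df x)"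
    by (intro continuous_intros C1_grad_continuous[OF f] C1_grad_continuous[OF g]
        C1_grad_continuous_grad[OF f] C1_grad_continuous_grad[OF g])
qed

lemma C1_grad_add:
  assumes f: "C1_grad f Df" and g: "C1_grad g Dg"
  shows "C1_grad (\<lambda>x. f x + g x) (\<lambda>x. Df x + Dg x)"
  using assms unfolding C1_grad_def
  by (auto intro!: derivative_eq_intros continuous_intros simp: inner_add_left)

lemma C1_grad_cmult:
  assumes f: "C1_grad f Df"
  shows "C1_grad (\<lambda>x. c * f x) (\<lambda>x. c *\<^sub>R Df x)"
  using assms unfolding C1_grad_def
  by (auto intro!: derivative_eq_intros continuous_intros)

lemma has_derivative_vec_lambda:
  fixes g :: "'a::real_normed_vector \<Rightarrow> real^'n::finite"
  assumes "\<And>i. ((\<lambda>x. g x $ i) has_derivative (\<lambda>h. g' h $ i)) (at x)"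
  shows "(g has_derivative g') (at x)"
  using assms
  by (subst has_derivative_componentwise_within) (auto simp: Basis_vec_def inner_axis)

lemma C1_grad_compose_vec:
  fixes G :: "real^'n::finite \<Rightarrow> real^'m::finite"
  assumes \<Phi>: "C1_grad \<Phi> D\<Phi>" and G: "\<And>j. C1_grad (\<lambda>x. G x $ j) (DG j)"
  shows "C1_grad (\<lambda>x. \<Phi> (G x)) (\<lambda>x. \<Sum>j\<in>UNIV. (D\<Phi> (G x) $ j) *\<^sub>R DG j x)"
  unfolding C1_grad_def
proof (intro conjI allI)
  have d: "(G has_derivative (\<lambda>h. \<chi> j. DG j x \<bullet> h)) (at x)" for x
    by (rule has_derivative_vec_lambda) (simp add: C1_gradD[OF G])
  fix x
  from has_derivative_compose[OF d[of x] C1_gradD[OF \<Phi>]]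
  show "((\<lambda>x. \<Phi> (G x)) has_derivative (\<lambda>h. (\<Sum>j\<in>UNIV. (D\<Phi> (G x) $ j) *\<^sub>R DG j x) \<bullet> h)) (at x)"
    by (simp add: inner_vec_def[of "D\<Phi> (G x)"] inner_sum_left)
  have "continuous_on UNIV G"
    using d by (meson continuous_at_imp_continuous_on has_derivative_continuous)
  then have "continuous_on UNIV (\<lambda>x. D\<Phi> (G x))"
    by (intro continuous_on_compose2[OF C1_grad_continuous_grad[OF \<Phi>, of UNIV]]) auto
  then show "continuous_on UNIV (\<lambda>x. \<Sum>j\<in>UNIV. (D\<Phi> (G x) $ j) *\<^sub>R DG j x)"
    by (intro continuous_intros continuous_on_component C1_grad_continuous_grad[OF G])
qed

lemma integration_by_parts_compact:
  fixes g \<phi> :: "real^'n::finite \<Rightarrow> real"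
  assumes g: "C1_grad g Dg" and \<phi>: "C1_grad \<phi> D\<phi>" and K: "compact K" "\<And>x. x \<notin> K \<Longrightarrow> \<phi> x = 0"
  shows "(LINT x|lborel. g x * D\<phi> x $ i) = - (LINT x|lborel. Dg x $ i * \<phi> x)"
    and "integrable lborel (\<lambda>x. g x * D\<phi> x $ i)" "integrable lborel (\<lambda>x. Dg x $ i * \<phi> x)"
proof -
  have D0: "D\<phi> x = 0" if "x \<notin> K" for x
    using C1_grad_eq_0[OF \<phi> compact_imp_closed[OF K(1)] K(2) that] .
  show 1: "integrable lborel (\<lambda>x. g x * D\<phi> x $ i)"
    by (rule integrable_continuous_compact_support[OF _ K(1)])
       (auto intro!: continuous_intros C1_grad_continuous[OF g] continuous_on_component C1_grad_continuous_grad[OF \<phi>] simp: D0)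
  show 2: "integrable lborel (\<lambda>x. Dg x $ i * \<phi> x)"
    by (rule integrable_continuous_compact_support[OF _ K(1)])
       (auto intro!: continuous_intros C1_grad_continuous[OF \<phi>] continuous_on_component C1_grad_continuous_grad[OF g] simp: K)
  have "(LINT x|lborel. (g x *\<^sub>R D\<phi> x + \<phi> x *\<^sub>R Dg x) $ i) = 0"
    by (rule C1_compact_support_integral_0[OF C1_grad_mult[OF g \<phi>] K(1)]) (simp add: K)
  then have "(LINT x|lborel. g x * D\<phi> x $ i + Dg x $ i * \<phi> x) = 0" by (simp add: mult.commute)
  then show "(LINT x|lborel. g x * D\<phi> x $ i) = - (LINT x|lborel. Dg x $ i * \<phi> x)"
    using 1 2 by simp
qed

lemma partial_conv:
  assumes "integrable lborel g" "kernel r k"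
  shows "partial i (conv g k) x = conv g (partial i k) x"
  using C1_grad_partial[OF conv_C1_grad[OF assms]] by simp

lemma eventually_cball_mol_subset:
  fixes K :: "(real^'n::finite) set"
  assumes "compact K" "open U" "K \<subseteq> U"
  shows "\<exists>n0. \<forall>n\<ge>n0. \<forall>x\<in>K. cball x (inverse (real (Suc n))) \<subseteq> U"
proof -
  obtain e where e: "e > 0" "(\<Union>x\<in>K. ball x e) \<subseteq> U"
    using compact_subset_open_imp_ball_epsilon_subset[OF assms] by blast
  obtain n0 where n0: "inverse (real (Suc n0)) < e" using reals_Archimedean[OF e(1)] by blast
  have "cball x (inverse (real (Suc n))) \<subseteq> U" if "n \<ge> n0" "x \<in> K" for n x
  proof -
    have "inverse (real (Suc n)) \<le> inverse (real (Suc n0))" using that by (intro le_imp_inverse_le) auto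
    then have "inverse (real (Suc n)) < e" using n0 by (rule le_less_trans)
    then have "cball x (inverse (real (Suc n))) \<subseteq> ball x e" by (auto simp: subset_iff)
    then show ?thesis using e(2) that(2) by auto
  qed
  then show ?thesis by blast
qed

text \<open>The fundamental lemma of the calculus of variations in mollified form, used to show that
  weak derivatives are unique. The index \<open>n0\<close> may depend on the point, since the
  conclusion is drawn point by point from an almost everywhere convergent subsequence.\<close>

lemma AE_eq_0_of_conv_eq_0:
  fixes g :: "real^'n::finite \<Rightarrow> real"
  assumes g: "integrable lborel g"
    and z: "\<And>x. x \<in> U \<Longrightarrow> \<exists>n0. \<forall>n\<ge>n0. conv g (mol n) x = 0"
  shows "AE x in lborel. x \<in> U \<longrightarrow> g x = 0"
proof -
  have "(\<lambda>n. LINT x|lborel. norm (conv g (mol n) x - g x)) \<longlonglongrightarrow> 0"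
    using conv_L1_tendsto[OF g] by simp
  moreover have "integrable lborel (\<lambda>x. conv g (mol n) x - g x)" for n
    using conv_integrable(1)[OF g, of "inverse (real (Suc n))"] g by (auto simp: mol_def)
  ultimately obtain \<rho> where \<rho>: "strict_mono \<rho>" "AE x in lborel. (\<lambda>j. conv g (mol (\<rho> j)) x - g x) \<longlonglongrightarrow> 0"
    using tendsto_L1_AE_subseq[of lborel "\<lambda>n x. conv g (mol n) x - g x"] by auto
  from \<rho>(2) show ?thesis
  proof eventually_elim
    case (elim x)
    show ?case
    proof
      assume "x \<in> U"
      then obtain n0 where n0: "\<And>n. n \<ge> n0 \<Longrightarrow> conv g (mol n) x = 0" using z by blast
      have "\<forall>\<^sub>F j in sequentially. conv g (mol (\<rho> j)) x - g x = - g x"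
        unfolding eventually_sequentially
      proof (intro exI[of _ n0] allI impI)
        fix j assume "n0 \<le> j"
        then have "n0 \<le> \<rho> j" using seq_suble[OF \<rho>(1), of j] by simp
        then show "conv g (mol (\<rho> j)) x - g x = - g x" using n0 by simp
      qed
      then have "(\<lambda>j. conv g (mol (\<rho> j)) x - g x) \<longlonglongrightarrow> - g x"
        by (simp add: tendsto_eventually)
      then have "- g x = 0" using elim LIMSEQ_unique by blast
      then show "g x = 0" by simp
    qed
  qed
qed

lemma conv_L1_mult_bounded:
  fixes g :: "real^'n::finite \<Rightarrow> real"
  assumes g: "integrable lborel g" and b: "b \<in> borel_measurable borel" "\<And>x. \<bar>b x\<bar> \<le> B"
  shows "(\<lambda>n. LINT x|lborel. b x * conv g (mol n) x) \<longlonglongrightarrow> (LINT x|lborel. b x * g x)"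
  by (rule bounded_AE_mult_L1_tendsto[where B=B])
     (use b g conv_integrable(1)[OF g, of "inverse (real (Suc n))" for n] conv_L1_tendsto[OF g] in \<open>auto simp: mol_def\<close>)

subsection \<open>The chain rule for weak derivatives\<close>

text \<open>For mollified G the classical chain rule and integration by parts apply. In the limit
  D\<Phi> (Gn) is bounded and converges almost everywhere, while the mollified derivatives converge
  in L1. Derivative information on the support K of the test function suffices.\<close>

lemma weak_chain_rule:
  fixes G :: "real^'n::finite \<Rightarrow> real^2" and d :: "2 \<Rightarrow> real^'n \<Rightarrow> real"
  assumes G: "\<And>j. integrable lborel (\<lambda>x. G x $ j)" and d: "\<And>j. integrable lborel (d j)"
    and wd: "\<And>n x j. n0 \<le> n \<Longrightarrow> x \<in> K \<Longrightarrow> partial i (conv (\<lambda>y. G y $ j) (mol n)) x = conv (d j) (mol n) x"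
    and \<Phi>: "C1_grad \<Phi> D\<Phi>" "\<And>z. norm (D\<Phi> z) \<le> L"
    and \<phi>: "C1_grad \<phi> D\<phi>" "compact K" "\<And>x. x \<notin> K \<Longrightarrow> \<phi> x = 0"
  shows "(LINT x|lborel. \<Phi> (G x) * D\<phi> x $ i) = - (LINT x|lborel. (\<Sum>j\<in>UNIV. D\<Phi> (G x) $ j * d j x) * \<phi> x)"
proof -
  have [measurable]: "(\<lambda>x. G x $ j) \<in> borel_measurable borel" "d j \<in> borel_measurable borel" for j
    using borel_measurable_integrable[OF G] borel_measurable_integrable[OF d] by auto
  have [measurable]: "G \<in> borel_measurable borel"
    by (subst borel_measurable_euclidean_space) (auto simp: Basis_vec_def inner_axis)
  note [measurable] = C1_grad_measurable[OF \<Phi>(1)] C1_grad_measurable[OF \<phi>(1)]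
  have D0: "D\<phi> x = 0" if "x \<notin> K" for x
    using C1_grad_eq_0[OF \<phi>(1) compact_imp_closed[OF \<phi>(2)] \<phi>(3) that] .
  obtain B where B: "B \<ge> 0" "\<And>x. \<bar>D\<phi> x $ i\<bar> \<le> B"
    using continuous_compact_support_bounded[OF C1_grad_continuous_grad[OF \<phi>(1)] \<phi>(2) D0]
    by (meson component_le_norm_cart order_trans)
  obtain B' where B': "B' \<ge> 0" "\<And>x. \<bar>\<phi> x\<bar> \<le> B'"
    using continuous_compact_support_bounded[OF C1_grad_continuous[OF \<phi>(1)] \<phi>(2,3)] by auto
  have L0: "L \<ge> 0" using \<Phi>(2)[of 0] norm_ge_zero order_trans by blast
  define Gn where "Gn n x = (\<chi> j. conv (\<lambda>y. G y $ j) (mol n) x)" for n x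
  have Gn_C1: "C1_grad (\<lambda>x. Gn n x $ j) (grad (conv (\<lambda>y. G y $ j) (mol n)))" for n j
  proof -
    note g = conv_C1_grad[OF G[of j] kernel_mol, of n]
    then show ?thesis using C1_grad_eq[OF g] by (simp add: C1_grad_def Gn_def)
  qed
  note [measurable] = C1_grad_measurable(1)[OF Gn_C1]
  have Gn_meas [measurable]: "Gn n \<in> borel_measurable borel" for n
    by (subst borel_measurable_euclidean_space) (auto simp: Basis_vec_def inner_axis)
  have Gn_int: "integrable lborel (\<lambda>x. Gn n x $ j)" for n j
    using conv_integrable(1)[OF G[of j], of "inverse (real (Suc n))"] by (simp add: Gn_def mol_def)
  define e where "e n x = \<bar>Gn n x $ 1 - G x $ 1\<bar> + \<bar>Gn n x $ 2 - G x $ 2\<bar>" for n x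
  have e_int: "integrable lborel (e n)" for n
    unfolding e_def[abs_def] using Gn_int G by auto
  have e_L1: "(\<lambda>n. LINT x|lborel. e n x) \<longlonglongrightarrow> 0"
  proof -
    have "(LINT x|lborel. e n x) = (LINT x|lborel. \<bar>Gn n x $ 1 - G x $ 1\<bar>) + (LINT x|lborel. \<bar>Gn n x $ 2 - G x $ 2\<bar>)" for n
      unfolding e_def using Gn_int G by simp
    then show ?thesis
      using tendsto_add[OF conv_L1_tendsto[OF G[of 1]] conv_L1_tendsto[OF G[of 2]]] by (simp add: Gn_def)
  qed
  have e_ge: "norm (Gn n x - G x) \<le> e n x" for n x
    using norm_le_l1_cart[of "Gn n x - G x"] by (simp add: e_def UNIV_2)
  have "(\<lambda>n. LINT x|lborel. norm (e n x)) \<longlonglongrightarrow> 0" using e_L1 by (simp add: e_def)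
  then obtain \<rho> where \<rho>: "strict_mono \<rho>" "AE x in lborel. (\<lambda>j. e (\<rho> j) x) \<longlonglongrightarrow> 0"
    using tendsto_L1_AE_subseq[of lborel e] e_int by blast
  define \<nu> where "\<nu> j = \<rho> (j + n0)" for j
  have \<nu>: "strict_mono \<nu>" using \<rho>(1) by (auto simp: \<nu>_def strict_mono_def)
  have \<nu>n0: "n0 \<le> \<nu> j" for j using seq_suble[OF \<rho>(1), of "j + n0"] by (simp add: \<nu>_def)
  have ae: "AE x in lborel. (\<lambda>j. Gn (\<nu> j) x) \<longlonglongrightarrow> G x"
    using \<rho>(2)
  proof eventually_elim
    case (elim x)
    from LIMSEQ_ignore_initial_segment[OF this, of n0] have "(\<lambda>j. e (\<nu> j) x) \<longlonglongrightarrow> 0" by (simp add: \<nu>_def)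
    then have "(\<lambda>j. Gn (\<nu> j) x - G x) \<longlonglongrightarrow> 0"
      by (rule Lim_null_comparison[OF always_eventually, rotated]) (simp add: e_ge)
    then show ?case by (simp add: LIM_zero_iff)
  qed
  note sub = LIMSEQ_subseq_LIMSEQ[OF _ \<nu>, unfolded o_def]
  define E where "E n x = (\<Sum>j\<in>UNIV. (D\<Phi> (Gn n x) $ j) *\<^sub>R grad (conv (\<lambda>y. G y $ j) (mol n)) x)" for n x
  have C: "C1_grad (\<lambda>x. \<Phi> (Gn n x)) (E n)" for n
    unfolding E_def by (rule C1_grad_compose_vec[OF \<Phi>(1) Gn_C1])
  have parts: "(LINT x|lborel. \<Phi> (Gn n x) * D\<phi> x $ i) = - (LINT x|lborel. E n x $ i * \<phi> x)" for n
    by (rule integration_by_parts_compact(1)[OF C \<phi>])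
  have E_eq: "E (\<nu> n) x $ i * \<phi> x = (\<Sum>j\<in>UNIV. (D\<Phi> (Gn (\<nu> n) x) $ j * \<phi> x) * conv (d j) (mol (\<nu> n)) x)" for n x
  proof (cases "x \<in> K")
    case True
    then show ?thesis
      using wd[OF \<nu>n0[of n] True] by (simp add: E_def grad_def sum_distrib_left mult_ac)
  qed (simp add: \<phi>(3))
  have lim_j: "(\<lambda>n. LINT x|lborel. (D\<Phi> (Gn (\<nu> n) x) $ j * \<phi> x) * conv (d j) (mol (\<nu> n)) x)
      \<longlonglongrightarrow> (LINT x|lborel. (D\<Phi> (G x) $ j * \<phi> x) * d j x)"
    and int_j: "integrable lborel (\<lambda>x. (D\<Phi> (Gn (\<nu> n) x) $ j * \<phi> x) * conv (d j) (mol (\<nu> n)) x)"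
      "integrable lborel (\<lambda>x. (D\<Phi> (G x) $ j * \<phi> x) * d j x)" for j n
  proof -
    have cd: "integrable lborel (conv (d j) (mol n))" for n
      using conv_integrable(1)[OF d[of j], of "inverse (real (Suc n))"] by (simp add: mol_def)
    have bd: "\<bar>D\<Phi> z $ j * \<phi> x\<bar> \<le> L * B'" for z x
      unfolding abs_mult
      by (intro mult_mono B' order_trans[OF component_le_norm_cart \<Phi>(2)] L0) auto
    have [measurable]: "conv (d j) (mol n) \<in> borel_measurable borel" for n
      using borel_measurable_integrable[OF cd] by simp
    show "(\<lambda>n. LINT x|lborel. (D\<Phi> (Gn (\<nu> n) x) $ j * \<phi> x) * conv (d j) (mol (\<nu> n)) x)
      \<longlonglongrightarrow> (LINT x|lborel. (D\<Phi> (G x) $ j * \<phi> x) * d j x)"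
    proof (rule bounded_AE_mult_L1_tendsto[OF _ _ bd _ cd d sub[OF conv_L1_tendsto[OF d]]])
      show "AE x in lborel. (\<lambda>n. D\<Phi> (Gn (\<nu> n) x) $ j * \<phi> x) \<longlonglongrightarrow> D\<Phi> (G x) $ j * \<phi> x"
        using ae
      proof eventually_elim
        case (elim x)
        have "isCont D\<Phi> (G x)"
          using C1_grad_continuous_grad[OF \<Phi>(1)] continuous_on_eq_continuous_at open_UNIV by blast
        from isCont_tendsto_compose[OF this elim]
        show ?case by (intro tendsto_intros tendsto_vec_nth)
      qed
    qed measurable
    have ib: "integrable lborel (\<lambda>x. b x * h x)"
      if "b \<in> borel_measurable borel" "\<And>x. \<bar>b x\<bar> \<le> L * B'" "integrable lborel h" for b h :: "real^'n \<Rightarrow> real"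
      by (rule Bochner_Integration.integrable_bound[of _ "\<lambda>x. L * B' * \<bar>h x\<bar>"])
         (use that borel_measurable_integrable[OF that(3)] L0 B'(1) in \<open>auto simp: abs_mult intro!: AE_I2 mult_right_mono\<close>)
    show "integrable lborel (\<lambda>x. (D\<Phi> (Gn (\<nu> n) x) $ j * \<phi> x) * conv (d j) (mol (\<nu> n)) x)"
      by (rule ib[OF _ bd cd]) measurable
    show "integrable lborel (\<lambda>x. (D\<Phi> (G x) $ j * \<phi> x) * d j x)"
      by (rule ib[OF _ bd d]) measurable
  qed
  have rhs: "(\<lambda>n. - (LINT x|lborel. E (\<nu> n) x $ i * \<phi> x)) \<longlonglongrightarrow> - (LINT x|lborel. (\<Sum>j\<in>UNIV. D\<Phi> (G x) $ j * d j x) * \<phi> x)"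
  proof (rule tendsto_minus)
    have "(LINT x|lborel. E (\<nu> n) x $ i * \<phi> x) = (\<Sum>j\<in>UNIV. LINT x|lborel. (D\<Phi> (Gn (\<nu> n) x) $ j * \<phi> x) * conv (d j) (mol (\<nu> n)) x)" for n
      unfolding E_eq using int_j(1) by (rule Bochner_Integration.integral_sum)
    moreover have "(LINT x|lborel. (\<Sum>j\<in>UNIV. D\<Phi> (G x) $ j * d j x) * \<phi> x) = (\<Sum>j\<in>UNIV. LINT x|lborel. (D\<Phi> (G x) $ j * \<phi> x) * d j x)"
    proof -
      have "(\<Sum>j\<in>UNIV. D\<Phi> (G x) $ j * d j x) * \<phi> x = (\<Sum>j\<in>UNIV. (D\<Phi> (G x) $ j * \<phi> x) * d j x)" for x
        by (simp add: sum_distrib_left mult_ac)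
      then show ?thesis using int_j(2) by (simp only: Bochner_Integration.integral_sum)
    qed
    ultimately show "(\<lambda>n. LINT x|lborel. E (\<nu> n) x $ i * \<phi> x) \<longlonglongrightarrow> (LINT x|lborel. (\<Sum>j\<in>UNIV. D\<Phi> (G x) $ j * d j x) * \<phi> x)"
      using tendsto_sum[of UNIV, OF lim_j] by simp
  qed
  \<comment> \<open>\<Phi> may be unbounded and \<Phi> (G) is not known to be integrable on the
    whole plane. Its Lipschitz bound makes the differences \<Phi> (Gn) - \<Phi> (G) integrable and
    small in L1, which is all that is needed.\<close>
  have dif_int: "integrable lborel (\<lambda>x. \<Phi> (Gn (\<nu> n) x) - \<Phi> (G x))" for n
  proof (rule Bochner_Integration.integrable_bound[of _ "\<lambda>x. L * e (\<nu> n) x"])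
    show "AE x in lborel. norm (\<Phi> (Gn (\<nu> n) x) - \<Phi> (G x)) \<le> norm (L * e (\<nu> n) x)"
    proof (rule AE_I2)
      fix x
      have "\<bar>\<Phi> (Gn (\<nu> n) x) - \<Phi> (G x)\<bar> \<le> L * e (\<nu> n) x"
        using C1_grad_lipschitz[OF \<Phi>] mult_left_mono[OF e_ge L0] order_trans by blast
      then show "norm (\<Phi> (Gn (\<nu> n) x) - \<Phi> (G x)) \<le> norm (L * e (\<nu> n) x)" by simp
    qed
  qed (use e_int in auto)
  have dif_L1: "(\<lambda>n. LINT x|lborel. \<bar>(\<Phi> (Gn (\<nu> n) x) - \<Phi> (G x)) - 0\<bar>) \<longlonglongrightarrow> 0"
  proof (rule tendsto_sandwich[OF _ _ tendsto_const])
    show "(\<lambda>n. L * (LINT x|lborel. e (\<nu> n) x)) \<longlonglongrightarrow> 0"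
      by (intro tendsto_mult_right_zero sub[OF e_L1])
    show "\<forall>\<^sub>F n in sequentially. (LINT x|lborel. \<bar>(\<Phi> (Gn (\<nu> n) x) - \<Phi> (G x)) - 0\<bar>) \<le> L * (LINT x|lborel. e (\<nu> n) x)"
    proof (rule always_eventually, rule allI)
      fix n
      have "(LINT x|lborel. \<bar>(\<Phi> (Gn (\<nu> n) x) - \<Phi> (G x)) - 0\<bar>) \<le> (LINT x|lborel. L * e (\<nu> n) x)"
      proof (rule integral_mono)
        show "\<bar>(\<Phi> (Gn (\<nu> n) x) - \<Phi> (G x)) - 0\<bar> \<le> L * e (\<nu> n) x" for x
          using C1_grad_lipschitz[OF \<Phi>, of "Gn (\<nu> n) x" "G x"] mult_left_mono[OF e_ge[of "\<nu> n" x] L0] by simp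
      qed (use dif_int[of n] e_int in auto)
      then show "(LINT x|lborel. \<bar>(\<Phi> (Gn (\<nu> n) x) - \<Phi> (G x)) - 0\<bar>) \<le> L * (LINT x|lborel. e (\<nu> n) x)" by simp
    qed
  qed auto
  have l0: "(\<lambda>n. LINT x|lborel. D\<phi> x $ i * (\<Phi> (Gn (\<nu> n) x) - \<Phi> (G x))) \<longlonglongrightarrow> (LINT x|lborel. D\<phi> x $ i * 0)"
    by (rule bounded_AE_mult_L1_tendsto[OF _ _ B(2) _ dif_int _ dif_L1]) auto
  have iG: "integrable lborel (\<lambda>x. \<Phi> (G x) * D\<phi> x $ i)"
  proof -
    have [measurable]: "K \<in> sets borel" using \<phi>(2) by (intro borel_closed compact_imp_closed)
    have iK: "integrable lborel (indicator K :: real^'n \<Rightarrow> real)"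
      using emeasure_compact_finite[OF \<phi>(2)] by (simp add: integrable_indicator_iff less_top)
    show ?thesis
    proof (rule Bochner_Integration.integrable_bound[of _ "\<lambda>x. B * (\<bar>\<Phi> 0\<bar> * indicator K x + L * (\<bar>G x $ 1\<bar> + \<bar>G x $ 2\<bar>))"])
      show "AE x in lborel. norm (\<Phi> (G x) * D\<phi> x $ i) \<le> norm (B * (\<bar>\<Phi> 0\<bar> * indicator K x + L * (\<bar>G x $ 1\<bar> + \<bar>G x $ 2\<bar>)))"
      proof (rule AE_I2)
        fix x
        show "norm (\<Phi> (G x) * D\<phi> x $ i) \<le> norm (B * (\<bar>\<Phi> 0\<bar> * indicator K x + L * (\<bar>G x $ 1\<bar> + \<bar>G x $ 2\<bar>)))"
        proof (cases "x \<in> K")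
          case True
          have "\<bar>\<Phi> (G x) - \<Phi> 0\<bar> \<le> L * norm (G x)" using C1_grad_lipschitz[OF \<Phi>, of "G x" 0] by simp
          also have "\<dots> \<le> L * (\<bar>G x $ 1\<bar> + \<bar>G x $ 2\<bar>)"
            using norm_le_l1_cart[of "G x"] by (intro mult_left_mono L0) (simp add: UNIV_2)
          finally have "\<bar>\<Phi> (G x)\<bar> \<le> \<bar>\<Phi> 0\<bar> + L * (\<bar>G x $ 1\<bar> + \<bar>G x $ 2\<bar>)" by linarith
          then have "\<bar>\<Phi> (G x)\<bar> * \<bar>D\<phi> x $ i\<bar> \<le> (\<bar>\<Phi> 0\<bar> + L * (\<bar>G x $ 1\<bar> + \<bar>G x $ 2\<bar>)) * B"
            using B(2)[of x] by (intro mult_mono) auto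
          also have "\<dots> = norm (B * (\<bar>\<Phi> 0\<bar> * indicator K x + L * (\<bar>G x $ 1\<bar> + \<bar>G x $ 2\<bar>)))"
            using True B(1) L0 by (simp add: abs_mult mult.commute)
          finally show ?thesis by (simp add: abs_mult)
        qed (simp add: D0)
      qed
    qed (use iK G in auto)
  qed
  have iD: "integrable lborel (\<lambda>x. D\<phi> x $ i * (\<Phi> (Gn (\<nu> n) x) - \<Phi> (G x)))" for n
    by (rule Bochner_Integration.integrable_bound[of _ "\<lambda>x. B * \<bar>\<Phi> (Gn (\<nu> n) x) - \<Phi> (G x)\<bar>"])
       (use dif_int[of n] B in \<open>auto simp: abs_mult intro!: AE_I2 mult_right_mono\<close>)
  have "(LINT x|lborel. \<Phi> (Gn (\<nu> n) x) * D\<phi> x $ i) =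
    (LINT x|lborel. D\<phi> x $ i * (\<Phi> (Gn (\<nu> n) x) - \<Phi> (G x))) + (LINT x|lborel. \<Phi> (G x) * D\<phi> x $ i)" for n
    using iD[of n] iG by (subst Bochner_Integration.integral_add[symmetric]) (auto simp: algebra_simps)
  then have lhs: "(\<lambda>n. LINT x|lborel. \<Phi> (Gn (\<nu> n) x) * D\<phi> x $ i) \<longlonglongrightarrow> (LINT x|lborel. \<Phi> (G x) * D\<phi> x $ i)"
    using tendsto_add[OF l0 tendsto_const[of "LINT x|lborel. \<Phi> (G x) * D\<phi> x $ i"]] by simp
  show ?thesis
    by (rule LIMSEQ_unique[OF lhs]) (use rhs parts in simp)
qed

section \<open>Limits of truncations, and cut-off flux components\<close>

lemma max_square_has_derivative: "((\<lambda>s. (max 0 s)\<^sup>2) has_real_derivative 2 * max 0 s) (at (s :: real))"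
proof -
  consider "s > 0" | "s < 0" | "s = 0" by linarith
  then show ?thesis
  proof cases
    case 1
    have "((\<lambda>s. s\<^sup>2) has_real_derivative 2 * max 0 s) (at s)" using 1 by (auto intro!: derivative_eq_intros)
    then show ?thesis
      by (rule has_field_derivative_transform_within_open[of _ _ _ "{0<..}"]) (use 1 in auto)
  next
    case 2
    have "((\<lambda>_. 0) has_real_derivative 0) (at s)" by simp
    then have "((\<lambda>s. (max 0 s)\<^sup>2) has_real_derivative 0) (at s)"
      by (rule has_field_derivative_transform_within_open[of _ _ _ "{..<0}"]) (use 2 in auto)
    then show ?thesis using 2 by simp
  next
    case 3
    have "((\<lambda>h. ((max 0 (0 + h))\<^sup>2 - (max 0 (0::real))\<^sup>2) / h) \<longlongrightarrow> 0) (at 0)"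
    proof (rule Lim_null_comparison)
      show "\<forall>\<^sub>F h in at 0. norm (((max 0 (0 + h))\<^sup>2 - (max 0 (0::real))\<^sup>2) / h) \<le> \<bar>h\<bar>"
        unfolding eventually_at by (rule exI[of _ 1]) (auto simp: max_def power2_eq_square)
      show "((\<lambda>h::real. \<bar>h\<bar>) \<longlongrightarrow> 0) (at 0)" by (intro tendsto_rabs_zero tendsto_ident_at)
    qed
    then have "((\<lambda>s. (max 0 s)\<^sup>2) has_real_derivative 0) (at (0::real))" unfolding DERIV_def .
    then show ?thesis using 3 by simp
  qed
qed

text \<open>As \<open>ramp'\<close> is 0 at 0, the limiting slope is the indicator of the strict
  inequality t > 0. The gradient of a positive part thereby comes out as 0 on the critical level set
  without a separate argument.\<close>

lemma ramp_tendsto: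
  "(\<lambda>m. ramp (inverse (real (Suc m))) t) \<longlonglongrightarrow> max 0 t"
  "(\<lambda>m. ramp' (inverse (real (Suc m))) t) \<longlonglongrightarrow> (if t > 0 then 1 else 0)"
proof -
  have "(\<lambda>m. ramp (inverse (real (Suc m))) t) \<longlonglongrightarrow> max 0 t \<and>
    (\<lambda>m. ramp' (inverse (real (Suc m))) t) \<longlonglongrightarrow> (if t > 0 then 1 else 0)"
  proof (cases "t > 0")
    case True
    have "(\<lambda>m. t\<^sup>2 / (t + inverse (real (Suc m)))) \<longlonglongrightarrow> t\<^sup>2 / (t + 0)"
      by (intro tendsto_intros LIMSEQ_inverse_real_of_nat) (use True in simp)
    moreover have "(\<lambda>m. t * (t + 2 * inverse (real (Suc m))) / (t + inverse (real (Suc m)))\<^sup>2) \<longlonglongrightarrow> t * (t + 2 * 0) / (t + 0)\<^sup>2"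
      by (intro tendsto_intros LIMSEQ_inverse_real_of_nat) (use True in simp)
    ultimately show ?thesis using True by (simp add: ramp_def ramp'_def power2_eq_square)
  qed simp
  then show "(\<lambda>m. ramp (inverse (real (Suc m))) t) \<longlonglongrightarrow> max 0 t"
    "(\<lambda>m. ramp' (inverse (real (Suc m))) t) \<longlonglongrightarrow> (if t > 0 then 1 else 0)" by auto
qed

text \<open>The components of \<open>F\<close> are cutoff off where \<open>|F z|\<^sup>2 + |z|\<^sup>2\<close> is large. With this choice the
  derivative of the cutoff factor costs no more than \<open>|DF|\<close>, which is bounded along the solution,
  although \<open>DF\<close> itself may be unbounded.\<close>

definition cutoff_level :: "(real^2 \<Rightarrow> real^2) \<Rightarrow> real \<Rightarrow> real^2 \<Rightarrow> real" where
  "cutoff_level F m z = (F z \<bullet> F z + z \<bullet> z) / m"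

definition cutoff :: "(real^2 \<Rightarrow> real^2) \<Rightarrow> real \<Rightarrow> 2 \<Rightarrow> real^2 \<Rightarrow> real" where
  "cutoff F m j z = (max 0 (1 - cutoff_level F m z))\<^sup>2 * F z $ j"

definition cutoff_grad :: "(real^2 \<Rightarrow> real^2) \<Rightarrow> (real^2 \<Rightarrow> real^2^2) \<Rightarrow> real \<Rightarrow> 2 \<Rightarrow> real^2 \<Rightarrow> real^2" where
  "cutoff_grad F A m j z = (max 0 (1 - cutoff_level F m z))\<^sup>2 *\<^sub>R A z $ j
     - (F z $ j * (2 * max 0 (1 - cutoff_level F m z)) * (2 / m)) *\<^sub>R (F z $ 1 *\<^sub>R A z $ 1 + F z $ 2 *\<^sub>R A z $ 2 + z)"

context
  fixes F :: "real^2 \<Rightarrow> real^2" and A :: "real^2 \<Rightarrow> real^2^2"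
  assumes F: "\<And>z. (F has_derivative (\<lambda>h. A z *v h)) (at z)" and A: "continuous_on UNIV A"
begin

lemma component_C1_grad: "C1_grad (\<lambda>z. F z $ j) (\<lambda>z. A z $ j)"
  unfolding C1_grad_def
proof (intro conjI allI)
  show "((\<lambda>z. F z $ j) has_derivative (\<lambda>h. A z $ j \<bullet> h)) (at z)" for z
    using bounded_linear.has_derivative[OF bounded_linear_vec_nth[of j] F[of z]]
    by (simp add: matrix_vector_mult_def inner_vec_def)
  show "continuous_on UNIV (\<lambda>z. A z $ j)" by (intro continuous_on_component A)
qed

lemma cutoff_level_C1_grad:
  assumes "m > 0"
  shows "C1_grad (cutoff_level F m) (\<lambda>z. (2 / m) *\<^sub>R (F z $ 1 *\<^sub>R A z $ 1 + F z $ 2 *\<^sub>R A z $ 2 + z))"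
proof -
  have z: "C1_grad (\<lambda>z::real^2. z $ i) (\<lambda>z. axis i 1)" for i
  proof -
    have "(\<lambda>h::real^2. axis i 1 \<bullet> h) = (\<lambda>h. h $ i)" by (simp add: fun_eq_iff inner_axis')
    then show ?thesis
      unfolding C1_grad_def by (simp add: bounded_linear_imp_has_derivative bounded_linear_vec_nth)
  qed
  note c = C1_grad_cmult[OF C1_grad_add[OF C1_grad_add[OF C1_grad_mult[OF component_C1_grad[of 1] component_C1_grad[of 1]]
      C1_grad_mult[OF component_C1_grad[of 2] component_C1_grad[of 2]]]
      C1_grad_add[OF C1_grad_mult[OF z[of 1] z[of 1]] C1_grad_mult[OF z[of 2] z[of 2]]]], of "1 / m"]
  have "(\<lambda>x. (1 / m) * (F x $ 1 * F x $ 1 + F x $ 2 * F x $ 2 + (x $ 1 * x $ 1 + x $ 2 * x $ 2))) = cutoff_level F m"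
    by (auto simp: cutoff_level_def inner_vec_def UNIV_2)
  moreover have "(1 / m) *\<^sub>R (F x $ 1 *\<^sub>R A x $ 1 + F x $ 1 *\<^sub>R A x $ 1 + (F x $ 2 *\<^sub>R A x $ 2 + F x $ 2 *\<^sub>R A x $ 2) +
      (x $ 1 *\<^sub>R axis 1 1 + x $ 1 *\<^sub>R axis 1 1 + (x $ 2 *\<^sub>R axis 2 1 + x $ 2 *\<^sub>R axis 2 1)))
    = (2 / m) *\<^sub>R (F x $ 1 *\<^sub>R A x $ 1 + F x $ 2 *\<^sub>R A x $ 2 + x)" for x :: "real^2"
    by (simp add: vec_eq_iff forall_2 axis_def add_divide_distrib[symmetric])
  ultimately show ?thesis using c by simp
qed

lemma cutoff_C1_grad:
  assumes "m > 0" shows "C1_grad (cutoff F m j) (cutoff_grad F A m j)"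
proof -
  \<comment> \<open>Squaring the positive part removes its kink at t = 1, so the cutoff factor has a
    continuous derivative.\<close>
  have "((\<lambda>t. (max 0 (1 - t))\<^sup>2) has_real_derivative - (2 * max 0 (1 - t))) (at t)" for t :: real
  proof -
    have "((\<lambda>t. 1 - t) has_real_derivative - 1) (at t)" by (auto intro!: derivative_eq_intros)
    from DERIV_chain2[OF max_square_has_derivative this] show ?thesis by simp
  qed
  then have "C1_grad (\<lambda>z. (max 0 (1 - cutoff_level F m z))\<^sup>2)
     (\<lambda>z. (- (2 * max 0 (1 - cutoff_level F m z))) *\<^sub>R ((2 / m) *\<^sub>R (F z $ 1 *\<^sub>R A z $ 1 + F z $ 2 *\<^sub>R A z $ 2 + z)))"
    by (rule C1_grad_compose[OF cutoff_level_C1_grad[OF assms]]) (intro continuous_intros)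
  from C1_grad_mult[OF this component_C1_grad[of j]] show ?thesis
    unfolding cutoff_def[abs_def] cutoff_grad_def[abs_def]
    by (simp add: mult_ac)
qed

text \<open>The summand |z|^2 in the cutoff level forces compact support, which bounds the gradient
  for each fixed m. This bound may grow with m; it is there to make the chain rule
  applicable.\<close>

lemma cutoff_grad_bounded:
  assumes "m > 0" shows "\<exists>L\<ge>0. \<forall>z. norm (cutoff_grad F A m j z) \<le> L"
proof (rule continuous_compact_support_bounded[OF C1_grad_continuous_grad[OF cutoff_C1_grad[OF assms]] compact_cball[of 0 "sqrt m"]])
  fix z :: "real^2" assume "z \<notin> cball 0 (sqrt m)"
  then have "sqrt m < norm z" by simp
  then have "(sqrt m)\<^sup>2 < (norm z)\<^sup>2" using assms by (intro power_strict_mono) auto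
  then have "m < z \<bullet> z" using assms by (simp add: power2_norm_eq_inner)
  then have "m \<le> F z \<bullet> F z + z \<bullet> z" using inner_ge_zero[of "F z"] by linarith
  then have "1 \<le> cutoff_level F m z" using assms by (simp add: cutoff_level_def)
  then show "cutoff_grad F A m j z = 0" by (simp add: cutoff_grad_def)
qed

text \<open>The bound that does not depend on m. Where the cutoff is positive, |F|^2 and |F| |z| are
  at most m, which cancels the 1 / m from the derivative of the cutoff level. Only the rows of A at
  the same point z enter, so a bound along the solution is enough.\<close>

lemma norm_cutoff_grad_le:
  assumes m: "m > 0" and L: "\<And>l. norm (A z $ l) \<le> \<Lambda>"
  shows "norm (cutoff_grad F A m j z) \<le> \<Lambda> + 4 * (2 * \<Lambda> + 1)"
proof (cases "cutoff_level F m z < 1")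
  case False
  have "\<Lambda> \<ge> 0" using L[of 1] norm_ge_zero order_trans by blast
  then show ?thesis using False by (simp add: cutoff_grad_def)
next
  case True
  have L0: "\<Lambda> \<ge> 0" using L[of 1] norm_ge_zero order_trans by blast
  define q where "q = max 0 (1 - cutoff_level F m z)"
  have q: "0 \<le> q" "q \<le> 1" using m by (auto simp: q_def cutoff_level_def)
  have Fm: "(norm (F z))\<^sup>2 + (norm z)\<^sup>2 < m" using True m by (simp add: cutoff_level_def power2_norm_eq_inner)
  have FF: "norm (F z) * norm (F z) \<le> m" using Fm zero_le_power2[of "norm z"] unfolding power2_eq_square[of "norm (F z)"] by linarith
  have Fz: "norm (F z) * norm z \<le> m" using Fm sum_squares_bound[of "norm (F z)" "norm z"]
    mult_nonneg_nonneg[OF norm_ge_zero[of "F z"] norm_ge_zero[of z]] by linarith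
  have v: "norm (F z $ 1 *\<^sub>R A z $ 1 + F z $ 2 *\<^sub>R A z $ 2 + z) \<le> norm (F z) * \<Lambda> + norm (F z) * \<Lambda> + norm z"
    by (intro order_trans[OF norm_triangle_ineq] add_mono)
       (auto intro!: mult_mono L component_le_norm_cart)
  have "norm (F z $ j) * norm (F z $ 1 *\<^sub>R A z $ 1 + F z $ 2 *\<^sub>R A z $ 2 + z)
    \<le> norm (F z) * (norm (F z) * \<Lambda> + norm (F z) * \<Lambda> + norm z)"
    by (rule mult_mono[OF _ v]) (auto simp: component_le_norm_cart)
  also have "\<dots> = (norm (F z) * norm (F z)) * \<Lambda> + (norm (F z) * norm (F z)) * \<Lambda> + norm (F z) * norm z"
    by (simp add: algebra_simps)
  also have "\<dots> \<le> m * \<Lambda> + m * \<Lambda> + m"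
    by (intro add_mono mult_right_mono FF Fz L0)
  finally have b: "\<bar>F z $ j\<bar> * norm (F z $ 1 *\<^sub>R A z $ 1 + F z $ 2 *\<^sub>R A z $ 2 + z) \<le> m * (2 * \<Lambda> + 1)"
    by (simp add: algebra_simps)
  have t0: "norm (cutoff_grad F A m j z) \<le> norm (q\<^sup>2 *\<^sub>R A z $ j) +
     norm ((F z $ j * (2 * q) * (2 / m)) *\<^sub>R (F z $ 1 *\<^sub>R A z $ 1 + F z $ 2 *\<^sub>R A z $ 2 + z))"
    unfolding cutoff_grad_def q_def[symmetric] by (rule norm_triangle_ineq4)
  have "q\<^sup>2 \<le> 1" using q by (intro power_le_one)
  then have "q\<^sup>2 * norm (A z $ j) \<le> 1 * \<Lambda>" by (intro mult_mono L) auto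
  then have t1: "norm (q\<^sup>2 *\<^sub>R A z $ j) \<le> \<Lambda>" by simp
  have "norm ((F z $ j * (2 * q) * (2 / m)) *\<^sub>R (F z $ 1 *\<^sub>R A z $ 1 + F z $ 2 *\<^sub>R A z $ 2 + z))
     = (4 / m) * q * (\<bar>F z $ j\<bar> * norm (F z $ 1 *\<^sub>R A z $ 1 + F z $ 2 *\<^sub>R A z $ 2 + z))"
    using q(1) m unfolding norm_scaleR abs_mult by simp
  also have "\<dots> \<le> (4 / m) * 1 * (m * (2 * \<Lambda> + 1))"
    by (rule mult_mono[OF mult_left_mono[OF q(2)] b]) (use q(1) m in auto)
  also have "\<dots> = 4 * (2 * \<Lambda> + 1)" using m by simp
  finally show ?thesis using t0 t1 by linarith
qed

lemma cutoff_tendsto: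
  "(\<lambda>m. cutoff F (real (Suc m)) j z) \<longlonglongrightarrow> F z $ j"
  "(\<lambda>m. cutoff_grad F A (real (Suc m)) j z $ i) \<longlonglongrightarrow> A z $ j $ i"
proof -
  have "(\<lambda>m. (F z \<bullet> F z + z \<bullet> z) * inverse (real (Suc m))) \<longlonglongrightarrow> (F z \<bullet> F z + z \<bullet> z) * 0"
    by (intro tendsto_intros LIMSEQ_inverse_real_of_nat)
  then have l: "(\<lambda>m. cutoff_level F (real (Suc m)) z) \<longlonglongrightarrow> 0"
    by (simp add: cutoff_level_def divide_inverse)
  have x: "(\<lambda>m. max 0 (1 - cutoff_level F (real (Suc m)) z)) \<longlonglongrightarrow> max 0 (1 - 0)"
    by (intro tendsto_intros l)
  have "(\<lambda>m. (max 0 (1 - cutoff_level F (real (Suc m)) z))\<^sup>2 * F z $ j) \<longlonglongrightarrow> (max 0 (1 - 0))\<^sup>2 * F z $ j"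
    by (intro tendsto_intros x)
  then show "(\<lambda>m. cutoff F (real (Suc m)) j z) \<longlonglongrightarrow> F z $ j" by (simp add: cutoff_def)
  have "(\<lambda>m. (max 0 (1 - cutoff_level F (real (Suc m)) z))\<^sup>2 * A z $ j $ i
     - (F z $ j * (2 * max 0 (1 - cutoff_level F (real (Suc m)) z)) * (2 * inverse (real (Suc m)))) * (F z $ 1 *\<^sub>R A z $ 1 + F z $ 2 *\<^sub>R A z $ 2 + z) $ i)
    \<longlonglongrightarrow> (max 0 (1 - 0))\<^sup>2 * A z $ j $ i - (F z $ j * (2 * max 0 (1 - 0)) * (2 * 0)) * (F z $ 1 *\<^sub>R A z $ 1 + F z $ 2 *\<^sub>R A z $ 2 + z) $ i"
    by (intro tendsto_intros x LIMSEQ_inverse_real_of_nat)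
  then show "(\<lambda>m. cutoff_grad F A (real (Suc m)) j z $ i) \<longlonglongrightarrow> A z $ j $ i"
    by (simp add: cutoff_grad_def divide_inverse)
qed

lemma abs_cutoff_le: "m > 0 \<Longrightarrow> \<bar>cutoff F m j z\<bar> \<le> \<bar>F z $ j\<bar>"
proof -
  assume m: "m > 0"
  have "0 \<le> max 0 (1 - cutoff_level F m z)" "max 0 (1 - cutoff_level F m z) \<le> 1" using m by (auto simp: cutoff_level_def)
  then have "(max 0 (1 - cutoff_level F m z))\<^sup>2 \<le> 1" by (rule power_le_one)
  then show ?thesis by (simp add: cutoff_def abs_mult mult_left_le_one_le)
qed

end

subsection \<open>The differentiated equation\<close>

lemma conv_cong_AE:
  assumes g: "AE y in lborel. y \<in> cball x r \<longrightarrow> g y = h y" and k: "kernel r k"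
    and m: "g \<in> borel_measurable borel" "h \<in> borel_measurable borel"
  shows "conv g k x = conv h k x"
  unfolding conv_def
proof (rule integral_cong_AE)
  have [measurable]: "k \<in> borel_measurable borel" by (rule kernel_measurable[OF k])
  note [measurable] = m
  show "(\<lambda>y. g y * k (x - y)) \<in> borel_measurable lborel" "(\<lambda>y. h y * k (x - y)) \<in> borel_measurable lborel" by measurable
  show "AE y in lborel. g y * k (x - y) = h y * k (x - y)"
    using g
  proof eventually_elim
    case (elim y)
    then show ?case using k by (cases "y \<in> cball x r") (auto simp: kernel_def dist_norm)
  qed
qed

text \<open>Globally integrable representatives on one closed square: G stands for \<nabla>u,
  \<open>D j\<close> for the weak gradient of its component j, F for the flux and A for its
  Jacobian. Every weak identity is stored as an identity between convolutions with kernels whose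
  ball fits in the square. Since partial derivatives of kernels are kernels, such identities can be
  differentiated again by inserting a derivative of the mollifier.\<close>

locale solution_data =
  fixes p :: "real^2" and R' :: real and u f w :: "real^2 \<Rightarrow> real" and G W :: "real^2 \<Rightarrow> real^2"
    and D :: "2 \<Rightarrow> real^2 \<Rightarrow> real^2" and F :: "real^2 \<Rightarrow> real^2" and A :: "real^2 \<Rightarrow> real^2^2"
    and \<delta> c \<epsilon> \<Lambda> N :: real
  assumes c: "c > 0" and \<epsilon>: "\<epsilon> > 0" and \<Lambda>: "\<Lambda> \<ge> 0"
    and u: "integrable lborel u"
    and G: "\<And>j. integrable lborel (\<lambda>x. G x $ j)"
    and D: "\<And>j i. integrable lborel (\<lambda>x. D j x $ i)" "\<And>j i. integrable lborel (\<lambda>x. (D j x $ i)\<^sup>2)"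
    and F: "\<And>z. (F has_derivative (\<lambda>h. A z *v h)) (at z)" "continuous_on UNIV A"
    and P: "\<And>j. integrable lborel (\<lambda>x. indicator (csquare p R') x * F (G x) $ j)"
    and A_bounded: "AE x in lborel. x \<in> csquare p R' \<longrightarrow> (\<forall>j. norm (A (G x) $ j) \<le> \<Lambda>)"
    and A_elliptic: "\<And>z \<xi>. norm z \<ge> 1 + \<delta> \<Longrightarrow> c * (norm \<xi>)\<^sup>2 \<le> \<xi> \<bullet> (A z *v \<xi>)"
    and f: "integrable lborel f" "integrable lborel (\<lambda>x. (f x)\<^sup>2)"
      "integrable lborel (\<lambda>x. \<bar>f x\<bar> powr (2 + \<epsilon>))" "(LINT x|lborel. \<bar>f x\<bar> powr (2 + \<epsilon>)) \<le> N"
    and w: "integrable lborel w" "AE x in lborel. x \<in> csquare p R' \<longrightarrow> w x = max 0 (G x $ 1 - (1 + \<delta>))"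
    and W: "\<And>i. integrable lborel (\<lambda>x. W x $ i)" "\<And>i. integrable lborel (\<lambda>x. (W x $ i)\<^sup>2)"
    and grad_u: "\<And>r k x i. kernel r k \<Longrightarrow> cball x r \<subseteq> csquare p R' \<Longrightarrow> conv u (partial i k) x = conv (\<lambda>y. G y $ i) k x"
    and grad_G: "\<And>r k x i j. kernel r k \<Longrightarrow> cball x r \<subseteq> csquare p R' \<Longrightarrow> conv (\<lambda>y. G y $ j) (partial i k) x = conv (\<lambda>y. D j y $ i) k x"
    and grad_w: "\<And>r k x i. kernel r k \<Longrightarrow> cball x r \<subseteq> csquare p R' \<Longrightarrow> conv w (partial i k) x = conv (\<lambda>y. W y $ i) k x"
    and equation: "\<And>r k x. kernel r k \<Longrightarrow> cball x r \<subseteq> csquare p R' \<Longrightarrow>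
      (\<Sum>j\<in>UNIV. conv (\<lambda>y. indicator (csquare p R') y * F (G y) $ j) (partial j k) x) = conv f k x"
begin

lemma meas [measurable]:
  "u \<in> borel_measurable borel" "f \<in> borel_measurable borel" "w \<in> borel_measurable borel"
  "G \<in> borel_measurable borel" "(\<lambda>x. G x $ j) \<in> borel_measurable borel"
  "D i \<in> borel_measurable borel" "(\<lambda>x. D i x $ j) \<in> borel_measurable borel"
  "(\<lambda>x. W x $ j) \<in> borel_measurable borel"
  "F \<in> borel_measurable borel" "A \<in> borel_measurable borel" "(\<lambda>z. A z $ j) \<in> borel_measurable borel"
  "(\<lambda>x. F (G x) $ j) \<in> borel_measurable borel" "(\<lambda>x. A (G x) $ j) \<in> borel_measurable borel"
proof -
  show "u \<in> borel_measurable borel" "f \<in> borel_measurable borel" "w \<in> borel_measurable borel"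
    "(\<lambda>x. W x $ j) \<in> borel_measurable borel"
    using borel_measurable_integrable[OF u] borel_measurable_integrable[OF f(1)] borel_measurable_integrable[OF w(1)]
      borel_measurable_integrable[OF W(1)] by auto
  show Gj: "(\<lambda>x. G x $ j) \<in> borel_measurable borel" for j
    using borel_measurable_integrable[OF G] by simp
  show Dj: "(\<lambda>x. D i x $ j) \<in> borel_measurable borel" for i j
    using borel_measurable_integrable[OF D(1)] by simp
  show Gm: "G \<in> borel_measurable borel"
    by (subst borel_measurable_euclidean_space) (auto simp: Basis_vec_def inner_axis Gj)
  show "D i \<in> borel_measurable borel"
    by (subst borel_measurable_euclidean_space) (auto simp: Basis_vec_def inner_axis Dj)
  have Fc: "continuous_on UNIV F"
    using F(1) by (meson continuous_at_imp_continuous_on has_derivative_continuous)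
  then show "F \<in> borel_measurable borel" by (rule borel_measurable_continuous_onI)
  have "(\<lambda>z. F z $ j) \<in> borel_measurable borel" for j
    by (intro borel_measurable_continuous_onI continuous_on_component Fc)
  from measurable_compose[OF Gm this] show "(\<lambda>x. F (G x) $ j) \<in> borel_measurable borel" .
  show "A \<in> borel_measurable borel" by (rule borel_measurable_continuous_onI[OF F(2)])
  show Aj: "(\<lambda>z. A z $ j) \<in> borel_measurable borel" for j
    by (intro borel_measurable_continuous_onI continuous_on_component F)
  from measurable_compose[OF Gm this] show "(\<lambda>x. A (G x) $ j) \<in> borel_measurable borel" .
qed

lemma inside:
  assumes "x \<in> osquare p R'"
  shows "\<exists>n0. \<forall>n\<ge>n0. cball x (inverse (real (Suc n))) \<subseteq> osquare p R'"
  using eventually_cball_mol_subset[OF compact_sing open_osquare, of x p R'] assms by auto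

lemma osquare_subset: "S \<subseteq> osquare p R' \<Longrightarrow> S \<subseteq> csquare p R'"
  using osquare_subset_csquare[of R' R' p] by blast

text \<open>Mollifying either mixed derivative gives u convolved with a mixed second partial
  derivative of the mollifier, and those commute; uniqueness of weak derivatives does the
  rest.\<close>

lemma D_symmetric: "AE x in lborel. x \<in> osquare p R' \<longrightarrow> D 1 x $ 2 = D 2 x $ 1"
proof -
  have "AE x in lborel. x \<in> osquare p R' \<longrightarrow> D 1 x $ 2 - D 2 x $ 1 = 0"
  proof (rule AE_eq_0_of_conv_eq_0)
    show "integrable lborel (\<lambda>x. D 1 x $ 2 - D 2 x $ 1)" using D by auto
    fix x assume "x \<in> osquare p R'"
    then obtain n0 where n0: "\<And>n. n \<ge> n0 \<Longrightarrow> cball x (inverse (real (Suc n))) \<subseteq> osquare p R'" using inside by blast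
    have "conv (\<lambda>x. D 1 x $ 2 - D 2 x $ 1) (mol n) x = 0" if "n \<ge> n0" for n
    proof -
      note s = osquare_subset[OF n0[OF that]]
      note k = kernel_mol[of n]
      have comm: "partial 1 (partial 2 (mol n)) = partial 2 (partial 1 (mol n :: real^2 \<Rightarrow> real))"
        unfolding mol_def by (rule ext) (rule partial_partial_mollifier_commute)
      have "conv (\<lambda>y. D 1 y $ 2) (mol n) x = conv u (partial 1 (partial 2 (mol n))) x"
        using grad_G[OF k s, of 1 2] grad_u[OF kernel_partial[OF k] s, of 1 2] by simp
      moreover have "conv (\<lambda>y. D 2 y $ 1) (mol n) x = conv u (partial 2 (partial 1 (mol n))) x"
        using grad_G[OF k s, of 2 1] grad_u[OF kernel_partial[OF k] s, of 2 1] by simp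
      ultimately show ?thesis
        using conv_diff[OF D(1) D(1) k, of 1 2 2 1] by (simp add: comm)
    qed
    then show "\<exists>n0. \<forall>n\<ge>n0. conv (\<lambda>x. D 1 x $ 2 - D 2 x $ 1) (mol n) x = 0" by blast
  qed
  then show ?thesis by (rule eventually_mono) auto
qed

text \<open>The test function is y \<mapsto> k (x - y). The sign from the reflection cancels the one
  from integration by parts, which leaves an identity in the convolution format of the
  locale.\<close>

lemma chain_kernel:
  assumes \<Phi>: "C1_grad \<Phi> D\<Phi>" "\<And>z. norm (D\<Phi> z) \<le> L" and k: "kernel r k" and x: "cball x r \<subseteq> osquare p R'"
  shows "(LINT y|lborel. \<Phi> (G y) * partial i k (x - y)) = (LINT y|lborel. (\<Sum>j\<in>UNIV. D\<Phi> (G y) $ j * D j y $ i) * k (x - y))"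
proof -
  obtain n0 where n0: "\<And>n y. n \<ge> n0 \<Longrightarrow> y \<in> cball x r \<Longrightarrow> cball y (inverse (real (Suc n))) \<subseteq> osquare p R'"
    using eventually_cball_mol_subset[OF compact_cball open_osquare x] by blast
  have sk: "smooth k" using k by (simp add: kernel_def)
  have \<phi>: "C1_grad (\<lambda>y. k (x - y)) (\<lambda>y. - grad k (x - y))"
    unfolding C1_grad_def
  proof (intro conjI allI)
    fix y
    have "((\<lambda>y. x - y) has_derivative (\<lambda>h. - h)) (at y)" by (auto intro!: derivative_eq_intros)
    from has_derivative_compose[OF this C1_gradD[OF smooth_C1_grad[OF sk]]]
    show "((\<lambda>y. k (x - y)) has_derivative (\<lambda>h. - grad k (x - y) \<bullet> h)) (at y)" by simp
    show "continuous_on UNIV (\<lambda>y. - grad k (x - y))"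
      by (intro continuous_intros continuous_on_compose2[OF C1_grad_continuous_grad[OF smooth_C1_grad[OF sk], of UNIV]]) auto
  qed
  have "(LINT y|lborel. \<Phi> (G y) * (- grad k (x - y)) $ i) = - (LINT y|lborel. (\<Sum>j\<in>UNIV. D\<Phi> (G y) $ j * D j y $ i) * k (x - y))"
  proof (rule weak_chain_rule[where K="cball x r", OF G D(1) _ \<Phi> \<phi> compact_cball])
    show "partial i (conv (\<lambda>y. G y $ j) (mol n)) y = conv (\<lambda>x. D j x $ i) (mol n) y"
      if "n0 \<le> n" "y \<in> cball x r" for n y j
      unfolding partial_conv[OF G kernel_mol]
      by (rule grad_G[OF kernel_mol osquare_subset[OF n0[OF that]]])
    show "k (x - y) = 0" if "y \<notin> cball x r" for y
      using k that by (auto simp: kernel_def dist_norm)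
  qed
  then show ?thesis by (simp add: grad_def)
qed

lemma kernel_dominated:
  assumes k: "kernel r k" and h: "\<And>m. h m \<in> borel_measurable borel" "g \<in> borel_measurable borel"
    and lim: "AE y in lborel. y \<in> cball x r \<longrightarrow> (\<lambda>m. h m y) \<longlonglongrightarrow> g y"
    and b: "integrable lborel b" "\<And>m::nat. AE y in lborel. y \<in> cball x r \<longrightarrow> \<bar>h m y\<bar> \<le> b y"
  shows "(\<lambda>m. LINT y|lborel. h m y * k (x - y)) \<longlonglongrightarrow> (LINT y|lborel. g y * k (x - y))"
proof -
  obtain B where B: "B \<ge> 0" "\<And>z. \<bar>k z\<bar> \<le> B" using kernel_bounded[OF k] by blast
  note [measurable] = kernel_measurable[OF k] h
  have z: "k (x - y) = 0" if "y \<notin> cball x r" for y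
    using k that by (auto simp: kernel_def dist_norm)
  show ?thesis
  proof (rule integral_dominated_convergence[where w="\<lambda>y. \<bar>b y\<bar> * B"])
    show "integrable lborel (\<lambda>y. \<bar>b y\<bar> * B)" using b(1) by simp
    show "AE y in lborel. (\<lambda>m. h m y * k (x - y)) \<longlonglongrightarrow> g y * k (x - y)"
      using lim
    proof eventually_elim
      case (elim y)
      then show ?case by (cases "y \<in> cball x r") (auto intro!: tendsto_mult_right simp: z)
    qed
    show "AE y in lborel. norm (h m y * k (x - y)) \<le> \<bar>b y\<bar> * B" for m
      using b(2)[of m]
    proof eventually_elim
      case (elim y)
      show ?case
      proof (cases "y \<in> cball x r")
        case True
        then have "\<bar>h m y\<bar> \<le> \<bar>b y\<bar>" using elim by linarith
        then show ?thesis unfolding real_norm_def abs_mult by (intro mult_mono B) auto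
      qed (use B(1) in \<open>simp add: z\<close>)
    qed
  qed measurable
qed

text \<open>The positive part is approximated by \<open>ramp\<close> with smoothing 1 / (m + 1), for
  which the chain rule holds, and the limit is compared with W by uniqueness of weak derivatives.
  Ellipticity of the problem for w rests on this: W vanishes wherever D^2H may degenerate.\<close>

lemma W_eq: "AE x in lborel. x \<in> osquare p R' \<longrightarrow> (\<forall>i. W x $ i = (if G x $ 1 > 1 + \<delta> then D 1 x $ i else 0))"
proof -
  define Di where "Di i x = (if G x $ 1 > 1 + \<delta> then D 1 x $ i else 0)" for i x
  have [measurable]: "Di i \<in> borel_measurable borel" for i unfolding Di_def[abs_def] by measurable
  have Di: "integrable lborel (Di i)" for i
    by (rule Bochner_Integration.integrable_bound[OF D(1)[of 1 i]]) (auto simp: Di_def)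
  define \<sigma> where "\<sigma> m = inverse (real (Suc m))" for m
  have \<sigma>: "\<sigma> m > 0" for m by (simp add: \<sigma>_def)
  have conv_w: "conv (\<lambda>y. W y $ i) k x = conv (Di i) k x" if k: "kernel r k" and x: "cball x r \<subseteq> osquare p R'" for r k x i
  proof -
    note xc = osquare_subset[OF x]
    define \<Phi> where "\<Phi> m z = ramp (\<sigma> m) (z $ 1 - (1 + \<delta>))" for m and z :: "real^2"
    have C: "C1_grad (\<Phi> m) (\<lambda>z. ramp' (\<sigma> m) (z $ 1 - (1 + \<delta>)) *\<^sub>R axis 1 1)" for m
      unfolding \<Phi>_def[abs_def]
    proof (rule C1_grad_compose[OF _ ramp_has_derivative[OF \<sigma>] ramp'_continuous[OF \<sigma>]])
      have "((\<lambda>z::real^2. z $ 1 - (1 + \<delta>)) has_derivative (\<lambda>h. h $ 1)) (at z)" for z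
        using has_derivative_diff[OF bounded_linear_imp_has_derivative[OF bounded_linear_vec_nth[of 1]] has_derivative_const[of "1 + \<delta>"]]
        by simp
      moreover have "(\<lambda>h::real^2. axis 1 1 \<bullet> h) = (\<lambda>h. h $ 1)" by (simp add: fun_eq_iff inner_axis')
      ultimately show "C1_grad (\<lambda>z::real^2. z $ 1 - (1 + \<delta>)) (\<lambda>z. axis 1 1)"
        unfolding C1_grad_def by simp
    qed
    have b: "norm (ramp' (\<sigma> m) (z $ 1 - (1 + \<delta>)) *\<^sub>R (axis 1 1 :: real^2)) \<le> 1" for m and z :: "real^2"
      using ramp'_bounds[OF \<sigma>] by simp
    have eq: "(LINT y|lborel. \<Phi> m (G y) * partial i k (x - y)) = (LINT y|lborel. (ramp' (\<sigma> m) (G y $ 1 - (1 + \<delta>)) * D 1 y $ i) * k (x - y))" for m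
      using chain_kernel[OF C b k x, of m i] by (simp add: UNIV_2 axis_def)
    have [measurable]: "ramp' (\<sigma> m) \<in> borel_measurable borel" "ramp (\<sigma> m) \<in> borel_measurable borel" for m
      by (intro borel_measurable_continuous_onI ramp'_continuous ramp_continuous \<sigma>)+
    have "(\<lambda>m. LINT y|lborel. \<Phi> m (G y) * partial i k (x - y)) \<longlonglongrightarrow> (LINT y|lborel. max 0 (G y $ 1 - (1 + \<delta>)) * partial i k (x - y))"
    proof (rule kernel_dominated[OF kernel_partial[OF k], where b="\<lambda>y. \<bar>G y $ 1\<bar> + \<bar>1 + \<delta>\<bar> * indicator (csquare p R') y"])
      show "AE y in lborel. y \<in> cball x r \<longrightarrow> (\<lambda>m. \<Phi> m (G y)) \<longlonglongrightarrow> max 0 (G y $ 1 - (1 + \<delta>))"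
        unfolding \<Phi>_def \<sigma>_def by (intro AE_I2 impI ramp_tendsto)
      show "AE y in lborel. y \<in> cball x r \<longrightarrow> \<bar>\<Phi> m (G y)\<bar> \<le> \<bar>G y $ 1\<bar> + \<bar>1 + \<delta>\<bar> * indicator (csquare p R') y" for m
      proof (intro AE_I2 impI)
        fix y assume "y \<in> cball x r"
        then have "y \<in> csquare p R'" using xc by blast
        moreover have "0 \<le> \<Phi> m (G y)" "\<Phi> m (G y) \<le> max 0 (G y $ 1 - (1 + \<delta>))"
          unfolding \<Phi>_def using ramp_nonneg[OF \<sigma>] ramp_le[OF \<sigma>] by blast+
        ultimately show "\<bar>\<Phi> m (G y)\<bar> \<le> \<bar>G y $ 1\<bar> + \<bar>1 + \<delta>\<bar> * indicator (csquare p R') y" by simp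
      qed
      have "integrable lborel (indicator (csquare p R') :: real^2 \<Rightarrow> real)"
        using emeasure_compact_finite[OF compact_csquare] by (simp add: integrable_indicator_iff less_top)
      then show "integrable lborel (\<lambda>y. \<bar>G y $ 1\<bar> + \<bar>1 + \<delta>\<bar> * indicator (csquare p R') y)" using G by auto
    qed (unfold \<Phi>_def, measurable)
    moreover have "(\<lambda>m. LINT y|lborel. (ramp' (\<sigma> m) (G y $ 1 - (1 + \<delta>)) * D 1 y $ i) * k (x - y)) \<longlonglongrightarrow> (LINT y|lborel. Di i y * k (x - y))"
    proof (rule kernel_dominated[OF k, where b="\<lambda>y. \<bar>D 1 y $ i\<bar>"])
      show "AE y in lborel. y \<in> cball x r \<longrightarrow> (\<lambda>m. ramp' (\<sigma> m) (G y $ 1 - (1 + \<delta>)) * D 1 y $ i) \<longlonglongrightarrow> Di i y"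
      proof (intro AE_I2 impI)
        fix y
        have "(\<lambda>m. ramp' (\<sigma> m) (G y $ 1 - (1 + \<delta>)) * D 1 y $ i) \<longlonglongrightarrow> (if G y $ 1 - (1 + \<delta>) > 0 then 1 else 0) * D 1 y $ i"
          unfolding \<sigma>_def by (intro tendsto_mult_right ramp_tendsto)
        then show "(\<lambda>m. ramp' (\<sigma> m) (G y $ 1 - (1 + \<delta>)) * D 1 y $ i) \<longlonglongrightarrow> Di i y"
          by (auto simp: Di_def split: if_splits)
      qed
      show "AE y in lborel. y \<in> cball x r \<longrightarrow> \<bar>ramp' (\<sigma> m) (G y $ 1 - (1 + \<delta>)) * D 1 y $ i\<bar> \<le> \<bar>D 1 y $ i\<bar>" for m
        using ramp'_bounds[OF \<sigma>] by (intro AE_I2) (auto simp: abs_mult mult_left_le_one_le)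
    qed (use D in auto)
    ultimately have "(LINT y|lborel. max 0 (G y $ 1 - (1 + \<delta>)) * partial i k (x - y)) = (LINT y|lborel. Di i y * k (x - y))"
      unfolding eq by (rule LIMSEQ_unique)
    moreover have "conv w (partial i k) x = conv (\<lambda>y. max 0 (G y $ 1 - (1 + \<delta>))) (partial i k) x"
    proof (rule conv_cong_AE[OF _ kernel_partial[OF k]])
      show "AE y in lborel. y \<in> cball x r \<longrightarrow> w y = max 0 (G y $ 1 - (1 + \<delta>))"
        using w(2) by eventually_elim (use xc in auto)
    qed measurable
    ultimately show ?thesis using grad_w[OF k xc, of i] by (simp add: conv_def)
  qed
  have "AE x in lborel. x \<in> osquare p R' \<longrightarrow> W x $ i - Di i x = 0" for i
  proof (rule AE_eq_0_of_conv_eq_0)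
    show "integrable lborel (\<lambda>x. W x $ i - Di i x)" using W Di by auto
    fix x assume "x \<in> osquare p R'"
    then obtain n0 where n0: "\<And>n. n \<ge> n0 \<Longrightarrow> cball x (inverse (real (Suc n))) \<subseteq> osquare p R'" using inside by blast
    have "conv (\<lambda>x. W x $ i - Di i x) (mol n) x = 0" if "n \<ge> n0" for n
      using conv_diff[OF W(1) Di kernel_mol, of i i n] conv_w[OF kernel_mol n0[OF that], of i] by simp
    then show "\<exists>n0. \<forall>n\<ge>n0. conv (\<lambda>x. W x $ i - Di i x) (mol n) x = 0" by blast
  qed
  from this[of 1] this[of 2] show ?thesis
    by eventually_elim (auto simp: Di_def forall_2)
qed

text \<open>The flux of the differentiated equation, extended by 0 outside the square because the
  coefficient bound is available only inside it.\<close>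

definition Y :: "real^2 \<Rightarrow> real^2" where
  "Y x = indicator (csquare p R') x *\<^sub>R (A (G x) *v D 1 x)"

lemma Y_nth: "Y x $ j = indicator (csquare p R') x * (A (G x) $ j \<bullet> D 1 x)"
  by (simp add: Y_def matrix_vector_mult_def inner_vec_def)

lemma Y_measurable: "(\<lambda>x. Y x $ j) \<in> borel_measurable borel"
  unfolding Y_nth by measurable

lemma abs_Y_le: "AE x in lborel. \<bar>Y x $ j\<bar> \<le> \<Lambda> * (\<bar>D 1 x $ 1\<bar> + \<bar>D 1 x $ 2\<bar>)"
  using A_bounded
proof eventually_elim
  case (elim x)
  show ?case
  proof (cases "x \<in> csquare p R'")
    case True
    then have L: "norm (A (G x) $ j) \<le> \<Lambda>" using elim by blast
    have "\<bar>A (G x) $ j \<bullet> D 1 x\<bar> \<le> norm (A (G x) $ j) * norm (D 1 x)" by (rule Cauchy_Schwarz_ineq2)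
    also have "\<dots> \<le> \<Lambda> * (\<bar>D 1 x $ 1\<bar> + \<bar>D 1 x $ 2\<bar>)"
      using norm_le_l1_cart[of "D 1 x"] norm_ge_zero[of "A (G x) $ j"] L
      by (intro mult_mono L) (auto simp: UNIV_2 \<Lambda>)
    finally show ?thesis using True by (simp add: Y_nth)
  next
    case False
    then show ?thesis using \<Lambda> by (simp add: Y_nth)
  qed
qed

lemma Y_integrable: "integrable lborel (\<lambda>x. Y x $ j)" "integrable lborel (\<lambda>x. (Y x $ j)\<^sup>2)"
proof -
  note [measurable] = Y_measurable
  show "integrable lborel (\<lambda>x. Y x $ j)"
  proof (rule Bochner_Integration.integrable_bound[of _ "\<lambda>x. \<Lambda> * (\<bar>D 1 x $ 1\<bar> + \<bar>D 1 x $ 2\<bar>)"])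
    show "AE x in lborel. norm (Y x $ j) \<le> norm (\<Lambda> * (\<bar>D 1 x $ 1\<bar> + \<bar>D 1 x $ 2\<bar>))"
      using abs_Y_le[of j] by eventually_elim (use \<Lambda> in auto)
  qed (use D in auto)
  show "integrable lborel (\<lambda>x. (Y x $ j)\<^sup>2)"
  proof (rule Bochner_Integration.integrable_bound[of _ "\<lambda>x. \<Lambda>\<^sup>2 * (2 * ((D 1 x $ 1)\<^sup>2 + (D 1 x $ 2)\<^sup>2))"])
    show "AE x in lborel. norm ((Y x $ j)\<^sup>2) \<le> norm (\<Lambda>\<^sup>2 * (2 * ((D 1 x $ 1)\<^sup>2 + (D 1 x $ 2)\<^sup>2)))"
      using abs_Y_le[of j]
    proof eventually_elim
      case (elim x)
      then have "\<bar>Y x $ j\<bar>\<^sup>2 \<le> (\<Lambda> * (\<bar>D 1 x $ 1\<bar> + \<bar>D 1 x $ 2\<bar>))\<^sup>2" by (intro power_mono) auto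
      also have "\<dots> = \<Lambda>\<^sup>2 * (\<bar>D 1 x $ 1\<bar> + \<bar>D 1 x $ 2\<bar>)\<^sup>2" by (rule power_mult_distrib)
      also have "\<dots> \<le> \<Lambda>\<^sup>2 * (2 * ((D 1 x $ 1)\<^sup>2 + (D 1 x $ 2)\<^sup>2))"
        using sum_squares_bound[of "\<bar>D 1 x $ 1\<bar>" "\<bar>D 1 x $ 2\<bar>"]
        by (intro mult_left_mono) (auto simp: power2_sum)
      finally show ?case by simp
    qed
  qed (use D in auto)
qed

text \<open>The gradient of F may be unbounded on the plane, so the chain rule is used for the
  components cut off at level m. As m grows, F (G) itself dominates on the left, and the bound
  uniform in m along the solution dominates on the right.\<close>

lemma flux_derivative:
  assumes k: "kernel r k" and x: "cball x r \<subseteq> osquare p R'"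
  shows "conv (\<lambda>y. indicator (csquare p R') y * F (G y) $ j) (partial 1 k) x = conv (\<lambda>y. Y y $ j) k x"
proof -
  note xc = osquare_subset[OF x]
  define P where "P y = indicator (csquare p R') y * F (G y) $ j" for y
  define E where "E m y = (\<Sum>l\<in>UNIV. cutoff_grad F A (real (Suc m)) j (G y) $ l * D l y $ 1)" for m y
  have m0: "real (Suc m) > 0" for m by simp
  have cutoff_meas: "cutoff F (real (Suc m)) j \<in> borel_measurable borel"
    "(\<lambda>z. cutoff_grad F A (real (Suc m)) j z $ l) \<in> borel_measurable borel" for m l
    using C1_grad_measurable[OF cutoff_C1_grad[OF F m0, of m j]] by auto
  note [measurable] = cutoff_meas
  have P_meas [measurable]: "P \<in> borel_measurable borel" unfolding P_def[abs_def] by measurable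
  have E_meas: "E m \<in> borel_measurable borel" for m
    unfolding E_def[abs_def] by (intro borel_measurable_sum borel_measurable_times measurable_compose[OF meas(4) cutoff_meas(2)] meas(7))
  have eq: "(LINT y|lborel. cutoff F (real (Suc m)) j (G y) * partial 1 k (x - y)) = (LINT y|lborel. E m y * k (x - y))" for m
  proof -
    obtain L where L: "\<And>z. norm (cutoff_grad F A (real (Suc m)) j z) \<le> L"
      using cutoff_grad_bounded[OF F m0, of m j] by blast
    show ?thesis unfolding E_def by (rule chain_kernel[OF cutoff_C1_grad[OF F m0] L k x])
  qed
  have l1: "(\<lambda>m. LINT y|lborel. cutoff F (real (Suc m)) j (G y) * partial 1 k (x - y)) \<longlonglongrightarrow> (LINT y|lborel. P y * partial 1 k (x - y))"
  proof (rule kernel_dominated[OF kernel_partial[OF k], where b="\<lambda>y. \<bar>P y\<bar>"])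
    show "(\<lambda>y. cutoff F (real (Suc m)) j (G y)) \<in> borel_measurable borel" for m by measurable
    show "AE y in lborel. y \<in> cball x r \<longrightarrow> (\<lambda>m. cutoff F (real (Suc m)) j (G y)) \<longlonglongrightarrow> P y"
    proof (intro AE_I2 impI)
      fix y assume "y \<in> cball x r"
      then have "P y = F (G y) $ j" using xc by (auto simp: P_def)
      then show "(\<lambda>m. cutoff F (real (Suc m)) j (G y)) \<longlonglongrightarrow> P y"
        using cutoff_tendsto(1)[OF F, of j "G y"] by simp
    qed
    show "AE y in lborel. y \<in> cball x r \<longrightarrow> \<bar>cutoff F (real (Suc m)) j (G y)\<bar> \<le> \<bar>P y\<bar>" for m
    proof (intro AE_I2 impI)
      fix y assume "y \<in> cball x r"
      then have "y \<in> csquare p R'" using xc by blast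
      then show "\<bar>cutoff F (real (Suc m)) j (G y)\<bar> \<le> \<bar>P y\<bar>"
        using abs_cutoff_le[OF F m0, of m j "G y"] by (simp add: P_def)
    qed
    show "integrable lborel (\<lambda>y. \<bar>P y\<bar>)" using P[of j] by (simp add: P_def)
  qed measurable
  have l2: "(\<lambda>m. LINT y|lborel. E m y * k (x - y)) \<longlonglongrightarrow> (LINT y|lborel. Y y $ j * k (x - y))"
  proof (rule kernel_dominated[OF k E_meas Y_measurable, where b="\<lambda>y. \<Sum>l\<in>UNIV. (\<Lambda> + 4 * (2 * \<Lambda> + 1)) * \<bar>D l y $ 1\<bar>"])
    show "AE y in lborel. y \<in> cball x r \<longrightarrow> (\<lambda>m. E m y) \<longlonglongrightarrow> Y y $ j"
      using D_symmetric
    proof eventually_elim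
      case (elim y)
      show ?case
      proof
        assume "y \<in> cball x r"
        then have y: "y \<in> csquare p R'" "y \<in> osquare p R'" using x xc by auto
        have "(\<lambda>m. E m y) \<longlonglongrightarrow> (\<Sum>l\<in>UNIV. A (G y) $ j $ l * D l y $ 1)"
          unfolding E_def by (intro tendsto_sum tendsto_mult_right cutoff_tendsto(2)[OF F])
        \<comment> \<open>Symmetry of the second derivatives turns the derivative of G $ l in
          direction 1 into that of G $ 1 in direction l.\<close>
        also have "(\<Sum>l\<in>UNIV. A (G y) $ j $ l * D l y $ 1) = Y y $ j"
          using y elim by (simp add: Y_nth inner_vec_def UNIV_2)
        finally show "(\<lambda>m. E m y) \<longlonglongrightarrow> Y y $ j" .
      qed
    qed
    show "AE y in lborel. y \<in> cball x r \<longrightarrow> \<bar>E m y\<bar> \<le> (\<Sum>l\<in>UNIV. (\<Lambda> + 4 * (2 * \<Lambda> + 1)) * \<bar>D l y $ 1\<bar>)" for m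
      using A_bounded
    proof eventually_elim
      case (elim y)
      show ?case
      proof
        assume "y \<in> cball x r"
        then have b: "norm (A (G y) $ l) \<le> \<Lambda>" for l using elim xc by blast
        have "\<bar>E m y\<bar> \<le> (\<Sum>l\<in>UNIV. \<bar>cutoff_grad F A (real (Suc m)) j (G y) $ l * D l y $ 1\<bar>)"
          unfolding E_def by (rule sum_abs)
        also have "\<dots> \<le> (\<Sum>l\<in>UNIV. (\<Lambda> + 4 * (2 * \<Lambda> + 1)) * \<bar>D l y $ 1\<bar>)"
          unfolding abs_mult
          by (intro sum_mono mult_right_mono order_trans[OF component_le_norm_cart norm_cutoff_grad_le[OF F m0 b]]) auto
        finally show "\<bar>E m y\<bar> \<le> (\<Sum>l\<in>UNIV. (\<Lambda> + 4 * (2 * \<Lambda> + 1)) * \<bar>D l y $ 1\<bar>)" .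
      qed
    qed
    show "integrable lborel (\<lambda>y. \<Sum>l\<in>UNIV. (\<Lambda> + 4 * (2 * \<Lambda> + 1)) * \<bar>D l y $ 1\<bar>)"
      using D(1) by auto
  qed
  have "(LINT y|lborel. P y * partial 1 k (x - y)) = (LINT y|lborel. Y y $ j * k (x - y))"
    using l1 l2 unfolding eq by (rule LIMSEQ_unique)
  then show ?thesis by (simp add: conv_def P_def)
qed

text \<open>The derivative in direction 1 is placed on the mollifier, where it is free. On the
  support of \<phi> the mollified flux derivative and the mollified equation are classical;
  integration by parts moves the remaining derivatives onto and off \<phi>, so one continuous
  derivative of \<phi> suffices, and the mollification is then removed.\<close>

lemma differentiated_equation:
  assumes \<phi>: "C1_grad \<phi> D\<phi>" and K: "compact K" "K \<subseteq> osquare p R'" "\<And>x. x \<notin> K \<Longrightarrow> \<phi> x = 0"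
  shows "(LINT x|lborel. Y x \<bullet> D\<phi> x) = (LINT x|lborel. f x * D\<phi> x $ 1)"
proof -
  have D0: "D\<phi> x = 0" if "x \<notin> K" for x
    using C1_grad_eq_0[OF \<phi> compact_imp_closed[OF K(1)] K(3) that] .
  obtain B where B: "B \<ge> 0" "\<And>x. norm (D\<phi> x) \<le> B"
    using continuous_compact_support_bounded[OF C1_grad_continuous_grad[OF \<phi>] K(1) D0] by blast
  have Bi: "\<bar>D\<phi> x $ i\<bar> \<le> B" for x i
    using order_trans[OF component_le_norm_cart B(2)] by blast
  note [measurable] = C1_grad_measurable[OF \<phi>]
  obtain n0 where n0: "\<And>n y. n \<ge> n0 \<Longrightarrow> y \<in> K \<Longrightarrow> cball y (inverse (real (Suc n))) \<subseteq> osquare p R'"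
    using eventually_cball_mol_subset[OF K(1) open_osquare K(2)] by blast
  define P where "P j y = indicator (csquare p R') y * F (G y) $ j" for j y
  have Pi: "integrable lborel (P j)" for j using P[of j] by (simp add: P_def[abs_def])
  have step: "(\<Sum>j\<in>UNIV. LINT x|lborel. D\<phi> x $ j * conv (\<lambda>y. Y y $ j) (mol n) x) = (LINT x|lborel. D\<phi> x $ 1 * conv f (mol n) x)"
    if n: "n \<ge> n0" for n
  proof -
    note k = kernel_mol[of n] and k1 = kernel_partial[OF kernel_mol[of n], of 1]
    define Q where "Q j = conv (P j) (partial 1 (mol n))" for j
    have Q: "C1_grad (Q j) (\<lambda>x. \<chi> i. conv (P j) (partial i (partial 1 (mol n))) x)" for j
      unfolding Q_def by (rule conv_C1_grad[OF Pi k1])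
    have "(LINT x|lborel. D\<phi> x $ j * conv (\<lambda>y. Y y $ j) (mol n) x) = (LINT x|lborel. Q j x * D\<phi> x $ j)" for j
    proof (intro Bochner_Integration.integral_cong refl)
      fix x
      show "D\<phi> x $ j * conv (\<lambda>y. Y y $ j) (mol n) x = Q j x * D\<phi> x $ j"
      proof (cases "x \<in> K")
        case True
        then show ?thesis using flux_derivative[OF k n0[OF n], of x j] by (simp add: Q_def P_def[abs_def])
      qed (simp add: D0)
    qed
    also have "(LINT x|lborel. Q j x * D\<phi> x $ j) = - (LINT x|lborel. conv (P j) (partial j (partial 1 (mol n))) x * \<phi> x)" for j
      using integration_by_parts_compact(1)[OF Q \<phi> K(1,3)] by simp
    finally have 1: "(LINT x|lborel. D\<phi> x $ j * conv (\<lambda>y. Y y $ j) (mol n) x) = - (LINT x|lborel. conv (P j) (partial j (partial 1 (mol n))) x * \<phi> x)" for j .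
    have i: "integrable lborel (\<lambda>x. conv (P j) (partial j (partial 1 (mol n))) x * \<phi> x)" for j
      using integration_by_parts_compact(3)[OF Q \<phi> K(1,3), of j j] by simp
    have "(\<Sum>j\<in>UNIV. LINT x|lborel. D\<phi> x $ j * conv (\<lambda>y. Y y $ j) (mol n) x) =
      - (LINT x|lborel. (\<Sum>j\<in>UNIV. conv (P j) (partial j (partial 1 (mol n))) x * \<phi> x))"
      unfolding 1 sum_negf using i by (simp only: Bochner_Integration.integral_sum)
    also have "\<dots> = - (LINT x|lborel. conv f (partial 1 (mol n)) x * \<phi> x)"
    proof (intro arg_cong[where f=uminus] Bochner_Integration.integral_cong refl)
      fix x
      show "(\<Sum>j\<in>UNIV. conv (P j) (partial j (partial 1 (mol n))) x * \<phi> x) = conv f (partial 1 (mol n)) x * \<phi> x"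
      proof (cases "x \<in> K")
        case True
        show ?thesis
          \<comment> \<open>The equation is used with the kernel \<open>partial 1 (mol n)\<close>,
            which is how it gets differentiated.\<close>
          using equation[OF k1 osquare_subset[OF n0[OF n True]]]
          by (simp add: P_def[abs_def] sum_distrib_right[symmetric])
      qed (simp add: K(3))
    qed
    also have "\<dots> = (LINT x|lborel. conv f (mol n) x * D\<phi> x $ 1)"
      using integration_by_parts_compact(1)[OF conv_C1_grad[OF f(1) k] \<phi> K(1,3), of 1] by simp
    finally show ?thesis by (simp add: mult.commute)
  qed
  have L1: "(\<lambda>n. \<Sum>j\<in>UNIV. LINT x|lborel. D\<phi> x $ j * conv (\<lambda>y. Y y $ j) (mol n) x) \<longlonglongrightarrow> (\<Sum>j\<in>UNIV. LINT x|lborel. D\<phi> x $ j * Y x $ j)"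
    by (intro tendsto_sum conv_L1_mult_bounded[OF Y_integrable(1) _ Bi]) measurable
  have L2: "(\<lambda>n. LINT x|lborel. D\<phi> x $ 1 * conv f (mol n) x) \<longlonglongrightarrow> (LINT x|lborel. D\<phi> x $ 1 * f x)"
    by (intro conv_L1_mult_bounded[OF f(1) _ Bi]) measurable
  have ev: "\<forall>\<^sub>F n in sequentially. (\<Sum>j\<in>UNIV. LINT x|lborel. D\<phi> x $ j * conv (\<lambda>y. Y y $ j) (mol n) x) = (LINT x|lborel. D\<phi> x $ 1 * conv f (mol n) x)"
    unfolding eventually_sequentially using step by blast
  have "(\<Sum>j\<in>UNIV. LINT x|lborel. D\<phi> x $ j * Y x $ j) = (LINT x|lborel. D\<phi> x $ 1 * f x)"
    by (rule LIMSEQ_unique[OF Lim_transform_eventually[OF L1 ev] L2])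
  moreover have "integrable lborel (\<lambda>x. D\<phi> x $ j * Y x $ j)" for j
  proof (rule Bochner_Integration.integrable_bound[of _ "\<lambda>x. B * \<bar>Y x $ j\<bar>"])
    show "(\<lambda>x. D\<phi> x $ j * Y x $ j) \<in> borel_measurable lborel" using Y_measurable[of j] by measurable
    show "AE x in lborel. norm (D\<phi> x $ j * Y x $ j) \<le> norm (B * \<bar>Y x $ j\<bar>)"
    proof (rule AE_I2)
      fix x
      have "\<bar>D\<phi> x $ j\<bar> * \<bar>Y x $ j\<bar> \<le> B * \<bar>Y x $ j\<bar>" by (intro mult_right_mono Bi) simp
      then show "norm (D\<phi> x $ j * Y x $ j) \<le> norm (B * \<bar>Y x $ j\<bar>)" using B(1) by (simp add: abs_mult)
    qed
  qed (use Y_integrable(1) in auto)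
  ultimately show ?thesis
    by (simp add: inner_vec_def mult.commute)
qed

text \<open>The margin between R and R' leaves room for the mollification balls. Where G $ 1 > 1 +
  \<delta>, also |G| \<ge> 1 + \<delta>, so the lower bound on D^2H applies and W is the gradient of
  G $ 1; elsewhere W = 0 and both sides of the ellipticity inequality vanish.\<close>

lemma elliptic_square_solution:
  assumes R: "0 < R" "R < R'"
  shows "\<exists>n0. elliptic_square w f W Y p R c \<epsilon> N n0"
proof -
  obtain n0 where n0: "\<And>n y. n \<ge> n0 \<Longrightarrow> y \<in> csquare p R \<Longrightarrow> cball y (inverse (real (Suc n))) \<subseteq> osquare p R'"
    using eventually_cball_mol_subset[OF compact_csquare open_osquare csquare_subset_osquare[OF R(2)]] by blast
  have "elliptic_square w f W Y p R c \<epsilon> N n0"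
  proof
    show "partial i (conv w (mol n)) x = conv (\<lambda>y. W y $ i) (mol n) x" if "n0 \<le> n" "x \<in> csquare p R" for n x i
      unfolding partial_conv[OF w(1) kernel_mol]
      by (rule grad_w[OF kernel_mol osquare_subset[OF n0[OF that]]])
    show "(LINT x|lborel. Y x \<bullet> D\<phi> x) = (LINT x|lborel. f x * D\<phi> x $ 1)"
      if "C1_grad \<phi> D\<phi>" "compact K" "K \<subseteq> osquare p R" "\<And>x. x \<notin> K \<Longrightarrow> \<phi> x = 0" for \<phi> D\<phi> K
      by (rule differentiated_equation[OF that(1,2) _ that(4)])
         (use that(3) osquare_mono[of R R' p] R in auto)
    show "AE x in lborel. x \<in> csquare p R \<longrightarrow> c * (norm (W x))\<^sup>2 \<le> Y x \<bullet> W x"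
      using W_eq
    proof eventually_elim
      case (elim x)
      show ?case
      proof
        assume "x \<in> csquare p R"
        then have x: "x \<in> osquare p R'" "x \<in> csquare p R'"
          using csquare_subset_osquare[OF R(2), of p] csquare_mono[of R R' p] R by auto
        show "c * (norm (W x))\<^sup>2 \<le> Y x \<bullet> W x"
        proof (cases "G x $ 1 > 1 + \<delta>")
          case True
          then have "W x = D 1 x" using elim x by (simp add: vec_eq_iff)
          moreover have "norm (G x) \<ge> 1 + \<delta>" using True component_le_norm_cart[of "G x" 1] by linarith
          ultimately show ?thesis using A_elliptic[of "G x" "D 1 x"] x by (simp add: Y_def inner_commute)
        next
          case False
          then have "W x = 0" using elim x by (simp add: vec_eq_iff)
          then show ?thesis by simp
        qed
      qed
    qed
  qed (use R c \<epsilon> w W Y_measurable Y_integrable f meas in auto)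
  then show ?thesis by blast
qed

end

subsection \<open>Borel representatives\<close>

text \<open>Bridges the two settings: the Sobolev data are Lebesgue measurable on a set and defined
  up to null sets, while the convolution calculus uses Borel functions on the whole plane. Extension
  by 0 makes local integrability on a compact K global.\<close>

definition borel_rep :: "'a::euclidean_space set \<Rightarrow> ('a \<Rightarrow> 'b::euclidean_space) \<Rightarrow> ('a \<Rightarrow> 'b) \<Rightarrow> bool" where
  "borel_rep K g g' \<longleftrightarrow> g' \<in> borel_measurable borel \<and> (\<forall>x. x \<notin> K \<longrightarrow> g' x = 0) \<and> (AE x in lborel. x \<in> K \<longrightarrow> g x = g' x)"

lemma AE_lebesgue_on_iff:
  "S \<in> sets borel \<Longrightarrow> (AE x in lebesgue_on S. Q x) \<longleftrightarrow> (AE x in lborel. x \<in> S \<longrightarrow> Q x)"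
  by (subst AE_restrict_space_iff) (auto simp: AE_completion_iff)

lemma ex_borel_rep_real:
  fixes g :: "'a::euclidean_space \<Rightarrow> real"
  assumes g: "g \<in> borel_measurable (lebesgue_on K)" and K: "K \<in> sets borel"
  shows "\<exists>g'. borel_rep K g g'"
proof -
  have "(\<lambda>x. if x \<in> K then g x else 0) \<in> borel_measurable lebesgue"
    using borel_measurable_if[of K g] g K by auto
  then obtain g0 where g0: "g0 \<in> borel_measurable lborel" "AE x in lborel. (if x \<in> K then g x else 0) = g0 x"
    using completion_ex_borel_measurable_real by blast
  have "borel_rep K g (\<lambda>x. indicator K x * g0 x)"
    unfolding borel_rep_def
  proof (intro conjI)
    show "(\<lambda>x. indicator K x * g0 x) \<in> borel_measurable borel" using g0(1) K by simp
    show "AE x in lborel. x \<in> K \<longrightarrow> g x = indicator K x * g0 x"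
      using g0(2) by eventually_elim auto
  qed auto
  then show ?thesis by blast
qed

lemma ex_borel_rep_vec:
  fixes g :: "'a::euclidean_space \<Rightarrow> real^2"
  assumes g: "g \<in> borel_measurable (lebesgue_on K)" and K: "K \<in> sets borel"
  shows "\<exists>g'. borel_rep K g g'"
proof -
  have "\<exists>g'. borel_rep K (\<lambda>x. g x $ j) g'" for j
    by (rule ex_borel_rep_real[OF _ K])
       (rule measurable_compose[OF g], auto intro!: borel_measurable_continuous_onI continuous_on_component)
  then obtain g' where g': "\<And>j. borel_rep K (\<lambda>x. g x $ j) (g' j)" by metis
  have "borel_rep K g (\<lambda>x. \<chi> j. g' j x)"
    unfolding borel_rep_def
  proof (intro conjI allI impI)
    show "(\<lambda>x. \<chi> j. g' j x) \<in> borel_measurable borel"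
      using g' by (subst borel_measurable_euclidean_space) (auto simp: Basis_vec_def inner_axis borel_rep_def)
    show "(\<chi> j. g' j x) = 0" if "x \<notin> K" for x
      using g' that by (simp add: vec_eq_iff borel_rep_def)
    have "AE x in lborel. x \<in> K \<longrightarrow> g x $ j = g' j x" for j using g' by (simp add: borel_rep_def)
    from this[of 1] this[of 2] show "AE x in lborel. x \<in> K \<longrightarrow> g x = (\<chi> j. g' j x)"
      by eventually_elim (simp add: vec_eq_iff forall_2)
  qed
  then show ?thesis by blast
qed

lemma borel_rep_nth:
  fixes g :: "'a::euclidean_space \<Rightarrow> real^2"
  assumes "borel_rep K g g'" shows "borel_rep K (\<lambda>x. g x $ j) (\<lambda>x. g' x $ j)"
proof -
  have "g' \<in> borel_measurable borel" using assms by (simp add: borel_rep_def)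
  then have "(\<lambda>x. g' x $ j) \<in> borel_measurable borel"
    by (rule measurable_compose) (auto intro!: borel_measurable_continuous_onI continuous_on_component)
  then show ?thesis using assms by (auto simp: borel_rep_def elim: eventually_mono)
qed

lemma Lp_subset:
  assumes "g \<in> Lp q S" "T \<subseteq> S" "S \<in> sets lebesgue" "T \<in> sets lebesgue"
  shows "g \<in> Lp q T"
proof -
  have "integrable lebesgue (\<lambda>x. indicator S x *\<^sub>R norm (g x) powr q)"
    using assms by (simp add: Lp_def integrable_restrict_space)
  from integrable_mult_indicator[OF assms(4) this]
  have "integrable lebesgue (\<lambda>x. indicator T x *\<^sub>R norm (g x) powr q)"
    by (rule Bochner_Integration.integrable_cong[THEN iffD1, rotated -1]) (use assms(2) in \<open>auto simp: indicator_def\<close>)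
  then have "integrable (lebesgue_on T) (\<lambda>x. norm (g x) powr q)"
    by (subst integrable_restrict_space) (use assms(4) in auto)
  moreover have "g \<in> borel_measurable (lebesgue_on T)"
    by (rule measurable_restrict_mono[OF _ assms(2)]) (use assms(1) in \<open>simp add: Lp_def\<close>)
  ultimately show ?thesis by (simp add: Lp_def)
qed

lemma borel_rep_Lp:
  fixes g :: "'a::euclidean_space \<Rightarrow> 'b::euclidean_space"
  assumes g: "g \<in> Lp q S" and rep: "borel_rep K g g'" and K: "K \<subseteq> S" "K \<in> sets borel" "S \<in> sets borel" and q: "q > 0"
  shows "integrable lborel (\<lambda>x. norm (g' x) powr q)"
    and "(LINT x|lborel. norm (g' x) powr q) \<le> (LINT x|lebesgue_on S. norm (g x) powr q)"
proof -
  have [measurable]: "g' \<in> borel_measurable borel" using rep by (simp add: borel_rep_def)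
  have gS: "integrable lebesgue (\<lambda>x. indicator S x *\<^sub>R norm (g x) powr q)"
    using g K by (simp add: Lp_def integrable_restrict_space)
  have m: "(\<lambda>x. norm (g' x) powr q) \<in> borel_measurable lborel" by measurable
  have le: "AE x in lebesgue. norm (g' x) powr q \<le> indicator S x *\<^sub>R norm (g x) powr q"
    unfolding AE_completion_iff using rep[unfolded borel_rep_def, THEN conjunct2, THEN conjunct2]
  proof eventually_elim
    case (elim x)
    show ?case
    proof (cases "x \<in> K")
      case True then show ?thesis using elim K(1) by auto
    next
      case False then show ?thesis using rep by (simp add: borel_rep_def)
    qed
  qed
  have i: "integrable lebesgue (\<lambda>x. norm (g' x) powr q)"
  proof (rule Bochner_Integration.integrable_bound[OF gS measurable_completion[OF m]])
    show "AE x in lebesgue. norm (norm (g' x) powr q) \<le> norm (indicator S x *\<^sub>R norm (g x) powr q)"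
      using le by eventually_elim simp
  qed
  then show "integrable lborel (\<lambda>x. norm (g' x) powr q)" using integrable_completion[OF m] by simp
  have "(LINT x|lborel. norm (g' x) powr q) = (LINT x|lebesgue. norm (g' x) powr q)"
    by (rule integral_completion[OF m, symmetric])
  also have "\<dots> \<le> (LINT x|lebesgue. indicator S x *\<^sub>R norm (g x) powr q)"
    by (rule integral_mono_AE[OF i gS le])
  also have "\<dots> = (LINT x|lebesgue_on S. norm (g x) powr q)"
    by (rule integral_restrict_space[symmetric]) (use K in auto)
  finally show "(LINT x|lborel. norm (g' x) powr q) \<le> (LINT x|lebesgue_on S. norm (g x) powr q)" .
qed

lemma powr_2_norm: "norm x powr 2 = (norm x)\<^sup>2"
  by (cases "norm x = 0") (simp_all add: powr_numeral)

lemma integral_lebesgue_on_eq: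
  fixes g h :: "'a::euclidean_space \<Rightarrow> 'b::euclidean_space"
  assumes S: "S \<in> sets borel" and h: "h \<in> borel_measurable borel"
    and ae: "AE x in lborel. indicator S x *\<^sub>R g x = h x"
  shows "(LINT x|lebesgue_on S. g x) = (LINT x|lborel. h x)"
proof -
  have ae': "AE x in lebesgue. h x = indicator S x *\<^sub>R g x"
    unfolding AE_completion_iff using ae by eventually_elim simp
  have hm: "h \<in> borel_measurable lebesgue" using h by (intro measurable_completion) simp
  have "(LINT x|lebesgue_on S. g x) = (LINT x|lebesgue. indicator S x *\<^sub>R g x)"
    by (rule integral_restrict_space) (use S in auto)
  also have "\<dots> = (LINT x|lebesgue. h x)"
    by (rule integral_cong_AE[OF borel_measurable_AE[OF hm ae'] hm]) (use ae' in \<open>auto elim: eventually_mono\<close>)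
  also have "\<dots> = (LINT x|lborel. h x)" by (rule integral_completion) (use h in simp)
  finally show ?thesis .
qed

section \<open>From weak formulations to convolution identities\<close>

lemma test_function_kernel:
  assumes k: "kernel r k" and x: "cball x r \<subseteq> S"
  shows "(\<lambda>y. k (x - y)) \<in> test_functions S" "grad (\<lambda>y. k (x - y)) y = - grad k (x - y)"
proof -
  have sk: "smooth k" using k by (simp add: kernel_def)
  have "smooth (\<lambda>y. k (x - y))" using smooth_reflect[OF sk, of 1 x] by simp
  moreover have cl: "closure {y. k (x - y) \<noteq> 0} \<subseteq> cball x r"
  proof (rule closure_minimal)
    show "{y. k (x - y) \<noteq> 0} \<subseteq> cball x r"
      using k by (auto simp: kernel_def dist_norm not_less[symmetric])
  qed simp
  moreover have "compact (closure {y. k (x - y) \<noteq> 0})"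
    using bounded_subset[OF bounded_cball cl] by (simp add: compact_eq_bounded_closed)
  ultimately show "(\<lambda>y. k (x - y)) \<in> test_functions S" using x by (auto simp: test_functions_def)
  have "((\<lambda>y. x - y) has_derivative (\<lambda>h. - h)) (at y)" by (auto intro!: derivative_eq_intros)
  from has_derivative_compose[OF this C1_gradD[OF smooth_C1_grad[OF sk]]]
  have "((\<lambda>y. k (x - y)) has_derivative (\<lambda>h. - grad k (x - y) \<bullet> h)) (at y)" by simp
  from partial_eqI[OF this] show "grad (\<lambda>y. k (x - y)) y = - grad k (x - y)"
    by (simp add: grad_def vec_eq_iff cart_eq_inner_axis[symmetric])
qed

lemma kernel_reflect_0:
  assumes "kernel r k" "y \<notin> cball x r" shows "k (x - y) = 0" "grad k (x - y) = 0"
  using assms kernel_partial[OF assms(1)] by (auto simp: kernel_def dist_norm grad_def vec_eq_iff)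

text \<open>The reflected kernel y \<mapsto> k (x - y) is inserted as test function; the minus sign
  of the weak derivative cancels the one from the reflection. The kernel lives in
  \<open>cball x r\<close>, so only the values on K matter and the representatives may be
  used.\<close>

lemma weak_grad_conv:
  fixes S :: "(real^'n::finite) set"
  assumes wg: "has_weak_grad S g Dg" and S: "S \<in> sets borel" and K: "K \<subseteq> S"
    and g': "borel_rep K g g'" "integrable lborel g'"
    and D': "borel_rep K Dg D'" "\<And>i. integrable lborel (\<lambda>x. D' x $ i)"
    and k: "kernel r k" and x: "cball x r \<subseteq> K"
  shows "conv g' (partial i k) x = conv (\<lambda>y. D' y $ i) k x"
proof -
  note test = test_function_kernel[OF k order_trans[OF x K]]
  have [measurable]: "g' \<in> borel_measurable borel" "D' \<in> borel_measurable borel" "k \<in> borel_measurable borel"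
    using g' D' kernel_measurable[OF k] by (auto simp: borel_rep_def)
  have [measurable]: "grad k \<in> borel_measurable borel"
    using C1_grad_measurable(2)[OF smooth_C1_grad] k by (auto simp: kernel_def)
  have out: "k (x - y) = 0" "grad k (x - y) = 0" if "y \<notin> K" for y
  proof -
    have "y \<notin> cball x r" using that x by blast
    from kernel_reflect_0[OF k this] show "k (x - y) = 0" "grad k (x - y) = 0" by auto
  qed
  have "(LINT y|lebesgue_on S. g y *\<^sub>R grad (\<lambda>y. k (x - y)) y) = (LINT y|lborel. g' y *\<^sub>R (- grad k (x - y)))"
  proof (rule integral_lebesgue_on_eq[OF S])
    show "AE y in lborel. indicator S y *\<^sub>R g y *\<^sub>R grad (\<lambda>y. k (x - y)) y = g' y *\<^sub>R (- grad k (x - y))"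
      using g'(1)[unfolded borel_rep_def, THEN conjunct2, THEN conjunct2]
    proof eventually_elim
      case (elim y)
      then show ?case using K by (cases "y \<in> K") (auto simp: test(2) out)
    qed
  qed measurable
  moreover have "(LINT y|lebesgue_on S. k (x - y) *\<^sub>R Dg y) = (LINT y|lborel. k (x - y) *\<^sub>R D' y)"
  proof (rule integral_lebesgue_on_eq[OF S])
    show "AE y in lborel. indicator S y *\<^sub>R k (x - y) *\<^sub>R Dg y = k (x - y) *\<^sub>R D' y"
      using D'(1)[unfolded borel_rep_def, THEN conjunct2, THEN conjunct2]
    proof eventually_elim
      case (elim y)
      then show ?case using K by (cases "y \<in> K") (auto simp: out)
    qed
  qed measurable
  moreover have "(LINT y|lebesgue_on S. g y *\<^sub>R grad (\<lambda>y. k (x - y)) y) = - (LINT y|lebesgue_on S. k (x - y) *\<^sub>R Dg y)"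
    using wg test(1) by (auto simp: has_weak_grad_def)
  ultimately have eq: "(LINT y|lborel. g' y *\<^sub>R (- grad k (x - y))) = - (LINT y|lborel. k (x - y) *\<^sub>R D' y)" by simp
  have cart: "(LINT y|lborel. v y) $ i = (LINT y|lborel. v y $ i)"
    if v: "\<And>j. integrable lborel (\<lambda>y. v y $ j)" "v \<in> borel_measurable borel" for v :: "real^'n \<Rightarrow> real^'n"
  proof -
    have "integrable lborel v"
      by (rule Bochner_Integration.integrable_bound[of _ "\<lambda>y. \<Sum>j\<in>UNIV. \<bar>v y $ j\<bar>"])
         (use v in \<open>auto simp: norm_le_l1_cart intro!: AE_I2\<close>)
    from integral_bounded_linear[OF bounded_linear_vec_nth this, of i] show ?thesis by simp
  qed
  have i1: "integrable lborel (\<lambda>y. g' y * partial j k (x - y))" for j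
    by (rule conv_integrable_integrand[OF g'(2) kernel_partial[OF k]])
  have i2: "integrable lborel (\<lambda>y. D' y $ j * k (x - y))" for j
    by (rule conv_integrable_integrand[OF D'(2) k])
  have c1: "(LINT y|lborel. g' y *\<^sub>R (- grad k (x - y))) $ i = (LINT y|lborel. (g' y *\<^sub>R (- grad k (x - y))) $ i)"
  proof (rule cart)
    show "integrable lborel (\<lambda>y. (g' y *\<^sub>R (- grad k (x - y))) $ j)" for j using i1[of j] by (simp add: grad_def)
  qed measurable
  have c2: "(LINT y|lborel. k (x - y) *\<^sub>R D' y) $ i = (LINT y|lborel. (k (x - y) *\<^sub>R D' y) $ i)"
    by (rule cart) (use i2 in \<open>auto simp: mult.commute\<close>)
  have "(LINT y|lborel. (g' y *\<^sub>R (- grad k (x - y))) $ i) = - (LINT y|lborel. (k (x - y) *\<^sub>R D' y) $ i)"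
    unfolding c1[symmetric] c2[symmetric] eq by (rule vector_uminus_component)
  then show ?thesis by (simp add: conv_def grad_def mult.commute)
qed

lemma mat_mult_vec: "mat (a :: real) *v \<xi> = a *\<^sub>R \<xi>"
proof -
  have "mat a *v \<xi> = (a *\<^sub>R mat 1) *v \<xi>" by (simp add: vec_eq_iff matrix_vector_mult_def mat_def if_distrib cong: if_cong)
  then show ?thesis by (simp add: scaleR_matrix_vector_assoc[symmetric])
qed

lemma loewner_le_mat:
  assumes "loewner_le (mat a) A" shows "a * (norm \<xi>)\<^sup>2 \<le> \<xi> \<bullet> (A *v \<xi>)"
  using assms by (auto simp: loewner_le_def mat_mult_vec power2_norm_eq_inner)

text \<open>The form lies between 0 and b, so the diagonal entries lie in [0, b]. Nonnegativity on
  (1, 1) and (1, -1) bounds the off-diagonal entry by the mean of the diagonal ones, and a row has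
  two entries.\<close>

lemma loewner_row_bound:
  fixes A :: "real^2^2"
  assumes lower: "loewner_le (mat a) A" "a \<ge> 0" and upper: "loewner_le A (mat b)"
  shows "norm (A $ j) \<le> 2 * b"
proof -
  have sym: "A $ 1 $ 2 = A $ 2 $ 1"
    using upper unfolding loewner_le_def transpose_def by (simp add: vec_eq_iff)
  have lo: "0 \<le> \<xi> \<bullet> (A *v \<xi>)" for \<xi>
    using loewner_le_mat[OF lower(1), of \<xi>] lower(2) by (meson mult_nonneg_nonneg order_trans zero_le_power2)
  have up: "\<xi> \<bullet> (A *v \<xi>) \<le> b * (\<xi> \<bullet> \<xi>)" for \<xi>
    using upper by (auto simp: loewner_le_def mat_mult_vec)
  have q: "v2 s t \<bullet> (A *v v2 s t) = s * s * A $ 1 $ 1 + 2 * s * t * A $ 1 $ 2 + t * t * A $ 2 $ 2" "v2 s t \<bullet> v2 s t = s * s + t * t" for s t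
    by (auto simp: inner_vec_def UNIV_2 matrix_vector_mult_def sym algebra_simps)
  have "0 \<le> A $ 1 $ 1" "A $ 1 $ 1 \<le> b" using lo[of "v2 1 0"] up[of "v2 1 0"] by (auto simp: q)
  moreover have "0 \<le> A $ 2 $ 2" "A $ 2 $ 2 \<le> b" using lo[of "v2 0 1"] up[of "v2 0 1"] by (auto simp: q)
  moreover have "\<bar>A $ 1 $ 2\<bar> \<le> b"
    using lo[of "v2 1 1"] up[of "v2 1 1"] lo[of "v2 1 (-1)"] up[of "v2 1 (-1)"] calculation by (auto simp: q)
  ultimately have "\<bar>A $ j $ 1\<bar> + \<bar>A $ j $ 2\<bar> \<le> 2 * b"
    using exhaust_2[of j] sym by auto
  then show ?thesis using norm_le_l1_cart[of "A $ j"] by (simp add: UNIV_2)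
qed

lemma has_weak_grad_weak_grad: "\<exists>G. has_weak_grad S g G \<Longrightarrow> has_weak_grad S g (weak_grad S g)"
  unfolding weak_grad_def by (erule someI_ex)

lemma borel_rep_L1:
  fixes g :: "'a::euclidean_space \<Rightarrow> real^2"
  assumes rep: "borel_rep K g g'" and g: "g \<in> Lp 1 K" and K: "compact K"
  shows "integrable lborel (\<lambda>x. g' x $ j)"
proof -
  have Kb: "K \<in> sets borel" using K by (intro borel_closed compact_imp_closed)
  have i: "integrable lborel (\<lambda>x. norm (g' x))"
    using borel_rep_Lp(1)[OF g rep order_refl Kb Kb] by simp
  have m: "(\<lambda>x. g' x $ j) \<in> borel_measurable borel"
    using borel_rep_nth[OF rep, of j] by (simp add: borel_rep_def)
  show ?thesis
    by (rule Bochner_Integration.integrable_bound[OF i]) (use m in \<open>auto simp: component_le_norm_cart\<close>)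
qed

lemma borel_rep_L1_real:
  fixes g :: "'a::euclidean_space \<Rightarrow> real"
  assumes rep: "borel_rep K g g'" and g: "g \<in> Lp 1 K" and K: "compact K"
  shows "integrable lborel g'"
proof -
  have Kb: "K \<in> sets borel" using K by (intro borel_closed compact_imp_closed)
  have i: "integrable lborel (\<lambda>x. norm (g' x))"
    using borel_rep_Lp(1)[OF g rep order_refl Kb Kb] by simp
  then show ?thesis
    by (rule Bochner_Integration.integrable_bound) (use rep in \<open>auto simp: borel_rep_def\<close>)
qed

lemma borel_rep_L2:
  fixes g :: "'a::euclidean_space \<Rightarrow> real^2"
  assumes rep: "borel_rep K g g'" and g: "g \<in> Lp 2 S" and K: "compact K" "K \<subseteq> S" "S \<in> sets borel"
  shows "integrable lborel (\<lambda>x. g' x $ j)" "integrable lborel (\<lambda>x. (g' x $ j)\<^sup>2)"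
    "(LINT x|lborel. (norm (g' x))\<^sup>2) \<le> (LINT x|lebesgue_on S. norm (g x) powr 2)"
proof -
  have Kb [measurable]: "K \<in> sets borel" using K(1) by (intro borel_closed compact_imp_closed)
  note r = borel_rep_Lp[OF g rep K(2) Kb K(3), unfolded powr_2_norm]
  have m [measurable]: "(\<lambda>x. g' x $ j) \<in> borel_measurable borel"
    using borel_rep_nth[OF rep, of j] by (simp add: borel_rep_def)
  show 2: "integrable lborel (\<lambda>x. (g' x $ j)\<^sup>2)"
  proof (rule Bochner_Integration.integrable_bound[of _ "\<lambda>x. (norm (g' x))\<^sup>2"])
    show "integrable lborel (\<lambda>x. (norm (g' x))\<^sup>2)" using r(1) by simp
    show "AE x in lborel. norm ((g' x $ j)\<^sup>2) \<le> norm ((norm (g' x))\<^sup>2)"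
    proof (rule AE_I2)
      fix x
      have "\<bar>g' x $ j\<bar>\<^sup>2 \<le> (norm (g' x))\<^sup>2" by (intro power_mono component_le_norm_cart) simp
      then show "norm ((g' x $ j)\<^sup>2) \<le> norm ((norm (g' x))\<^sup>2)" by simp
    qed
  qed measurable
  show "integrable lborel (\<lambda>x. g' x $ j)"
  proof (rule Bochner_Integration.integrable_bound[of _ "\<lambda>x. indicator K x + (g' x $ j)\<^sup>2"])
    have "integrable lborel (indicator K :: 'a \<Rightarrow> real)"
      using emeasure_compact_finite[OF K(1)] by (simp add: integrable_indicator_iff less_top)
    then show "integrable lborel (\<lambda>x. indicator K x + (g' x $ j)\<^sup>2)" using 2 by simp
    show "AE x in lborel. norm (g' x $ j) \<le> norm (indicator K x + (g' x $ j)\<^sup>2 :: real)"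
    proof (rule AE_I2)
      fix x
      show "norm (g' x $ j) \<le> norm (indicator K x + (g' x $ j)\<^sup>2 :: real)"
      proof (cases "x \<in> K")
        case True
        have "0 \<le> (\<bar>g' x $ j\<bar> - 1)\<^sup>2" by simp
        also have "\<dots> = (g' x $ j)\<^sup>2 - 2 * \<bar>g' x $ j\<bar> + 1" by (simp add: power2_diff)
        finally have "\<bar>g' x $ j\<bar> \<le> 1 + (g' x $ j)\<^sup>2" using abs_ge_zero[of "g' x $ j"] by linarith
        then show ?thesis using True by simp
      next
        case False
        then show ?thesis using rep by (simp add: borel_rep_def)
      qed
    qed
  qed measurable
  show "(LINT x|lborel. (norm (g' x))\<^sup>2) \<le> (LINT x|lebesgue_on S. norm (g x) powr 2)" using r(2) by (simp add: powr_2_norm)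
qed

lemma Lp_norm_powr:
  assumes "q > 0" shows "Lp_norm q S g powr q = (LINT x|lebesgue_on S. norm (g x) powr q)"
proof -
  have "0 \<le> (LINT x|lebesgue_on S. norm (g x) powr q)" by (intro integral_nonneg_AE) simp
  then show ?thesis using assms by (simp add: Lp_norm_def powr_powr)
qed

lemma Lp_2_norm_square: "(Lp_norm 2 S g)\<^sup>2 = (LINT x|lebesgue_on S. norm (g x) powr 2)"
proof -
  have "Lp_norm 2 S g \<ge> 0" by (simp add: Lp_norm_def)
  then show ?thesis using Lp_norm_powr[of 2 S g] powr_2_norm[of "Lp_norm 2 S g"] by simp
qed

text \<open>Covers the region near the degenerate set, where no positive lower bound on the Hessian
  is at hand. The constant depends on H; it helps to make the flux square integrable and does not
  reach the modulus of continuity.\<close>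

lemma hess_row_bound_on_cball:
  assumes "continuous_on UNIV (A :: real^2 \<Rightarrow> real^2^2)"
  shows "\<exists>B\<ge>0. \<forall>z j. norm z \<le> 2 \<longrightarrow> norm (A z $ j) \<le> B"
proof -
  have "\<exists>B. \<forall>z\<in>cball 0 2. norm (A z $ j) \<le> B" for j
  proof -
    have "compact ((\<lambda>z. A z $ j) ` cball 0 2)"
      by (intro compact_continuous_image continuous_on_component continuous_on_subset[OF assms]) auto
    then show ?thesis by (auto simp: bounded_iff dest: compact_imp_bounded)
  qed
  then obtain B where B: "\<And>j z. z \<in> cball 0 2 \<Longrightarrow> norm (A z $ j) \<le> B j" by metis
  have "norm (A z $ j) \<le> \<bar>B 1\<bar> + \<bar>B 2\<bar>" if "norm z \<le> 2" for z j
    using B[of z j] that exhaust_2[of j] by auto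
  then show ?thesis by (intro exI[of _ "\<bar>B 1\<bar> + \<bar>B 2\<bar>"]) auto
qed

lemma Linf_bound:
  assumes "g \<in> Linf S" and S: "S \<in> sets borel"
  shows "AE x in lborel. x \<in> S \<longrightarrow> \<bar>g x\<bar> \<le> Linf_norm S g"
proof -
  have fin: "esssup (lebesgue_on S) (\<lambda>x. ennreal \<bar>g x\<bar>) < \<infinity>" using assms(1) by (simp add: Linf_def)
  have "AE x in lebesgue_on S. ennreal \<bar>g x\<bar> \<le> esssup (lebesgue_on S) (\<lambda>x. ennreal \<bar>g x\<bar>)"
    by (rule esssup_AE)
  then have "AE x in lebesgue_on S. \<bar>g x\<bar> \<le> Linf_norm S g"
  proof eventually_elim
    case (elim x)
    then have "enn2real (ennreal \<bar>g x\<bar>) \<le> Linf_norm S g"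
      unfolding Linf_norm_def using fin by (intro enn2real_mono) auto
    then show ?case by simp
  qed
  then show ?thesis using AE_lebesgue_on_iff[OF S] by simp
qed

text \<open>Passing to representatives supported in the closed square does not increase the L^p, sup
  and energy quantities. The bounds are therefore stated with the global norms on
  \<open>\<Omega>\<close> and are the same for every square.\<close>

lemma local_elliptic_square:
  fixes \<Omega> :: "(real^2) set" and H :: "real^2 \<Rightarrow> real" and c :: "real \<Rightarrow> real"
  assumes \<Omega>: "open \<Omega>" and H: "C2 H"
    and c: "\<And>d z. d > 0 \<Longrightarrow> c d > 0" "\<And>d z. d > 0 \<Longrightarrow> norm z \<ge> 1 + d \<Longrightarrow> loewner_le (mat (c d)) (hess H z)"
    and \<epsilon>: "\<epsilon> > 0" and f: "f \<in> Lp (2 + \<epsilon>) \<Omega>" and u: "u \<in> H2_loc \<Omega>" and eq: "weak_solution \<Omega> (grad H) f u"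
    and \<delta>: "\<delta> > 0" and v: "excess \<Omega> u \<delta> \<in> H1 \<Omega>" "excess \<Omega> u \<delta> \<in> Linf \<Omega>"
    and Cbar: "AE x in lebesgue_on \<Omega>. loewner_le (hess H (weak_grad \<Omega> u x)) (mat Cbar)"
    and R: "0 < R" "R < R'" and sq: "csquare p R' \<subseteq> \<Omega>"
  shows "\<exists>w f' W Y n0. elliptic_square w f' W Y p R (c \<delta>) \<epsilon> (Lp_norm (2 + \<epsilon>) \<Omega> f powr (2 + \<epsilon>)) n0 \<and>
    (AE x in lborel. x \<in> csquare p R' \<longrightarrow> excess \<Omega> u \<delta> x = w x) \<and>
    (AE x in lborel. \<bar>w x\<bar> \<le> Linf_norm \<Omega> (excess \<Omega> u \<delta>)) \<and>
    (LINT x|lborel. (norm (W x))\<^sup>2) \<le> (H1_norm \<Omega> (excess \<Omega> u \<delta>))\<^sup>2"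
proof -
  define K where "K = csquare p R'"
  have K: "compact K" "K \<subseteq> \<Omega>" using sq by (auto simp: K_def compact_csquare)
  have Kb [measurable]: "K \<in> sets borel" by (simp add: K_def)
  have \<Omega>b: "\<Omega> \<in> sets borel" using \<Omega> by simp
  have indK: "integrable lborel (indicator K :: real^2 \<Rightarrow> real)"
    using emeasure_compact_finite[OF K(1)] by (simp add: integrable_indicator_iff less_top)
  have meas_K: "g \<in> borel_measurable (lebesgue_on K)" if "g \<in> Lp q K" for q and g :: "real^2 \<Rightarrow> 'b::euclidean_space"
    using that by (simp add: Lp_def)
  define G where "G = weak_grad \<Omega> u"
  define Dj where "Dj j = weak_grad \<Omega> (\<lambda>x. G x $ j)" for j
  define v' where "v' = excess \<Omega> u \<delta>"
  have uH: "u \<in> H1_loc \<Omega>" "\<And>j. (\<lambda>x. G x $ j) \<in> H1_loc \<Omega>" using u by (auto simp: H2_loc_def G_def)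
  have wu: "has_weak_grad \<Omega> u G" unfolding G_def by (rule has_weak_grad_weak_grad) (use uH in \<open>auto simp: H1_loc_def\<close>)
  have wG: "has_weak_grad \<Omega> (\<lambda>x. G x $ j) (Dj j)" for j
    unfolding Dj_def by (rule has_weak_grad_weak_grad) (use uH(2)[of j] in \<open>auto simp: H1_loc_def\<close>)
  have wv: "has_weak_grad \<Omega> v' (weak_grad \<Omega> v')"
    unfolding v'_def by (rule has_weak_grad_weak_grad) (use v(1) in \<open>auto simp: H1_def\<close>)
  have u1: "u \<in> Lp 1 K" and G1: "G \<in> Lp 1 K" using wu K by (auto simp: has_weak_grad_def Lp_loc_def)
  have D2: "Dj j \<in> Lp 2 K" for j using uH(2)[of j] K by (auto simp: H1_loc_def Lp_loc_def Dj_def)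
  have F1: "(\<lambda>x. grad H (G x)) \<in> Lp 1 K" using eq K by (auto simp: weak_solution_def Lp_loc_def G_def)
  have fK: "f \<in> Lp (2 + \<epsilon>) K" by (rule Lp_subset[OF f K(2)]) (use \<Omega>b Kb in auto)
  have v1: "v' \<in> Lp 1 K" using wv K by (auto simp: has_weak_grad_def Lp_loc_def)
  have W2: "weak_grad \<Omega> v' \<in> Lp 2 \<Omega>" using v(1) by (auto simp: H1_def v'_def)
  have W2K: "weak_grad \<Omega> v' \<in> Lp 2 K" by (rule Lp_subset[OF W2 K(2)]) (use \<Omega>b Kb in auto)
  obtain u' where u': "borel_rep K u u'" using ex_borel_rep_real[OF meas_K[OF u1] Kb] by blast
  obtain G' where G': "borel_rep K G G'" using ex_borel_rep_vec[OF meas_K[OF G1] Kb] by blast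
  have "\<exists>D'. borel_rep K (Dj j) D'" for j by (rule ex_borel_rep_vec[OF meas_K[OF D2] Kb])
  then obtain D' where D': "\<And>j. borel_rep K (Dj j) (D' j)" by metis
  obtain f' where f': "borel_rep K f f'" using ex_borel_rep_real[OF meas_K[OF fK] Kb] by blast
  obtain w where w: "borel_rep K v' w" using ex_borel_rep_real[OF meas_K[OF v1] Kb] by blast
  obtain W where W: "borel_rep K (weak_grad \<Omega> v') W" using ex_borel_rep_vec[OF meas_K[OF W2K] Kb] by blast
  have [measurable]: "G' \<in> borel_measurable borel" "f' \<in> borel_measurable borel" using G' f' by (auto simp: borel_rep_def)
  have Hd: "(grad H has_derivative (\<lambda>h. hess H z *v h)) (at z)" for z
    using H unfolding C2_def hess_def by (simp flip: jacobian_works)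
  have Hc: "continuous_on UNIV (hess H)" using H by (simp add: C2_def)
  have Fc: "continuous_on UNIV (grad H)"
    using Hd by (meson continuous_at_imp_continuous_on has_derivative_continuous)
  have [measurable]: "grad H \<in> borel_measurable borel" by (rule borel_measurable_continuous_onI[OF Fc])
  define P where "P x = indicator K x *\<^sub>R grad H (G' x)" for x
  have Gae: "AE x in lborel. x \<in> K \<longrightarrow> G x = G' x" using G' by (simp add: borel_rep_def)
  have P: "borel_rep K (\<lambda>x. grad H (G x)) P"
    unfolding borel_rep_def
  proof (intro conjI)
    show "P \<in> borel_measurable borel" unfolding P_def[abs_def] by measurable
    show "AE x in lborel. x \<in> K \<longrightarrow> grad H (G x) = P x" using Gae by eventually_elim (auto simp: P_def)
  qed (simp add: P_def)
  have Pi: "integrable lborel (\<lambda>x. P x $ j)" for j by (rule borel_rep_L1[OF P F1 K(1)])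
  have f'p: "integrable lborel (\<lambda>x. \<bar>f' x\<bar> powr (2 + \<epsilon>))"
    "(LINT x|lborel. \<bar>f' x\<bar> powr (2 + \<epsilon>)) \<le> Lp_norm (2 + \<epsilon>) \<Omega> f powr (2 + \<epsilon>)"
    using borel_rep_Lp[OF f f' K(2) Kb \<Omega>b] \<epsilon> by (auto simp: Lp_norm_powr)
  have f'2: "integrable lborel (\<lambda>x. (f' x)\<^sup>2)"
  proof (rule Bochner_Integration.integrable_bound[of _ "\<lambda>x. indicator K x + \<bar>f' x\<bar> powr (2 + \<epsilon>)"])
    show "integrable lborel (\<lambda>x. indicator K x + \<bar>f' x\<bar> powr (2 + \<epsilon>))" using indK f'p by simp
    show "AE x in lborel. norm ((f' x)\<^sup>2) \<le> norm (indicator K x + \<bar>f' x\<bar> powr (2 + \<epsilon>))"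
    proof (rule AE_I2)
      fix x
      show "norm ((f' x)\<^sup>2) \<le> norm (indicator K x + \<bar>f' x\<bar> powr (2 + \<epsilon>))"
      proof (cases "x \<in> K")
        case True
        have "(f' x)\<^sup>2 \<le> 1 + \<bar>f' x\<bar> powr (2 + \<epsilon>)"
        proof (cases "\<bar>f' x\<bar> \<le> 1")
          case True
          then have "\<bar>f' x\<bar>\<^sup>2 \<le> 1" by (intro power_le_one) auto
          then show ?thesis by (simp add: add_increasing2)
        next
          case False
          then have "\<bar>f' x\<bar> powr 2 \<le> \<bar>f' x\<bar> powr (2 + \<epsilon>)" using \<epsilon> by (intro powr_mono) auto
          then show ?thesis using powr_2_norm[of "f' x"] by simp
        qed
        then show ?thesis using True by simp
      next
        case False
        then show ?thesis using f' by (simp add: borel_rep_def)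
      qed
    qed
  qed measurable
  have f'1: "integrable lborel f'"
  proof (rule Bochner_Integration.integrable_bound[of _ "\<lambda>x. indicator K x + (f' x)\<^sup>2"])
    show "integrable lborel (\<lambda>x. indicator K x + (f' x)\<^sup>2)" using indK f'2 by simp
    show "AE x in lborel. norm (f' x) \<le> norm (indicator K x + (f' x)\<^sup>2 :: real)"
    proof (rule AE_I2)
      fix x
      show "norm (f' x) \<le> norm (indicator K x + (f' x)\<^sup>2 :: real)"
      proof (cases "x \<in> K")
        case True
        have "0 \<le> (\<bar>f' x\<bar> - 1)\<^sup>2" by simp
        also have "\<dots> = (f' x)\<^sup>2 - 2 * \<bar>f' x\<bar> + 1" by (simp add: power2_diff)
        finally have "\<bar>f' x\<bar> \<le> 1 + (f' x)\<^sup>2" using abs_ge_zero[of "f' x"] by linarith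
        then show ?thesis using True by simp
      next
        case False
        then show ?thesis using f' by (simp add: borel_rep_def)
      qed
    qed
  qed measurable
  obtain B where B: "B \<ge> 0" "\<And>z j. norm z \<le> 2 \<Longrightarrow> norm (hess H z $ j) \<le> B"
    using hess_row_bound_on_cball[OF Hc] by blast
  \<comment> \<open>Two regimes: for |\<nabla>u| \<le> 2 compactness gives B; beyond 2 = 1 + 1 the
    Hessian lies between \<open>c 1\<close> and \<open>Cbar\<close>, and a form between 0 and
    \<open>Cbar\<close> has rows of norm at most twice \<open>Cbar\<close>.\<close>
  define \<Lambda> where "\<Lambda> = max B (2 * Cbar)"
  have rows: "AE x in lborel. x \<in> K \<longrightarrow> (\<forall>j. norm (hess H (G' x) $ j) \<le> \<Lambda>)"
  proof -
    have "AE x in lborel. x \<in> \<Omega> \<longrightarrow> loewner_le (hess H (G x)) (mat Cbar)"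
      using Cbar AE_lebesgue_on_iff[OF \<Omega>b] by (simp add: G_def)
    with Gae show ?thesis
    proof eventually_elim
      case (elim x)
      show ?case
      proof (intro impI allI)
        fix j assume x: "x \<in> K"
        show "norm (hess H (G' x) $ j) \<le> \<Lambda>"
        proof (cases "norm (G' x) \<le> 2")
          case True then show ?thesis using B(2)[OF True, of j] by (simp add: \<Lambda>_def)
        next
          case False
          then have "loewner_le (mat (c 1)) (hess H (G' x))" by (intro c(2)) auto
          moreover have "loewner_le (hess H (G' x)) (mat Cbar)" using elim x K(2) by auto
          ultimately have "norm (hess H (G' x) $ j) \<le> 2 * Cbar"
            using c(1)[of 1] by (intro loewner_row_bound) auto
          then show ?thesis by (simp add: \<Lambda>_def)
        qed
      qed
    qed
  qed
  have D'L: "integrable lborel (\<lambda>x. D' j x $ i)" "integrable lborel (\<lambda>x. (D' j x $ i)\<^sup>2)" for i j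
    by (rule borel_rep_L2[OF D' D2 K(1) order_refl Kb])+
  have W'L: "integrable lborel (\<lambda>x. W x $ i)" "integrable lborel (\<lambda>x. (W x $ i)\<^sup>2)" for i
    by (rule borel_rep_L2[OF W W2 K \<Omega>b])+
  have u'i: "integrable lborel u'" by (rule borel_rep_L1_real[OF u' u1 K(1)])
  have wi: "integrable lborel w" by (rule borel_rep_L1_real[OF w v1 K(1)])
  have G'i: "integrable lborel (\<lambda>x. G' x $ j)" for j by (rule borel_rep_L1[OF G' G1 K(1)])
  interpret sol: solution_data p R' u' f' w G' W D' "grad H" "hess H" \<delta> "c \<delta>" \<epsilon> \<Lambda> "Lp_norm (2 + \<epsilon>) \<Omega> f powr (2 + \<epsilon>)"
  proof
    show "c \<delta> > 0" "\<epsilon> > 0" by (fact c(1)[OF \<delta>] \<epsilon>)+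
    show "\<Lambda> \<ge> 0" using B(1) by (simp add: \<Lambda>_def)
    show "integrable lborel (\<lambda>x. indicator (csquare p R') x * grad H (G' x) $ j)" for j
      using Pi[of j] by (simp add: P_def K_def)
    show "AE x in lborel. x \<in> csquare p R' \<longrightarrow> (\<forall>j. norm (hess H (G' x) $ j) \<le> \<Lambda>)"
      using rows by (simp add: K_def)
    show "c \<delta> * (norm \<xi>)\<^sup>2 \<le> \<xi> \<bullet> (hess H z *v \<xi>)" if "norm z \<ge> 1 + \<delta>" for z \<xi>
      by (rule loewner_le_mat[OF c(2)[OF \<delta> that]])
    have "AE x in lborel. x \<in> K \<longrightarrow> v' x = w x" using w by (simp add: borel_rep_def)
    with Gae show "AE x in lborel. x \<in> csquare p R' \<longrightarrow> w x = max 0 (G' x $ 1 - (1 + \<delta>))"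
      by eventually_elim (auto simp: K_def[symmetric] v'_def excess_def G_def max.commute)
    show "conv u' (partial i k) x = conv (\<lambda>y. G' y $ i) k x" if "kernel r k" "cball x r \<subseteq> csquare p R'" for r k x i
      by (rule weak_grad_conv[OF wu \<Omega>b K(2) u' u'i G' G'i that[folded K_def]])
    show "conv (\<lambda>y. G' y $ j) (partial i k) x = conv (\<lambda>y. D' j y $ i) k x" if "kernel r k" "cball x r \<subseteq> csquare p R'" for r k x i j
      by (rule weak_grad_conv[OF wG \<Omega>b K(2) borel_rep_nth[OF G'] G'i D' D'L(1) that[folded K_def]])
    show "conv w (partial i k) x = conv (\<lambda>y. W y $ i) k x" if "kernel r k" "cball x r \<subseteq> csquare p R'" for r k x i
      by (rule weak_grad_conv[OF wv \<Omega>b K(2) w wi W W'L(1) that[folded K_def]])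
    show "(\<Sum>j\<in>UNIV. conv (\<lambda>y. indicator (csquare p R') y * grad H (G' y) $ j) (partial j k) x) = conv f' k x"
      if k: "kernel r k" and x: "cball x r \<subseteq> csquare p R'" for r k x
    proof -
      note test = test_function_kernel[OF k order_trans[OF x[folded K_def] K(2)]]
      have [measurable]: "k \<in> borel_measurable borel" by (rule kernel_measurable[OF k])
      have gk [measurable]: "grad k \<in> borel_measurable borel"
        using C1_grad_measurable(2)[OF smooth_C1_grad] k by (auto simp: kernel_def)
      have [measurable]: "P \<in> borel_measurable borel" using P by (simp add: borel_rep_def)
      have out: "k (x - y) = 0" "grad k (x - y) = 0" if "y \<notin> K" for y
      proof -
        have "y \<notin> cball x r" using that x by (auto simp: K_def)
        from kernel_reflect_0[OF k this] show "k (x - y) = 0" "grad k (x - y) = 0" by auto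
      qed
      have "(LINT y|lebesgue_on \<Omega>. grad H (G y) \<bullet> grad (\<lambda>y. k (x - y)) y) = (LINT y|lborel. P y \<bullet> (- grad k (x - y)))"
      proof (rule integral_lebesgue_on_eq[OF \<Omega>b])
        show "AE y in lborel. indicator \<Omega> y *\<^sub>R (grad H (G y) \<bullet> grad (\<lambda>y. k (x - y)) y) = P y \<bullet> (- grad k (x - y))"
          using Gae
        proof eventually_elim
          case (elim y)
          then show ?case using K(2) by (cases "y \<in> K") (auto simp: test(2) out P_def)
        qed
      qed measurable
      moreover have "(LINT y|lebesgue_on \<Omega>. f y * k (x - y)) = (LINT y|lborel. f' y * k (x - y))"
      proof (rule integral_lebesgue_on_eq[OF \<Omega>b])
        show "AE y in lborel. indicator \<Omega> y *\<^sub>R (f y * k (x - y)) = f' y * k (x - y)"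
          using f'[unfolded borel_rep_def, THEN conjunct2, THEN conjunct2]
        proof eventually_elim
          case (elim y)
          then show ?case using K(2) by (cases "y \<in> K") (auto simp: out)
        qed
      qed measurable
      moreover have "(LINT y|lebesgue_on \<Omega>. grad H (G y) \<bullet> grad (\<lambda>y. k (x - y)) y) = - (LINT y|lebesgue_on \<Omega>. f y * k (x - y))"
        using eq test(1) by (auto simp: weak_solution_def G_def)
      ultimately have e: "(LINT y|lborel. P y \<bullet> (- grad k (x - y))) = - (LINT y|lborel. f' y * k (x - y))" by simp
      have i: "integrable lborel (\<lambda>y. P y $ j * partial j k (x - y))" for j
        by (rule conv_integrable_integrand[OF Pi kernel_partial[OF k]])
      have "(LINT y|lborel. P y \<bullet> (- grad k (x - y))) = (LINT y|lborel. - (\<Sum>j\<in>UNIV. P y $ j * partial j k (x - y)))"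
        by (simp add: inner_vec_def grad_def sum_negf)
      also have "\<dots> = - (\<Sum>j\<in>UNIV. LINT y|lborel. P y $ j * partial j k (x - y))"
        using i by (simp add: Bochner_Integration.integral_sum)
      finally show ?thesis using e by (simp add: conv_def P_def K_def)
    qed
  qed (fact u'i G'i D'L Hd Hc f'1 f'2 f'p wi W'L)+
  obtain n0 where n0: "elliptic_square w f' W sol.Y p R (c \<delta>) \<epsilon> (Lp_norm (2 + \<epsilon>) \<Omega> f powr (2 + \<epsilon>)) n0"
    using sol.elliptic_square_solution[OF R] by blast
  have wae: "AE x in lborel. x \<in> K \<longrightarrow> v' x = w x" using w by (simp add: borel_rep_def)
  have bd: "AE x in lborel. \<bar>w x\<bar> \<le> Linf_norm \<Omega> v'"
    using Linf_bound[OF v(2) \<Omega>b] wae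
  proof eventually_elim
    case (elim x)
    show ?case
    proof (cases "x \<in> K")
      case True
      then show ?thesis using elim K(2) by (auto simp: v'_def)
    next
      case False
      then show ?thesis using w by (simp add: borel_rep_def Linf_norm_def)
    qed
  qed
  have "(LINT x|lborel. (norm (W x))\<^sup>2) \<le> (Lp_norm 2 \<Omega> (weak_grad \<Omega> v'))\<^sup>2"
    using borel_rep_L2(3)[OF W W2 K \<Omega>b] by (simp add: Lp_2_norm_square)
  also have "\<dots> \<le> (H1_norm \<Omega> v')\<^sup>2" by (simp add: H1_norm_def)
  finally show ?thesis using n0 wae bd unfolding v'_def K_def by blast
qed

subsection \<open>The continuous representative\<close>

lemma osquare_subset_ball: "osquare x t \<subseteq> ball x (2 * t)"
proof
  fix y assume "y \<in> osquare x t"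
  then have "\<bar>y $ 1 - x $ 1\<bar> < t" "\<bar>y $ 2 - x $ 2\<bar> < t" by (auto simp: osquare_def)
  moreover have "norm (y - x) \<le> \<bar>y $ 1 - x $ 1\<bar> + \<bar>y $ 2 - x $ 2\<bar>"
    using norm_le_l1_cart[of "y - x"] by (simp add: UNIV_2)
  ultimately show "y \<in> ball x (2 * t)" by (simp add: dist_norm norm_minus_commute)
qed

lemma csquare_subset_cball: "csquare x t \<subseteq> cball x (2 * t)"
proof
  fix y assume "y \<in> csquare x t"
  then have "\<bar>y $ 1 - x $ 1\<bar> \<le> t" "\<bar>y $ 2 - x $ 2\<bar> \<le> t" by (auto simp: csquare_def)
  moreover have "norm (y - x) \<le> \<bar>y $ 1 - x $ 1\<bar> + \<bar>y $ 2 - x $ 2\<bar>"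
    using norm_le_l1_cart[of "y - x"] by (simp add: UNIV_2)
  ultimately show "y \<in> cball x (2 * t)" by (simp add: dist_norm norm_minus_commute)
qed

lemma ball_subset_osquare: "ball x t \<subseteq> osquare x t"
proof
  fix y assume "y \<in> ball x t"
  then have "norm (y - x) < t" by (simp add: dist_norm norm_minus_commute)
  then show "y \<in> osquare x t"
    using component_le_norm_cart[of "y - x"] by (auto simp: osquare_def intro: le_less_trans)
qed

lemma open_contains_osquare:
  assumes "open S" "y \<in> S" shows "\<exists>t>0. osquare y t \<subseteq> S"
proof -
  obtain e where "e > 0" "ball y e \<subseteq> S" using assms open_contains_ball by blast
  then show ?thesis using osquare_subset_ball[of y "e / 2"] by (intro exI[of _ "e / 2"]) auto
qed

definition ess_close :: "(real^2 \<Rightarrow> real) \<Rightarrow> (real^2) set \<Rightarrow> real \<Rightarrow> real \<Rightarrow> bool" where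
  "ess_close v S l e \<longleftrightarrow> (AE y in lborel. y \<in> S \<longrightarrow> \<bar>v y - l\<bar> \<le> e)"

lemma ess_close_mono: "ess_close v S l e \<Longrightarrow> T \<subseteq> S \<Longrightarrow> e \<le> e' \<Longrightarrow> ess_close v T l e'"
  unfolding ess_close_def by (erule eventually_mono) auto

text \<open>The overlap is open and nonempty, hence of positive measure, so some point of it
  satisfies both estimates. This is what replaces evaluating v at a point.\<close>

lemma ess_close_overlap:
  assumes "ess_close v S a e" "ess_close v S' b e'" and o: "open S" "open S'" "z \<in> S" "z \<in> S'"
  shows "\<bar>a - b\<bar> \<le> e + e'"
proof (rule ccontr)
  assume n: "\<not> \<bar>a - b\<bar> \<le> e + e'"
  obtain t where t: "t > 0" "osquare z t \<subseteq> S \<inter> S'"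
    using open_contains_osquare[of "S \<inter> S'" z] o by auto
  have "AE y in lborel. y \<notin> osquare z t"
    using assms(1,2) unfolding ess_close_def by eventually_elim (use n t(2) in auto)
  then have "osquare z t \<in> null_sets lborel" by (subst AE_iff_null_sets) auto
  then have "emeasure lborel (osquare z t) = 0" by auto
  then show False using emeasure_csquare(2)[of t z] t(1) by simp
qed

text \<open>The value of w at x is the limit of the constants that v is essentially close to on
  shrinking squares around x; overlapping makes these constants a Cauchy sequence. The last clause
  passes an almost everywhere bound on a square to every point of it without loss, which later
  carries the modulus of continuity.\<close>

lemma continuous_representative:
  fixes v :: "real^2 \<Rightarrow> real"
  assumes \<Omega>: "open \<Omega>" and osc: "\<And>x e. x \<in> \<Omega> \<Longrightarrow> e > 0 \<Longrightarrow> \<exists>r>0. \<exists>l. ess_close v (osquare x r) l e"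
  shows "\<exists>w. continuous_on \<Omega> w \<and> (AE y in lborel. y \<in> \<Omega> \<longrightarrow> w y = v y) \<and>
    (\<forall>x r l e y. ess_close v (osquare x r) l e \<longrightarrow> y \<in> \<Omega> \<longrightarrow> y \<in> osquare x r \<longrightarrow> \<bar>w y - l\<bar> \<le> e)"
proof -
  have in0: "x \<in> osquare x r" if "r > 0" for x r using that by (simp add: osquare_def)
  have "\<exists>L. \<forall>e>0. \<exists>r>0. ess_close v (osquare x r) L e" if x: "x \<in> \<Omega>" for x
  proof -
    have "\<forall>n. \<exists>r>0. \<exists>l. ess_close v (osquare x r) l (inverse (real (Suc n)))" using osc[OF x] by auto
    then obtain r l where r: "\<And>n. r n > 0" and l: "\<And>n. ess_close v (osquare x (r n)) (l n) (inverse (real (Suc n)))" by metis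
    have d: "\<bar>l n - l m\<bar> \<le> inverse (real (Suc n)) + inverse (real (Suc m))" for n m
      by (rule ess_close_overlap[OF l l open_osquare open_osquare in0[OF r] in0[OF r]])
    have "Cauchy l"
    proof (rule metric_CauchyI)
      fix e :: real assume e: "e > 0"
      obtain N where N: "inverse (real (Suc N)) < e / 2" using reals_Archimedean[of "e / 2"] e by auto
      have "dist (l m) (l n) < e" if "m \<ge> N" "n \<ge> N" for m n
      proof -
        have "inverse (real (Suc m)) \<le> inverse (real (Suc N))" "inverse (real (Suc n)) \<le> inverse (real (Suc N))"
          using that by (auto intro!: le_imp_inverse_le)
        then show ?thesis using d[of m n] N by (simp only: dist_real_def)
      qed
      then show "\<exists>M. \<forall>m\<ge>M. \<forall>n\<ge>M. dist (l m) (l n) < e" by blast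
    qed
    then obtain L where L: "l \<longlonglongrightarrow> L" using Cauchy_convergent convergentD by blast
    have lL: "\<bar>l n - L\<bar> \<le> inverse (real (Suc n))" for n
    proof (rule LIMSEQ_le[of "\<lambda>m. \<bar>l n - l m\<bar>"])
      show "(\<lambda>m. \<bar>l n - l m\<bar>) \<longlonglongrightarrow> \<bar>l n - L\<bar>" by (intro tendsto_intros L)
      have "(\<lambda>m. inverse (real (Suc n)) + inverse (real (Suc m))) \<longlonglongrightarrow> inverse (real (Suc n)) + 0"
        by (intro tendsto_intros LIMSEQ_inverse_real_of_nat)
      then show "(\<lambda>m. inverse (real (Suc n)) + inverse (real (Suc m))) \<longlonglongrightarrow> inverse (real (Suc n))" by simp
      show "\<exists>N. \<forall>m\<ge>N. \<bar>l n - l m\<bar> \<le> inverse (real (Suc n)) + inverse (real (Suc m))" using d by blast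
    qed
    have "\<exists>r>0. ess_close v (osquare x r) L e" if e: "e > 0" for e
    proof -
      obtain n where n: "inverse (real (Suc n)) < e / 2" using reals_Archimedean[of "e / 2"] e by auto
      have "ess_close v (osquare x (r n)) L e"
        unfolding ess_close_def using l[of n, unfolded ess_close_def]
      proof eventually_elim
        case (elim y)
        then show ?case using lL[of n] n by (auto simp: abs_le_iff)
      qed
      then show ?thesis using r by blast
    qed
    then show ?thesis by blast
  qed
  then obtain w where w: "\<And>x e. x \<in> \<Omega> \<Longrightarrow> e > 0 \<Longrightarrow> \<exists>r>0. ess_close v (osquare x r) (w x) e" by metis
  have key: "\<bar>w y - l\<bar> \<le> e" if c: "ess_close v (osquare x r) l e" and y: "y \<in> \<Omega>" "y \<in> osquare x r" for x r l e y
  proof (rule field_le_epsilon)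
    fix \<eta> :: real assume "\<eta> > 0"
    then obtain r' where r': "r' > 0" "ess_close v (osquare y r') (w y) \<eta>" using w[OF y(1)] by blast
    have "\<bar>w y - l\<bar> \<le> \<eta> + e"
      by (rule ess_close_overlap[OF r'(2) c open_osquare open_osquare in0[OF r'(1)] y(2)])
    then show "\<bar>w y - l\<bar> \<le> e + \<eta>" by simp
  qed
  have "continuous_on \<Omega> w"
    unfolding continuous_on_iff
  proof (intro ballI allI impI)
    fix x e assume x: "x \<in> \<Omega>" and e: "(e::real) > 0"
    obtain r l where r: "r > 0" "ess_close v (osquare x r) l (e / 3)" using osc[OF x, of "e / 3"] e by auto
    have "dist (w y) (w x) < e" if "y \<in> \<Omega>" "dist y x < r" for y
    proof -
      have "y \<in> osquare x r" using that ball_subset_osquare[of x r] by (auto simp: dist_commute)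
      then have "\<bar>w y - l\<bar> \<le> e / 3" "\<bar>w x - l\<bar> \<le> e / 3"
        using key[OF r(2) that(1)] key[OF r(2) x in0[OF r(1)]] by auto
      then show ?thesis using e unfolding dist_real_def by linarith
    qed
    then show "\<exists>d>0. \<forall>y\<in>\<Omega>. dist y x < d \<longrightarrow> dist (w y) (w x) < e" using r(1) by blast
  qed
  moreover have "AE y in lborel. y \<in> \<Omega> \<longrightarrow> w y = v y"
  proof -
    have "AE y in lborel. y \<in> \<Omega> \<longrightarrow> \<bar>w y - v y\<bar> \<le> 2 * inverse (real (Suc n))" for n
    proof -
      have "\<forall>x\<in>\<Omega>. \<exists>r. r > 0 \<and> (\<exists>l. ess_close v (osquare x r) l (inverse (real (Suc n))))"
        using osc by (simp del: of_nat_Suc)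
      then obtain r where r: "\<And>x. x \<in> \<Omega> \<Longrightarrow> r x > 0" "\<And>x. x \<in> \<Omega> \<Longrightarrow> \<exists>l. ess_close v (osquare x (r x)) l (inverse (real (Suc n)))"
        by metis
      have "\<And>S. S \<in> (\<lambda>x. osquare x (r x)) ` \<Omega> \<Longrightarrow> open S" using open_osquare by auto
      \<comment> \<open>Each square yields its own exceptional null set, so a countable subcover is
        needed before they can be united.\<close>
      then obtain \<F> where \<F>: "\<F> \<subseteq> (\<lambda>x. osquare x (r x)) ` \<Omega>" "countable \<F>" "\<Union>\<F> = \<Union>((\<lambda>x. osquare x (r x)) ` \<Omega>)"
        using Lindelof[of "(\<lambda>x. osquare x (r x)) ` \<Omega>"] by metis
      have cov: "\<Omega> \<subseteq> \<Union>\<F>" unfolding \<F>(3) using in0 r(1) by blast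
      have one: "AE y in lborel. y \<in> S \<longrightarrow> y \<in> \<Omega> \<longrightarrow> \<bar>w y - v y\<bar> \<le> 2 * inverse (real (Suc n))" if S: "S \<in> \<F>" for S
      proof -
        obtain x where x: "x \<in> \<Omega>" "S = osquare x (r x)" using subsetD[OF \<F>(1) S] by blast
        obtain l where l: "ess_close v (osquare x (r x)) l (inverse (real (Suc n)))" using r(2)[OF x(1)] by blast
        show ?thesis
          using l[unfolded ess_close_def]
        proof eventually_elim
          case (elim y)
          show ?case
          proof (intro impI)
            assume "y \<in> S" "y \<in> \<Omega>"
            then have "\<bar>w y - l\<bar> \<le> inverse (real (Suc n))" "\<bar>v y - l\<bar> \<le> inverse (real (Suc n))"
              using key[OF l] elim x by auto
            then show "\<bar>w y - v y\<bar> \<le> 2 * inverse (real (Suc n))" by linarith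
          qed
        qed
      qed
      have "AE y in lborel. \<forall>S\<in>\<F>. y \<in> S \<longrightarrow> y \<in> \<Omega> \<longrightarrow> \<bar>w y - v y\<bar> \<le> 2 * inverse (real (Suc n))"
        using one \<F>(2) by (subst AE_ball_countable) auto
      then show ?thesis by (rule eventually_mono) (use cov in blast)
    qed
    then have "AE y in lborel. \<forall>n. y \<in> \<Omega> \<longrightarrow> \<bar>w y - v y\<bar> \<le> 2 * inverse (real (Suc n))"
      unfolding AE_all_countable by blast
    then show ?thesis
    proof eventually_elim
      case (elim y)
      show ?case
      proof
        assume y: "y \<in> \<Omega>"
        have "(\<lambda>n. 2 * inverse (real (Suc n))) \<longlonglongrightarrow> 2 * 0" by (intro tendsto_intros LIMSEQ_inverse_real_of_nat)
        then have "\<bar>w y - v y\<bar> \<le> 2 * 0" by (rule LIMSEQ_le_const) (use elim y in auto)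
        then show "w y = v y" by simp
      qed
    qed
  qed
  ultimately show ?thesis using key by blast
qed

text \<open>A ball is connected: if it meets \<open>\<Omega>\<close> without being contained in it,
  it contains a frontier point, and that point is closer to x than the assumed distance.\<close>

lemma ball_subset_of_set_edist:
  fixes \<Omega> :: "'a::euclidean_space set"
  assumes "open \<Omega>" "\<Omega>0 \<subseteq> \<Omega>" "x \<in> \<Omega>0" and d: "d > 0" "ennreal d \<le> set_edist \<Omega>0 (frontier \<Omega>)"
  shows "ball x d \<subseteq> \<Omega>"
proof (rule ccontr)
  assume "\<not> ball x d \<subseteq> \<Omega>"
  moreover have "x \<in> ball x d \<inter> \<Omega>" using assms(2,3) d(1) by auto
  ultimately have "ball x d \<inter> frontier \<Omega> \<noteq> {}"
    using connected_Int_frontier[OF connected_ball] by blast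
  then obtain b where b: "b \<in> frontier \<Omega>" "dist x b < d" by auto
  have "set_edist \<Omega>0 (frontier \<Omega>) \<le> ennreal (dist x b)"
    unfolding set_edist_def by (rule INF_lower2[OF assms(3)], rule INF_lower2[OF b(1)]) simp
  then have "ennreal d \<le> ennreal (dist x b)" using d(2) by (rule order_trans[rotated])
  then show False using b(2) by (simp add: ennreal_le_iff)
qed

section \<open>Explicit constants and elementary logarithm estimates\<close>

text \<open>The defect of the maximum principle for R = 1; for general R it scales with
  \<open>R powr \<beta>\<close>.\<close>

definition defect :: "real \<Rightarrow> real \<Rightarrow> real \<Rightarrow> real" where
  "defect c \<beta> N = sqrt (4 * (4 * (N + 1) / c\<^sup>2) * 4 powr \<beta> * 4 powr (1 / \<beta>))"

lemma sup_defect_eq: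
  assumes "R > 0" "N \<ge> 0"
  shows "sqrt (4 * (4 * (N + 1) / c\<^sup>2) * (4 * R\<^sup>2) powr \<beta> * 4 powr (1 / \<beta>)) = defect c \<beta> N * R powr \<beta>"
proof -
  have "(4 * R\<^sup>2) powr \<beta> = 4 powr \<beta> * (R powr \<beta>)\<^sup>2"
    using assms by (simp add: powr_mult power2_eq_square)
  then have "4 * (4 * (N + 1) / c\<^sup>2) * (4 * R\<^sup>2) powr \<beta> * 4 powr (1 / \<beta>) =
    (4 * (4 * (N + 1) / c\<^sup>2) * 4 powr \<beta> * 4 powr (1 / \<beta>)) * (R powr \<beta>)\<^sup>2"
    by simp
  also have "sqrt \<dots> = defect c \<beta> N * sqrt ((R powr \<beta>)\<^sup>2)" unfolding defect_def by (rule real_sqrt_mult)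
  finally show ?thesis by simp
qed

text \<open>From ln s \<le> s at s = 1 / t powr \<beta>, followed by a square root. It lets the
  power error of the maximum principle be absorbed into the logarithmic modulus.\<close>

lemma power_le_log_bound:
  assumes t: "0 < t" "t < 1" and \<beta>: "\<beta> > 0"
  shows "(sqrt t) powr \<beta> \<le> 1 / sqrt \<beta> * (1 / sqrt (- ln t))"
proof -
  have L: "- ln t > 0" using t by simp
  have tb: "t powr \<beta> > 0" using t by simp
  have "\<beta> * (- ln t) = ln (1 / t powr \<beta>)" using t by (simp add: ln_div ln_powr)
  also have "\<dots> \<le> 1 / t powr \<beta>" using tb by (intro less_imp_le ln_less_self) simp
  finally have "t powr \<beta> * (\<beta> * (- ln t)) \<le> t powr \<beta> * (1 / t powr \<beta>)" by (rule mult_left_mono) simp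
  then have "t powr \<beta> * (\<beta> * (- ln t)) \<le> 1" using tb by simp
  then have "t powr \<beta> \<le> 1 / (\<beta> * (- ln t))" using L \<beta> by (subst pos_le_divide_eq) (auto intro: mult_pos_neg)
  then have "sqrt (t powr \<beta>) \<le> sqrt (1 / (\<beta> * (- ln t)))" by (rule real_sqrt_le_mono)
  also have "sqrt (1 / (\<beta> * (- ln t))) = 1 / sqrt \<beta> * (1 / sqrt (- ln t))"
    by (simp only: real_sqrt_divide real_sqrt_mult real_sqrt_one times_divide_times_eq mult_1)
  also have "sqrt (t powr \<beta>) = (sqrt t) powr \<beta>"
    using t by (simp add: powr_half_sqrt[symmetric] powr_powr mult.commute)
  finally show ?thesis .
qed

text \<open>The ratio is 1 / (2 sqrt t), with logarithm - ln t / 2 - ln 2. The threshold 1 / 16 is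
  where ln 2 becomes at most a quarter of - ln t.\<close>

lemma log_ratio_bound:
  assumes t: "0 < t" "t \<le> 1 / 16" shows "- ln t / 4 \<le> ln (sqrt t / (2 * t))"
proof -
  have "ln t \<le> ln (1 / 16)" using t by (subst ln_le_cancel_iff) auto
  also have "ln (1 / 16 :: real) = - (4 * ln 2)"
    using ln_realpow[of "2 :: real" 4] by (simp add: ln_div)
  finally have "4 * ln 2 \<le> - ln t" by simp
  moreover have "ln (sqrt t / (2 * t)) = - ln t / 2 - ln 2"
    using t by (simp add: ln_div ln_mult ln_sqrt)
  ultimately show ?thesis by simp
qed

text \<open>The summands come from the boundary oscillation, from the defect of the maximum
  principle, and from pairs of points too far apart for either, where twice the sup bound is used. F
  is the norm of f, so its power 2 + \<epsilon> is the integral bound N. Truncating the distance at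
  1 makes it a real number.\<close>

definition modulus_constant :: "real \<Rightarrow> real \<Rightarrow> real \<Rightarrow> real \<Rightarrow> real \<Rightarrow> real \<Rightarrow> ennreal \<Rightarrow> real" where
  "modulus_constant \<epsilon> F B E c Cbar d =
     4 * sqrt (32 * (E\<^sup>2 + 1)) + 2 * (defect c (\<epsilon> / (2 + \<epsilon>)) (F powr (2 + \<epsilon>)) / sqrt (\<epsilon> / (2 + \<epsilon>)))
     + 2 * B * sqrt (- ln ((enn2real (min d 1))\<^sup>2 / 16))"

theorem theorem8:
  shows "\<exists>C :: real \<Rightarrow> real \<Rightarrow> real \<Rightarrow> real \<Rightarrow> real \<Rightarrow> real \<Rightarrow> ennreal \<Rightarrow> real.
    \<forall>(\<Omega> :: (real^2) set) (H :: real^2 \<Rightarrow> real) (c :: real \<Rightarrow> real) (\<epsilon> :: real)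
      (f :: real^2 \<Rightarrow> real) (u :: real^2 \<Rightarrow> real) (\<delta> :: real) (Cbar :: real).
      open \<Omega> \<and> convex_on UNIV H \<and> C2 H \<and>
      (\<forall>d>0. c d > 0 \<and> (\<forall>z. norm z \<ge> 1 + d \<longrightarrow> loewner_le (mat (c d)) (hess H z))) \<and>
      \<epsilon> > 0 \<and> f \<in> Lp (2 + \<epsilon>) \<Omega> \<and>
      u \<in> H2_loc \<Omega> \<and> weak_solution \<Omega> (grad H) f u \<and>
      \<delta> > 0 \<and> excess \<Omega> u \<delta> \<in> H1 \<Omega> \<inter> Linf \<Omega> \<and>
      (AE x in lebesgue_on \<Omega>. loewner_le (hess H (weak_grad \<Omega> u x)) (mat Cbar))
      \<longrightarrow>
      (\<exists>w. continuous_on \<Omega> w \<and> (AE x in lebesgue_on \<Omega>. w x = excess \<Omega> u \<delta> x) \<and>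
        (\<forall>\<Omega>0. \<Omega>0 \<subseteq> \<Omega> \<and> set_edist \<Omega>0 (frontier \<Omega>) > 0 \<longrightarrow>
          (\<forall>x\<in>\<Omega>0. \<forall>y\<in>\<Omega>0. 0 < norm (x - y) \<and> norm (x - y) < 1 \<longrightarrow>
            \<bar>w x - w y\<bar> \<le>
              C \<epsilon> (Lp_norm (2 + \<epsilon>) \<Omega> f) (Linf_norm \<Omega> (excess \<Omega> u \<delta>)) (H1_norm \<Omega> (excess \<Omega> u \<delta>))
                (c \<delta>) Cbar (set_edist \<Omega>0 (frontier \<Omega>))
              * \<bar>ln (norm (x - y))\<bar> powr (-1/2))))"
proof (intro exI[of _ modulus_constant] allI impI)
  fix \<Omega> :: "(real^2) set" and H :: "real^2 \<Rightarrow> real" and c :: "real \<Rightarrow> real" and \<epsilon> :: real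
    and f :: "real^2 \<Rightarrow> real" and u :: "real^2 \<Rightarrow> real" and \<delta> Cbar :: real
  assume asm: "open \<Omega> \<and> convex_on UNIV H \<and> C2 H \<and>
      (\<forall>d>0. c d > 0 \<and> (\<forall>z. norm z \<ge> 1 + d \<longrightarrow> loewner_le (mat (c d)) (hess H z))) \<and>
      \<epsilon> > 0 \<and> f \<in> Lp (2 + \<epsilon>) \<Omega> \<and>
      u \<in> H2_loc \<Omega> \<and> weak_solution \<Omega> (grad H) f u \<and>
      \<delta> > 0 \<and> excess \<Omega> u \<delta> \<in> H1 \<Omega> \<inter> Linf \<Omega> \<and>
      (AE x in lebesgue_on \<Omega>. loewner_le (hess H (weak_grad \<Omega> u x)) (mat Cbar))"
  then have \<Omega>: "open \<Omega>" and \<epsilon>: "\<epsilon> > 0" and \<delta>: "\<delta> > 0" and Linf: "excess \<Omega> u \<delta> \<in> Linf \<Omega>" by auto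
  have \<Omega>b: "\<Omega> \<in> sets borel" using \<Omega> by simp
  have c\<delta>: "c \<delta> > 0" using asm \<delta> by blast
  define v where "v = excess \<Omega> u \<delta>"
  define N where "N = Lp_norm (2 + \<epsilon>) \<Omega> f powr (2 + \<epsilon>)"
  define B where "B = Linf_norm \<Omega> v"
  \<comment> \<open>The summand 1 turns the energy bound into the strict inequality required for the
    oscillation estimate, also when the norm is 0.\<close>
  define E where "E = (H1_norm \<Omega> v)\<^sup>2 + 1"
  define \<beta> where "\<beta> = \<epsilon> / (2 + \<epsilon>)"
  define Kd where "Kd = defect (c \<delta>) \<beta> N"
  have \<beta>: "\<beta> > 0" using \<epsilon> by (simp add: \<beta>_def)
  have N0: "N \<ge> 0" by (simp add: N_def)
  have B0: "B \<ge> 0" by (simp add: B_def Linf_norm_def)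
  have E0: "E > 0" by (simp add: E_def add_nonneg_pos)
  have Kd0: "Kd \<ge> 0" using N0 by (simp add: Kd_def defect_def)
  have osc: "\<exists>l. ess_close v (osquare x r) l (2 * sqrt (8 * E / ln (R / r)) + Kd * R powr \<beta>)"
    if R: "0 < r" "r < R" "R < R'" "csquare x R' \<subseteq> \<Omega>" for x r R R'
  proof -
    have R0: "0 < R" using R by simp
    obtain w f' W Y n0 where es: "elliptic_square w f' W Y x R (c \<delta>) \<epsilon> N n0"
      and ae: "AE y in lborel. y \<in> csquare x R' \<longrightarrow> v y = w y" "AE y in lborel. \<bar>w y\<bar> \<le> B"
      and en: "(LINT y|lborel. (norm (W y))\<^sup>2) \<le> (H1_norm \<Omega> v)\<^sup>2"
      using local_elliptic_square[of \<Omega> H c \<epsilon> f u \<delta> Cbar R R' x] asm R0 R unfolding v_def N_def B_def by blast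
    interpret es: elliptic_square w f' W Y x R "c \<delta>" \<epsilon> N n0 by (rule es)
    obtain l where l: "AE y in lborel. y \<in> osquare x r \<longrightarrow> \<bar>w y - l\<bar> \<le> 2 * sqrt (8 * E / ln (R / r)) + es.sup_defect"
      using es.essential_oscillation[OF R(1,2) ae(2), of E] en by (auto simp: E_def)
    have sd: "es.sup_defect = Kd * R powr \<beta>"
      unfolding es.sup_defect_def Kd_def \<beta>_def by (rule sup_defect_eq[OF R0 N0])
    have "ess_close v (osquare x r) l (2 * sqrt (8 * E / ln (R / r)) + Kd * R powr \<beta>)"
      unfolding ess_close_def using l[unfolded sd] ae(1)
      by eventually_elim (use osquare_subset_csquare[of r R' x] R in auto)
    then show ?thesis by blast
  qed
  have small: "\<exists>r>0. \<exists>l. ess_close v (osquare x r) l e" if x: "x \<in> \<Omega>" and e: "e > 0" for x e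
  proof -
    obtain d where d: "d > 0" "ball x d \<subseteq> \<Omega>" using \<Omega> x open_contains_ball by blast
    have "((\<lambda>R. Kd * R powr \<beta>) \<longlongrightarrow> Kd * 0) (at_right 0)"
      using \<beta> by (intro tendsto_intros tendsto_zero_powrI[of _ _ _ \<beta>] tendsto_ident_at) (auto simp: eventually_at_filter)
    then have "\<forall>\<^sub>F R in at_right 0. Kd * R powr \<beta> < e / 2"
      using e by (intro order_tendstoD(2)) auto
    moreover have "\<forall>\<^sub>F R in at_right 0. R < d / 4" 
      unfolding eventually_at_right_field by (rule exI[of _ "d / 4"]) (use d(1) in auto)
    ultimately have "\<forall>\<^sub>F R in at_right 0. Kd * R powr \<beta> < e / 2 \<and> R < d / 4 \<and> 0 < R"
      using eventually_at_right_less[of 0] by eventually_elim auto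
    then obtain R where R: "Kd * R powr \<beta> < e / 2" "R < d / 4" "0 < R"
      using eventually_happens[of _ "at_right (0::real)"] trivial_limit_at_right_real by blast
    \<comment> \<open>R is fixed first to make the defect small, then r is taken so small that ln (R
      / r) = M; this value makes the oscillation term equal to e / 2.\<close>
    define M where "M = 8 * E * (4 / e)\<^sup>2"
    have M: "M > 0" using E0 e by (simp add: M_def)
    define r where "r = R * exp (- M)"
    have r: "0 < r" "r < R" using R M by (auto simp: r_def)
    have "ln (R / r) = M" using R by (simp add: r_def ln_div ln_mult)
    then have "2 * sqrt (8 * E / ln (R / r)) = e / 2"
      using E0 e by (simp add: M_def real_sqrt_divide real_sqrt_mult)
    moreover have "csquare x (d / 4) \<subseteq> \<Omega>"
      using csquare_subset_cball[of x "d / 4"] d by (force simp: subset_iff)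
    ultimately obtain l where "ess_close v (osquare x r) l (e / 2 + Kd * R powr \<beta>)"
      using osc[OF r R(2), of x] by auto
    then have "ess_close v (osquare x r) l e" by (rule ess_close_mono) (use R(1) in auto)
    then show ?thesis using r(1) by blast
  qed
  obtain w where w: "continuous_on \<Omega> w" "AE y in lborel. y \<in> \<Omega> \<longrightarrow> w y = v y"
    and key: "\<And>x r l e y. ess_close v (osquare x r) l e \<Longrightarrow> y \<in> \<Omega> \<Longrightarrow> y \<in> osquare x r \<Longrightarrow> \<bar>w y - l\<bar> \<le> e"
    using continuous_representative[OF \<Omega> small] by blast
  have wB: "\<bar>w x\<bar> \<le> B" if x: "x \<in> \<Omega>" for x
  proof -
    obtain t where t: "t > 0" "osquare x t \<subseteq> \<Omega>" using open_contains_osquare[OF \<Omega> x] by blast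
    \<comment> \<open>The essential bound is closeness to the constant 0, which \<open>key\<close>
      turns into a bound at every point.\<close>
    have "ess_close v (osquare x t) 0 B"
      unfolding ess_close_def using Linf_bound[OF Linf \<Omega>b] by eventually_elim (use t in \<open>auto simp: v_def B_def\<close>)
    moreover have "x \<in> osquare x t" using t by (simp add: osquare_def)
    ultimately show ?thesis using key[of x t 0 B x] x by simp
  qed
  have est: "\<bar>w x - w y\<bar> \<le> modulus_constant \<epsilon> (Lp_norm (2 + \<epsilon>) \<Omega> f) (Linf_norm \<Omega> v) (H1_norm \<Omega> v)
      (c \<delta>) Cbar (set_edist \<Omega>0 (frontier \<Omega>)) * \<bar>ln (norm (x - y))\<bar> powr (-1/2)"
    if \<Omega>0: "\<Omega>0 \<subseteq> \<Omega>" "set_edist \<Omega>0 (frontier \<Omega>) > 0" and xy: "x \<in> \<Omega>0" "y \<in> \<Omega>0" "0 < norm (x - y)" "norm (x - y) < 1" for \<Omega>0 x y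
  proof -
    define t where "t = norm (x - y)"
    \<comment> \<open>The minimum with 1 keeps d finite when the frontier is empty, and d \<le> 1
      later yields t \<le> 1 / 16.\<close>
    define d where "d = enn2real (min (set_edist \<Omega>0 (frontier \<Omega>)) 1)"
    have t: "0 < t" "t < 1" using xy by (auto simp: t_def)
    have dm: "ennreal d = min (set_edist \<Omega>0 (frontier \<Omega>)) 1"
      unfolding d_def by (intro ennreal_enn2real) (simp add: min_less_iff_disj)
    have d0: "d > 0" using \<Omega>0(2) dm by (metis ennreal_eq_0_iff ennreal_neg linorder_not_le min_less_iff_conj not_gr_zero zero_less_one)
    have d1: "d \<le> 1" using dm by (metis ennreal_le_1 min.cobounded2)
    have ball: "ball x d \<subseteq> \<Omega>"
      by (rule ball_subset_of_set_edist[OF \<Omega> \<Omega>0(1) xy(1) d0]) (simp add: dm)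
    define L where "L = - ln t"
    have L: "L > 0" using t by (simp add: L_def)
    have pw: "\<bar>ln (norm (x - y))\<bar> powr (-1/2) = 1 / sqrt L"
      using L by (simp add: L_def t_def[symmetric] powr_minus_divide powr_half_sqrt)
    have xO: "x \<in> \<Omega>" "y \<in> \<Omega>" using xy \<Omega>0 by auto
    have t0: "- ln (d\<^sup>2 / 16) \<ge> 0" using d0 d1 power_le_one[of d 2] by simp
    have C: "modulus_constant \<epsilon> (Lp_norm (2 + \<epsilon>) \<Omega> f) (Linf_norm \<Omega> v) (H1_norm \<Omega> v) (c \<delta>) Cbar (set_edist \<Omega>0 (frontier \<Omega>))
      = 4 * sqrt (32 * E) + 2 * (Kd / sqrt \<beta>) + 2 * B * sqrt (- ln (d\<^sup>2 / 16))"
      by (simp add: modulus_constant_def E_def Kd_def \<beta>_def N_def B_def d_def)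
    have nn: "0 \<le> 4 * sqrt (32 * E)" "0 \<le> 2 * (Kd / sqrt \<beta>)" "0 \<le> 2 * B * sqrt (- ln (d\<^sup>2 / 16))"
      using E0 Kd0 \<beta> B0 t0 by auto
    have "\<bar>w x - w y\<bar> \<le> (4 * sqrt (32 * E) + 2 * (Kd / sqrt \<beta>) + 2 * B * sqrt (- ln (d\<^sup>2 / 16))) * (1 / sqrt L)"
    \<comment> \<open>If t is not small compared with d, then |ln t| is at most - ln (d^2 / 16), and
      the trivial bound 2 B already has the required form.\<close>
    proof (cases "t < d\<^sup>2 / 16")
      case False
      then have "L \<le> - ln (d\<^sup>2 / 16)" using d0 t unfolding L_def by (simp add: not_less)
      then have "sqrt L \<le> sqrt (- ln (d\<^sup>2 / 16))" by simp
      then have "1 \<le> sqrt (- ln (d\<^sup>2 / 16)) * (1 / sqrt L)" using L by (simp add: field_simps)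
      then have "2 * B * 1 \<le> 2 * B * (sqrt (- ln (d\<^sup>2 / 16)) * (1 / sqrt L))" using B0 by (intro mult_left_mono) auto
      moreover have "\<bar>w x - w y\<bar> \<le> 2 * B" using wB[OF xO(1)] wB[OF xO(2)] by linarith
      moreover have "0 \<le> (4 * sqrt (32 * E) + 2 * (Kd / sqrt \<beta>)) * (1 / sqrt L)" using nn L by (intro mult_nonneg_nonneg add_nonneg_nonneg) auto
      moreover have "(4 * sqrt (32 * E) + 2 * (Kd / sqrt \<beta>) + 2 * B * sqrt (- ln (d\<^sup>2 / 16))) * (1 / sqrt L)
        = (4 * sqrt (32 * E) + 2 * (Kd / sqrt \<beta>)) * (1 / sqrt L) + 2 * B * (sqrt (- ln (d\<^sup>2 / 16)) * (1 / sqrt L))"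
        by (simp only: distrib_right mult.assoc)
      ultimately show ?thesis by linarith
    next
      case True
      have t16: "t \<le> 1 / 16" using True d0 d1 power_le_one[of d 2] by simp
      \<comment> \<open>Smallness of t gives 4 R < d, so the square of half-side 2 R fits into the
        ball of radius d inside \<open>\<Omega>\<close>. The inner half-side 2 t exceeds the
        distance t, so that square contains both points.\<close>
      define R where "R = sqrt t"
      have R0: "R > 0" using t by (simp add: R_def)
      have "R < sqrt (d\<^sup>2 / 16)" unfolding R_def using True by simp
      then have R4: "4 * R < d" using d0 by (simp add: real_sqrt_divide)
      have "R \<le> sqrt (1 / 16)" unfolding R_def using t16 by (rule real_sqrt_le_mono)
      then have "R \<le> 1 / 4" by (simp add: real_sqrt_divide)
      moreover have tR: "t = R * R" using t by (simp add: R_def)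
      ultimately have "2 * t \<le> 2 * (R * (1 / 4))" using R0 by simp
      then have rR: "2 * t < R" using R0 by simp
      have "csquare x (2 * R) \<subseteq> \<Omega>"
        using csquare_subset_cball[of x "2 * R"] ball R4 by (force simp: subset_iff)
      then obtain l where l: "ess_close v (osquare x (2 * t)) l (2 * sqrt (8 * E / ln (R / (2 * t))) + Kd * R powr \<beta>)"
        using osc[of "2 * t" R "2 * R" x] t rR R0 by auto
      have xs: "x \<in> osquare x (2 * t)" using t by (simp add: osquare_def)
      have ys: "y \<in> osquare x (2 * t)"
        using ball_subset_osquare[of x "2 * t"] t by (auto simp: dist_norm t_def)
      have "\<bar>w x - w y\<bar> \<le> 2 * (2 * sqrt (8 * E / ln (R / (2 * t))) + Kd * R powr \<beta>)"
      proof -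
        have "\<bar>a - b\<bar> \<le> 2 * q" if "\<bar>a - l\<bar> \<le> q" "\<bar>b - l\<bar> \<le> q" for a b q :: real
          using that by linarith
        then show ?thesis using key[OF l xO(1) xs] key[OF l xO(2) ys] .
      qed
      also have "\<dots> \<le> 2 * (2 * (sqrt (32 * E) * (1 / sqrt L)) + Kd * (1 / sqrt \<beta> * (1 / sqrt L)))"
      proof (intro mult_left_mono add_mono)
        have "8 * E / ln (R / (2 * t)) \<le> 8 * E / (L / 4)"
          using log_ratio_bound[OF t(1) t16] L E0 unfolding R_def L_def[symmetric]
          by (intro divide_left_mono mult_pos_pos) auto
        then have "sqrt (8 * E / ln (R / (2 * t))) \<le> sqrt (32 * E / L)" by (intro real_sqrt_le_mono) simp
        then show "sqrt (8 * E / ln (R / (2 * t))) \<le> sqrt (32 * E) * (1 / sqrt L)" by (simp add: real_sqrt_divide)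
        show "R powr \<beta> \<le> 1 / sqrt \<beta> * (1 / sqrt L)"
          unfolding R_def L_def by (rule power_le_log_bound[OF t \<beta>])
      qed (use Kd0 in auto)
      also have "\<dots> = (4 * sqrt (32 * E) + 2 * (Kd / sqrt \<beta>)) * (1 / sqrt L)" by (simp add: algebra_simps)
      also have "\<dots> \<le> (4 * sqrt (32 * E) + 2 * (Kd / sqrt \<beta>) + 2 * B * sqrt (- ln (d\<^sup>2 / 16))) * (1 / sqrt L)"
        using nn(3) L by (intro mult_right_mono) auto
      finally show ?thesis .
    qed
    then show ?thesis unfolding C pw .
  qed
  show "\<exists>w. continuous_on \<Omega> w \<and> (AE x in lebesgue_on \<Omega>. w x = excess \<Omega> u \<delta> x) \<and>
        (\<forall>\<Omega>0. \<Omega>0 \<subseteq> \<Omega> \<and> set_edist \<Omega>0 (frontier \<Omega>) > 0 \<longrightarrow>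
          (\<forall>x\<in>\<Omega>0. \<forall>y\<in>\<Omega>0. 0 < norm (x - y) \<and> norm (x - y) < 1 \<longrightarrow>
            \<bar>w x - w y\<bar> \<le>
              modulus_constant \<epsilon> (Lp_norm (2 + \<epsilon>) \<Omega> f) (Linf_norm \<Omega> (excess \<Omega> u \<delta>)) (H1_norm \<Omega> (excess \<Omega> u \<delta>))
                (c \<delta>) Cbar (set_edist \<Omega>0 (frontier \<Omega>))
              * \<bar>ln (norm (x - y))\<bar> powr (-1/2)))"
    unfolding v_def[symmetric]
  proof (intro exI[of _ w] conjI allI impI ballI)
    show "continuous_on \<Omega> w" by (rule w)
    show "AE x in lebesgue_on \<Omega>. w x = v x" using w(2) AE_lebesgue_on_iff[OF \<Omega>b] by simp
  qed (use est in blast)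
qed

end
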